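(* Let $\Omega=(0,1)^2$ and $f\in L^2(\Omega)$. Consider the Helmholtz equation $\Delta u+k^2u=-f$ in $\Omega$ with homogeneous boundary conditions $\mathcal{B}_ju=0$ on $\Gamma_j$ for $j=1,\dots,4$, where $\mathcal{B}_1,\mathcal{B}_3\in\{\mathbf{I}_d,\frac{\partial}{\partial\nu}\}$, $\mathcal{B}_2\in\{\mathbf{I}_d,\frac{\partial}{\partial\nu},\frac{\partial}{\partial\nu}-ik\mathbf{I}_d\}$ and $\mathcal{B}_4=\frac{\partial}{\partial\nu}-ik\mathbf{I}_d$. Let $u$ be the unique weak solution. (1) For $\mathcal{B}_2=\mathbf{I}_d$, if $u\in H^2(\Omega)$, then $$\|\nabla u\|_{0,\Omega}+k\|u\|_{0,\Omega}\le\sqrt{30}\,\max\{k^2,1\}\,\|f\|_{0,\Omega},\qquad\forall\,k>0.$$ (2) For $\mathcal{B}_2\in\{\frac{\partial}{\partial\nu},\frac{\partial}{\partial\nu}-ik\mathbf{I}_d\}$, if $u\in H^2(\Omega)$, then $$\|\nabla u\|_{0,\Omega}+k\|u\|_{0,\Omega}\le\sqrt{542}\,\max\{k^2,k^{-1/2}\}\,\|f\|_{0,\Omega},\qquad\forall\,k>0.$$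
   Context: All functions are complex valued. $\Omega:=(0,1)^2$ with sides $\Gamma_1:=(0,1)\times\{0\}$, $\Gamma_2:=\{1\}\times(0,1)$, $\Gamma_3:=(0,1)\times\{1\}$, $\Gamma_4:=\{0\}\times(0,1)$. On $\Gamma_j$ the boundary operator $\mathcal{B}_j$ is $\mathbf{I}_d$ ($\mathbf{I}_du=u$, Dirichlet), $\frac{\partial}{\partial\nu}$ (Neumann), or $\frac{\partial}{\partial\nu}-ik\mathbf{I}_d$ (impedance), with $\nu$ the outward normal vector and $k>0$ a constant. $\Gamma_D$ and $\Gamma_R$ denote the unions of the sides carrying respectively Dirichlet and impedance conditions, and $\mathcal{H}:=\{v\in H^1(\Omega):v=0\text{ on }\Gamma_D\}$. The weak solution is the unique $u\in\mathcal{H}$ (existence and uniqueness hold) with $$\int_\Omega(\nabla u\cdot\nabla\overline v-k^2u\overline v)-ik\int_{\Gamma_R}u\overline v=\int_\Omega f\overline v\quad\forall v\in\mathcal{H}.$$ $\|\cdot\|_{0,\Omega}$ denotes the $L^2(\Omega)$ norm. *)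

theory Defs
  imports "HOL-Analysis.Analysis"
begin

section \<open>Lebesgue and Sobolev spaces of complex valued functions\<close>

text \<open>Elements of the spaces below are functions rather than classes modulo null sets.
  All notions are invariant under changes on null sets.\<close>

definition L2 :: "'a::euclidean_space set \<Rightarrow> ('a \<Rightarrow> complex) set" where
  "L2 \<Omega> = {u. u \<in> borel_measurable (lebesgue_on \<Omega>) \<and>
              integrable (lebesgue_on \<Omega>) (\<lambda>x. (cmod (u x))\<^sup>2)}"

definition L2_norm :: "'a::euclidean_space set \<Rightarrow> ('a \<Rightarrow> complex) \<Rightarrow> real" where
  "L2_norm \<Omega> u = sqrt (LINT x|lebesgue_on \<Omega>. (cmod (u x))\<^sup>2)"

definition partial :: "'a::euclidean_space \<Rightarrow> ('a \<Rightarrow> complex) \<Rightarrow> 'a \<Rightarrow> complex" where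
  "partial b \<phi> x = frechet_derivative \<phi> (at x) b"

primrec C_diff :: "nat \<Rightarrow> ('a::euclidean_space \<Rightarrow> complex) \<Rightarrow> bool" where
  "C_diff 0 \<phi> \<longleftrightarrow> continuous_on UNIV \<phi>"
| "C_diff (Suc n) \<phi> \<longleftrightarrow> \<phi> differentiable_on UNIV \<and> (\<forall>b\<in>Basis. C_diff n (partial b \<phi>))"

definition smooth :: "('a::euclidean_space \<Rightarrow> complex) \<Rightarrow> bool" where
  "smooth \<phi> \<longleftrightarrow> (\<forall>n. C_diff n \<phi>)"

definition test_functions :: "'a::euclidean_space set \<Rightarrow> ('a \<Rightarrow> complex) set" where
  "test_functions \<Omega> =
     {\<phi>. smooth \<phi> \<and> (\<exists>K. compact K \<and> K \<subseteq> \<Omega> \<and> (\<forall>x. x \<notin> K \<longrightarrow> \<phi> x = 0))}"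

definition has_weak_partial ::
  "'a::euclidean_space set \<Rightarrow> 'a \<Rightarrow> ('a \<Rightarrow> complex) \<Rightarrow> ('a \<Rightarrow> complex) \<Rightarrow> bool" where
  "has_weak_partial \<Omega> b u g \<longleftrightarrow>
     (\<forall>\<phi>\<in>test_functions \<Omega>.
        (LINT x|lebesgue_on \<Omega>. u x * partial b \<phi> x) = - (LINT x|lebesgue_on \<Omega>. g x * \<phi> x))"

text \<open>On open sets weak derivatives are unique up to null sets, so for \<open>u\<close> in \<open>H1 \<Omega>\<close> the
  choice below is immaterial.\<close>

definition weak_partial ::
  "'a::euclidean_space set \<Rightarrow> 'a \<Rightarrow> ('a \<Rightarrow> complex) \<Rightarrow> 'a \<Rightarrow> complex" where
  "weak_partial \<Omega> b u = (SOME g. g \<in> L2 \<Omega> \<and> has_weak_partial \<Omega> b u g)"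

definition H1 :: "'a::euclidean_space set \<Rightarrow> ('a \<Rightarrow> complex) set" where
  "H1 \<Omega> = {u \<in> L2 \<Omega>. \<forall>b\<in>Basis. \<exists>g\<in>L2 \<Omega>. has_weak_partial \<Omega> b u g}"

definition H2 :: "'a::euclidean_space set \<Rightarrow> ('a \<Rightarrow> complex) set" where
  "H2 \<Omega> = {u \<in> H1 \<Omega>. \<forall>b\<in>Basis. weak_partial \<Omega> b u \<in> H1 \<Omega>}"

text \<open>The norm \<open>\<parallel>\<nabla>u\<parallel>\<close> in \<open>L\<^sup>2(\<Omega>)\<close>, with the Euclidean norm of the gradient.\<close>

definition grad_norm :: "'a::euclidean_space set \<Rightarrow> ('a \<Rightarrow> complex) \<Rightarrow> real" where
  "grad_norm \<Omega> u =
     sqrt (LINT x|lebesgue_on \<Omega>. (\<Sum>b\<in>Basis. (cmod (weak_partial \<Omega> b u x))\<^sup>2))"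

definition H1_norm :: "'a::euclidean_space set \<Rightarrow> ('a \<Rightarrow> complex) \<Rightarrow> real" where
  "H1_norm \<Omega> u = sqrt ((L2_norm \<Omega> u)\<^sup>2 + (grad_norm \<Omega> u)\<^sup>2)"


section \<open>The unit square, its sides, and traces\<close>

definition unit_square :: "(real \<times> real) set" where
  "unit_square = {0<..<1} \<times> {0<..<1}"

datatype side = Side1 | Side2 | Side3 | Side4

instance side :: finite
proof
  have "(UNIV :: side set) = {Side1, Side2, Side3, Side4}"
    using side.exhaust by blast
  then show "finite (UNIV :: side set)" by (metis finite.emptyI finite.insertI)
qed

text \<open>Arc length parametrisation over \<open>(0,1)\<close> of the open sides: bottom, right, top, left.\<close>

primrec side_point :: "side \<Rightarrow> real \<Rightarrow> real \<times> real" where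
  "side_point Side1 t = (t, 0)"
| "side_point Side2 t = (1, t)"
| "side_point Side3 t = (t, 1)"
| "side_point Side4 t = (0, t)"

text \<open>The trace operator from \<open>H\<^sup>1\<close> of the square to \<open>L\<^sup>2\<close> of a side is the continuous extension
  of the restriction of functions smooth up to the boundary. A trace is a function
  of the arc length parameter, determined up to a null set; by the trace inequality it does not
  depend on the approximating sequence, and by density every \<open>H\<^sup>1\<close> function has one.\<close>

definition has_trace :: "side \<Rightarrow> (real \<times> real \<Rightarrow> complex) \<Rightarrow> (real \<Rightarrow> complex) \<Rightarrow> bool" where
  "has_trace j u g \<longleftrightarrow> g \<in> L2 {0<..<1} \<and>
     (\<exists>\<phi>::nat \<Rightarrow> real \<times> real \<Rightarrow> complex. (\<forall>n. smooth (\<phi> n)) \<and>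
        (\<lambda>n. H1_norm unit_square (\<lambda>x. \<phi> n x - u x)) \<longlonglongrightarrow> 0 \<and>
        (\<lambda>n. L2_norm {0<..<1} (\<lambda>t. \<phi> n (side_point j t) - g t)) \<longlonglongrightarrow> 0)"

definition trace :: "side \<Rightarrow> (real \<times> real \<Rightarrow> complex) \<Rightarrow> real \<Rightarrow> complex" where
  "trace j u = (SOME g. has_trace j u g)"


section \<open>The Helmholtz problem\<close>

text \<open>The boundary operators \<open>u\<close>, \<open>\<partial>u/\<partial>\<nu>\<close> and \<open>\<partial>u/\<partial>\<nu> - iku\<close>; an assignment of conditions to
  the sides is a function \<open>B\<close>. The Dirichlet condition is imposed in the space \<open>\<H>\<close>, the other
  two are encoded by the variational equation.\<close>

datatype boundary_condition = Dirichlet | Neumann | Impedance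

definition energy_space ::
  "(side \<Rightarrow> boundary_condition) \<Rightarrow> (real \<times> real \<Rightarrow> complex) set" where
  "energy_space B = {v \<in> H1 unit_square.
     \<forall>j. B j = Dirichlet \<longrightarrow> (AE t in lebesgue_on {0<..<1}. trace j v t = 0)}"

definition weak_solution ::
  "(side \<Rightarrow> boundary_condition) \<Rightarrow> real \<Rightarrow> (real \<times> real \<Rightarrow> complex) \<Rightarrow>
   (real \<times> real \<Rightarrow> complex) \<Rightarrow> bool" where
  "weak_solution B k f u \<longleftrightarrow> u \<in> energy_space B \<and>
     (\<forall>v\<in>energy_space B.
        (LINT x|lebesgue_on unit_square.
           (\<Sum>b\<in>Basis. weak_partial unit_square b u x * cnj (weak_partial unit_square b v x))
             - complex_of_real (k\<^sup>2) * u x * cnj (v x))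
        - \<i> * complex_of_real k *
            (\<Sum>j | B j = Impedance. LINT t|lebesgue_on {0<..<1}. trace j u t * cnj (trace j v t))
        = (LINT x|lebesgue_on unit_square. f x * cnj (v x)))"

end

theory Submission
  imports Defs
begin

text \<open>Testing the variational equation with \<open>u\<close> itself gives
  \<open>\<parallel>\<nabla>u\<parallel>\<^sup>2 \<le> k\<^sup>2 \<parallel>u\<parallel>\<^sup>2 + \<parallel>f\<parallel> \<parallel>u\<parallel>\<close>, so it suffices to bound \<open>\<parallel>u\<parallel>\<close>. This is done by duality: for
  \<open>g = \<Sum>p\<^sub>n(x) \<phi>\<^sub>n(y)\<close> with polynomials \<open>p\<^sub>n\<close> and the eigenfunctions \<open>\<phi>\<^sub>n\<close> of the conditions on the
  horizontal sides, the adjoint problem \<open>\<Delta>v + k\<^sup>2 v = -g\<close> separates into ordinary differential equations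
  for the coefficients of \<open>v\<close>, which have explicit smooth solutions; hence \<open>\<integral>u cnj g = \<integral>f cnj v\<close>. The
  one-dimensional energy identity and the multiplier \<open>(1 - x) w'\<close> bound each coefficient, orthogonality
  turns this into \<open>\<parallel>v\<parallel> \<le> C \<parallel>g\<parallel>\<close>, and the functions \<open>g\<close> are dense. Traces and Green's formula for
  \<open>H\<^sup>1\<close> functions come from the density of smooth functions, where the cosine expansion plays the
  role of mollification.\<close>

section \<open>Square integrable functions\<close>

text \<open>The estimate hinges on a constant that is uniform over all modes. A mode of frequency
  \<lambda> leads to w'' + \<mu> w = -g with \<mu> = k^2 - \<lambda>^2, which is at most k^2 but
  unbounded below. The energy identity carries -\<mu> and the multiplier identity +\<mu> in front of
  the squared norm of w, so their sum is free of \<mu> and treats oscillating and decaying modes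
  alike. In the horizontal direction the impedance condition is complex, hence not self-adjoint, and
  no orthogonal eigenbasis is at hand; this is why polynomials in x take the place of eigenfunctions
  there. Weak derivatives and traces are selected by \<open>SOME\<close>, so before either can be
  computed with, it must be shown unique up to null sets. Without a Dirichlet condition on the right
  side, bounding w requires its value at x = 0, which the imaginary part of the energy identity
  provides at the price of 1/k. This is the origin of the power k^(-1/2) in (2).\<close>

lemma L2_measurable: "u \<in> L2 \<Omega> \<Longrightarrow> u \<in> borel_measurable (lebesgue_on \<Omega>)"
  and L2_integrable_sq: "u \<in> L2 \<Omega> \<Longrightarrow> integrable (lebesgue_on \<Omega>) (\<lambda>x. (cmod (u x))\<^sup>2)"
  by (auto simp: L2_def)

lemma L2_add:
  assumes "u \<in> L2 \<Omega>" "v \<in> L2 \<Omega>" shows "(\<lambda>x. u x + v x) \<in> L2 \<Omega>"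
proof -
  note [measurable] = L2_measurable[OF assms(1)] L2_measurable[OF assms(2)]
  have "integrable (lebesgue_on \<Omega>) (\<lambda>x. (cmod (u x + v x))\<^sup>2)"
  proof (rule Bochner_Integration.integrable_bound)
    show "integrable (lebesgue_on \<Omega>) (\<lambda>x. 2 * (cmod (u x))\<^sup>2 + 2 * (cmod (v x))\<^sup>2)"
      using assms by (auto simp: L2_def)
    have "(cmod (u x + v x))\<^sup>2 \<le> 2 * (cmod (u x))\<^sup>2 + 2 * (cmod (v x))\<^sup>2" for x
    proof -
      have "(cmod (u x + v x))\<^sup>2 \<le> (cmod (u x) + cmod (v x))\<^sup>2"
        by (simp add: norm_triangle_ineq power_mono)
      also have "\<dots> \<le> 2 * (cmod (u x))\<^sup>2 + 2 * (cmod (v x))\<^sup>2"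
        using zero_le_power2[of "cmod (u x) - cmod (v x)"] by (simp add: power2_eq_square algebra_simps)
      finally show ?thesis .
    qed
    then show "AE x in lebesgue_on \<Omega>. norm ((cmod (u x + v x))\<^sup>2) \<le>
        norm (2 * (cmod (u x))\<^sup>2 + 2 * (cmod (v x))\<^sup>2)" by simp
  qed measurable
  then show ?thesis by (simp add: L2_def)
qed

lemma L2_cmult: "u \<in> L2 \<Omega> \<Longrightarrow> (\<lambda>x. c * u x) \<in> L2 \<Omega>"
  by (auto simp: L2_def norm_mult power_mult_distrib)

lemma L2_minus: "u \<in> L2 \<Omega> \<Longrightarrow> (\<lambda>x. - u x) \<in> L2 \<Omega>"
  using L2_cmult[of u \<Omega> "-1"] by simp

lemma L2_diff: "u \<in> L2 \<Omega> \<Longrightarrow> v \<in> L2 \<Omega> \<Longrightarrow> (\<lambda>x. u x - v x) \<in> L2 \<Omega>"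
  using L2_add[of u \<Omega> "\<lambda>x. - v x"] L2_minus[of v] by simp

lemma L2_0: "(\<lambda>x. 0) \<in> L2 \<Omega>"
  by (auto simp: L2_def)

lemma L2_sum: "(\<And>i. i \<in> A \<Longrightarrow> u i \<in> L2 \<Omega>) \<Longrightarrow> (\<lambda>x. \<Sum>i\<in>A. u i x) \<in> L2 \<Omega>"
  by (induction A rule: infinite_finite_induct) (auto simp: L2_0 intro: L2_add)

lemma L2_cnj: "u \<in> L2 \<Omega> \<Longrightarrow> (\<lambda>x. cnj (u x)) \<in> L2 \<Omega>"
  unfolding L2_def mem_Collect_eq complex_mod_cnj
  by (auto intro: measurable_compose[OF _ borel_measurable_continuous_onI[of cnj]] continuous_intros)

lemma L2_cong_AE:
  assumes "u \<in> L2 \<Omega>" "v \<in> borel_measurable (lebesgue_on \<Omega>)" "AE x in lebesgue_on \<Omega>. u x = v x"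
  shows "v \<in> L2 \<Omega>"
proof -
  note [measurable] = assms(2) L2_measurable[OF assms(1)]
  have "integrable (lebesgue_on \<Omega>) (\<lambda>x. (cmod (v x))\<^sup>2)"
    by (rule integrable_cong_AE_imp[OF L2_integrable_sq[OF assms(1)]]) (use assms(3) in auto)
  then show ?thesis using assms by (auto simp: L2_def)
qed

lemma L2_mult_bounded:
  assumes "u \<in> L2 \<Omega>" "\<psi> \<in> borel_measurable (lebesgue_on \<Omega>)"
    and b: "\<And>x. x \<in> \<Omega> \<Longrightarrow> cmod (\<psi> x) \<le> C" and S: "\<Omega> \<in> sets lebesgue"
  shows "(\<lambda>x. u x * \<psi> x) \<in> L2 \<Omega>"
proof -
  note [measurable] = assms(2) L2_measurable[OF assms(1)]
  have "integrable (lebesgue_on \<Omega>) (\<lambda>x. (cmod (u x * \<psi> x))\<^sup>2)"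
  proof (rule Bochner_Integration.integrable_bound)
    show "integrable (lebesgue_on \<Omega>) (\<lambda>x. C\<^sup>2 * (cmod (u x))\<^sup>2)"
      using assms by (auto simp: L2_def)
    have "(cmod (u x * \<psi> x))\<^sup>2 \<le> C\<^sup>2 * (cmod (u x))\<^sup>2" if "x \<in> \<Omega>" for x
    proof -
      have "(cmod (u x))\<^sup>2 * (cmod (\<psi> x))\<^sup>2 \<le> (cmod (u x))\<^sup>2 * C\<^sup>2"
        using b[OF that] by (intro mult_left_mono power_mono) auto
      then show ?thesis by (simp add: norm_mult power_mult_distrib mult.commute)
    qed
    then show "AE x in lebesgue_on \<Omega>. norm ((cmod (u x * \<psi> x))\<^sup>2) \<le> norm (C\<^sup>2 * (cmod (u x))\<^sup>2)"
      using S by (intro AE_I2) (auto simp: space_restrict_space)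
  qed measurable
  then show ?thesis by (simp add: L2_def)
qed

lemma L2_mult_integrable:
  assumes "u \<in> L2 \<Omega>" "v \<in> L2 \<Omega>" shows "integrable (lebesgue_on \<Omega>) (\<lambda>x. u x * v x)"
proof -
  note [measurable] = L2_measurable[OF assms(1)] L2_measurable[OF assms(2)]
  show ?thesis
  proof (rule Bochner_Integration.integrable_bound)
    show "integrable (lebesgue_on \<Omega>) (\<lambda>x. (cmod (u x))\<^sup>2 + (cmod (v x))\<^sup>2)"
      using assms by (auto simp: L2_def)
    have "cmod (u x * v x) \<le> (cmod (u x))\<^sup>2 + (cmod (v x))\<^sup>2" for x
      using sum_squares_bound[of "cmod (u x)" "cmod (v x)"] mult_nonneg_nonneg[OF norm_ge_zero[of "u x"] norm_ge_zero[of "v x"]]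
      unfolding norm_mult by linarith
    then show "AE x in lebesgue_on \<Omega>. norm (u x * v x) \<le> norm ((cmod (u x))\<^sup>2 + (cmod (v x))\<^sup>2)" by simp
  qed measurable
qed

lemma L2_norm_nonneg [simp]: "L2_norm \<Omega> u \<ge> 0"
  by (simp add: L2_norm_def)

lemma L2_norm_sq: "(L2_norm \<Omega> u)\<^sup>2 = (LINT x|lebesgue_on \<Omega>. (cmod (u x))\<^sup>2)"
  by (simp add: L2_norm_def)

lemma L2_norm_sq_cnj:
  "of_real ((L2_norm \<Omega> u)\<^sup>2) = (LINT x|lebesgue_on \<Omega>. u x * cnj (u x))"
  unfolding L2_norm_sq by (simp only: complex_norm_square[symmetric] integral_complex_of_real)

lemma L2_norm_cong_AE:
  assumes "u \<in> borel_measurable (lebesgue_on \<Omega>)" "v \<in> borel_measurable (lebesgue_on \<Omega>)"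
    "AE x in lebesgue_on \<Omega>. u x = v x"
  shows "L2_norm \<Omega> u = L2_norm \<Omega> v"
proof -
  note [measurable] = assms(1,2)
  show ?thesis unfolding L2_norm_def using assms(3)
    by (intro arg_cong[where f=sqrt] integral_cong_AE) auto
qed

text \<open>The squared norm of t|u| + |v| is a nonnegative quadratic in t, so its discriminant is
  not positive. The product carries no conjugate; inner products arise by conjugating
  \<open>v\<close> first.\<close>

lemma L2_Cauchy_Schwarz:
  assumes u: "u \<in> L2 \<Omega>" and v: "v \<in> L2 \<Omega>"
  shows "cmod (LINT x|lebesgue_on \<Omega>. u x * v x) \<le> L2_norm \<Omega> u * L2_norm \<Omega> v"
proof -
  let ?M = "lebesgue_on \<Omega>"
  define a b c where "a = (LINT x|?M. (cmod (u x))\<^sup>2)" and "b = (LINT x|?M. (cmod (v x))\<^sup>2)"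
    and "c = (LINT x|?M. cmod (u x) * cmod (v x))"
  have i1: "integrable ?M (\<lambda>x. cmod (u x) * cmod (v x))"
    using integrable_norm[OF L2_mult_integrable[OF u v]] by (simp add: norm_mult)
  have quad: "0 \<le> a * t\<^sup>2 + 2 * c * t + b" for t
  proof -
    have "0 \<le> (LINT x|?M. (t * cmod (u x) + cmod (v x))\<^sup>2)" by simp
    also have "\<dots> = (LINT x|?M. t\<^sup>2 * (cmod (u x))\<^sup>2 + (2 * t) * (cmod (u x) * cmod (v x)) + (cmod (v x))\<^sup>2)"
      by (intro Bochner_Integration.integral_cong refl) (simp add: power2_eq_square algebra_simps)
    also have "\<dots> = t\<^sup>2 * a + 2 * t * c + b"
      using i1 L2_integrable_sq[OF u] L2_integrable_sq[OF v] by (simp add: a_def b_def c_def)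
    finally show ?thesis by (simp add: mult_ac)
  qed
  have nonneg: "a \<ge> 0" "b \<ge> 0" "c \<ge> 0" by (auto simp: a_def b_def c_def)
  have "c\<^sup>2 \<le> a * b"
  proof (cases "a = 0")
    case True
    have "c = 0"
    proof (rule ccontr)
      assume "c \<noteq> 0"
      then have "c > 0" using nonneg by simp
      \<comment> \<open>For a = 0 the polynomial is affine in t; this t makes its value -1.\<close>
      have "0 \<le> 2 * c * (-(b + 1) / (2 * c)) + b" using quad[of "-(b+1)/(2*c)"] True by simp
      also have "\<dots> = -1" using \<open>c > 0\<close> by (simp add: field_simps)
      finally show False by simp
    qed
    then show ?thesis using True by simp
  next
    case False
    then have "a > 0" using nonneg by simp
    have "0 \<le> a * (- c / a)\<^sup>2 + 2 * c * (- c / a) + b" by (rule quad)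
    also have "\<dots> = b - c\<^sup>2 / a" using \<open>a > 0\<close> by (simp add: field_simps power2_eq_square)
    finally show ?thesis using \<open>a > 0\<close> by (simp add: field_simps)
  qed
  then have "c \<le> sqrt (a * b)" by (rule real_le_rsqrt)
  moreover have "cmod (LINT x|?M. u x * v x) \<le> c"
    unfolding c_def using integral_norm_bound[of ?M "\<lambda>x. u x * v x"] by (simp add: norm_mult)
  ultimately show ?thesis unfolding L2_norm_def a_def b_def by (simp add: real_sqrt_mult)
qed

lemma L2_norm_cnj: "L2_norm \<Omega> (\<lambda>x. cnj (u x)) = L2_norm \<Omega> u"
  by (simp add: L2_norm_def)

lemma L2_norm_minus_commute: "L2_norm \<Omega> (\<lambda>x. u x - v x) = L2_norm \<Omega> (\<lambda>x. v x - u x)"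
  by (simp add: L2_norm_def norm_minus_commute)

lemma integral_quadratic:
  fixes f g h :: "'a \<Rightarrow> real"
  assumes "integrable M f" "integrable M g" "integrable M h"
  shows "(LINT x|M. f x + 2 * g x + h x) = integral\<^sup>L M f + 2 * integral\<^sup>L M g + integral\<^sup>L M h"
  using assms by simp

lemma L2_norm_triangle:
  assumes u: "u \<in> L2 \<Omega>" and v: "v \<in> L2 \<Omega>"
  shows "L2_norm \<Omega> (\<lambda>x. u x + v x) \<le> L2_norm \<Omega> u + L2_norm \<Omega> v"
proof -
  let ?M = "lebesgue_on \<Omega>"
  have cv: "(\<lambda>x. cnj (v x)) \<in> L2 \<Omega>" using v by (rule L2_cnj)
  have i: "integrable ?M (\<lambda>x. u x * cnj (v x))" by (rule L2_mult_integrable[OF u cv])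
  have "(L2_norm \<Omega> (\<lambda>x. u x + v x))\<^sup>2
      = (LINT x|?M. (cmod (u x))\<^sup>2 + 2 * Re (u x * cnj (v x)) + (cmod (v x))\<^sup>2)"
    unfolding L2_norm_sq
    by (intro Bochner_Integration.integral_cong refl, unfold cmod_power2) (simp add: power2_eq_square algebra_simps)
  also have "\<dots> = (L2_norm \<Omega> u)\<^sup>2 + 2 * Re (LINT x|?M. u x * cnj (v x)) + (L2_norm \<Omega> v)\<^sup>2"
    unfolding L2_norm_sq integral_Re[OF i, symmetric]
    by (intro integral_quadratic L2_integrable_sq u v integrable_Re i)
  also have "\<dots> \<le> (L2_norm \<Omega> u)\<^sup>2 + 2 * (L2_norm \<Omega> u * L2_norm \<Omega> v) + (L2_norm \<Omega> v)\<^sup>2"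
    using L2_Cauchy_Schwarz[OF u cv] complex_Re_le_cmod[of "LINT x|?M. u x * cnj (v x)"]
    by (simp add: L2_norm_cnj)
  also have "\<dots> = (L2_norm \<Omega> u + L2_norm \<Omega> v)\<^sup>2" by (simp add: power2_eq_square algebra_simps)
  finally show ?thesis by (rule power2_le_imp_le) simp
qed

lemma L2_norm_triangle_diff:
  assumes "u \<in> L2 \<Omega>" "v \<in> L2 \<Omega>" "w \<in> L2 \<Omega>"
  shows "L2_norm \<Omega> (\<lambda>x. u x - w x) \<le> L2_norm \<Omega> (\<lambda>x. u x - v x) + L2_norm \<Omega> (\<lambda>x. v x - w x)"
  using L2_norm_triangle[OF L2_diff[OF assms(1,2)] L2_diff[OF assms(2,3)]] by simp

lemma L2_norm_eq_0_AE:
  assumes "u \<in> L2 \<Omega>" "L2_norm \<Omega> u = 0" shows "AE x in lebesgue_on \<Omega>. u x = 0"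
proof -
  have "AE x in lebesgue_on \<Omega>. (cmod (u x))\<^sup>2 = 0"
    using integral_nonneg_eq_0_iff_AE[OF L2_integrable_sq[OF assms(1)]] assms(2)
    by (simp add: L2_norm_def)
  then show ?thesis by simp
qed

lemma L2_norm_mult_le:
  assumes u: "u \<in> L2 \<Omega>" and \<psi>: "\<psi> \<in> borel_measurable (lebesgue_on \<Omega>)"
    and b: "\<And>x. x \<in> \<Omega> \<Longrightarrow> cmod (\<psi> x) \<le> 1" and S: "\<Omega> \<in> sets lebesgue"
  shows "L2_norm \<Omega> (\<lambda>x. u x * \<psi> x) \<le> L2_norm \<Omega> u"
proof (rule power2_le_imp_le)
  show "(L2_norm \<Omega> (\<lambda>x. u x * \<psi> x))\<^sup>2 \<le> (L2_norm \<Omega> u)\<^sup>2"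
    unfolding L2_norm_sq
  proof (rule integral_mono)
    fix x assume "x \<in> space (lebesgue_on \<Omega>)"
    then have "cmod (\<psi> x) \<le> 1" using b S by (simp add: space_restrict_space)
    then have "cmod (u x) * cmod (\<psi> x) \<le> cmod (u x)"
      using mult_left_mono[of "cmod (\<psi> x)" 1 "cmod (u x)"] by simp
    then show "(cmod (u x * \<psi> x))\<^sup>2 \<le> (cmod (u x))\<^sup>2"
      unfolding norm_mult by (rule power_mono) simp
  qed (rule L2_integrable_sq[OF L2_mult_bounded[OF u \<psi> b S]], assumption, rule L2_integrable_sq[OF u])
qed simp

lemma L2_integral_tendsto:
  assumes u: "u \<in> L2 \<Omega>" and v: "v \<in> L2 \<Omega>" and "\<And>n::nat. \<phi> n \<in> L2 \<Omega>"
    and lim: "(\<lambda>n. L2_norm \<Omega> (\<lambda>x. \<phi> n x - u x)) \<longlonglongrightarrow> 0"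
  shows "(\<lambda>n. LINT x|lebesgue_on \<Omega>. \<phi> n x * v x) \<longlonglongrightarrow> (LINT x|lebesgue_on \<Omega>. u x * v x)"
proof -
  have "(\<lambda>n. (LINT x|lebesgue_on \<Omega>. \<phi> n x * v x) - (LINT x|lebesgue_on \<Omega>. u x * v x)) \<longlonglongrightarrow> 0"
  proof (rule Lim_null_comparison)
    show "\<forall>\<^sub>F n in sequentially. cmod ((LINT x|lebesgue_on \<Omega>. \<phi> n x * v x) - (LINT x|lebesgue_on \<Omega>. u x * v x))
       \<le> L2_norm \<Omega> (\<lambda>x. \<phi> n x - u x) * L2_norm \<Omega> v"
    proof (intro always_eventually allI)
      fix n
      have "(LINT x|lebesgue_on \<Omega>. \<phi> n x * v x) - (LINT x|lebesgue_on \<Omega>. u x * v x)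
        = (LINT x|lebesgue_on \<Omega>. (\<phi> n x - u x) * v x)"
        using assms by (simp add: left_diff_distrib L2_mult_integrable)
      then show "cmod ((LINT x|lebesgue_on \<Omega>. \<phi> n x * v x) - (LINT x|lebesgue_on \<Omega>. u x * v x))
        \<le> L2_norm \<Omega> (\<lambda>x. \<phi> n x - u x) * L2_norm \<Omega> v"
        using L2_Cauchy_Schwarz[OF L2_diff[OF assms(3) u] v] by simp
    qed
    show "(\<lambda>n. L2_norm \<Omega> (\<lambda>x. \<phi> n x - u x) * L2_norm \<Omega> v) \<longlonglongrightarrow> 0"
      using tendsto_mult_right[OF lim, of "L2_norm \<Omega> v"] by simp
  qed
  then show ?thesis by (simp add: LIM_zero_iff)
qed

text \<open>The coefficients \<open>a\<close> satisfy the normal equations, so the residual is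
  orthogonal to the span, and Pythagoras applies to it and the difference of the two combinations.
  The equations are stated without division because some \<open>e i\<close> may be zero, such as the
  sine of index 0.\<close>

lemma L2_best_approximation:
  fixes e :: "'i \<Rightarrow> 'a::euclidean_space \<Rightarrow> complex"
  assumes A: "finite A" and e: "\<And>i. i \<in> A \<Longrightarrow> e i \<in> L2 \<Omega>" and u: "u \<in> L2 \<Omega>"
    and orth: "\<And>i j. i \<in> A \<Longrightarrow> j \<in> A \<Longrightarrow> i \<noteq> j \<Longrightarrow> (LINT x|lebesgue_on \<Omega>. e i x * cnj (e j x)) = 0"
    and a: "\<And>i. i \<in> A \<Longrightarrow> a i * of_real ((L2_norm \<Omega> (e i))\<^sup>2) = (LINT x|lebesgue_on \<Omega>. u x * cnj (e i x))"
  shows "L2_norm \<Omega> (\<lambda>x. u x - (\<Sum>i\<in>A. a i * e i x)) \<le> L2_norm \<Omega> (\<lambda>x. u x - (\<Sum>i\<in>A. c i * e i x))"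
proof -
  let ?M = "lebesgue_on \<Omega>"
  define p where "p = (\<lambda>x. u x - (\<Sum>i\<in>A. a i * e i x))"
  define q where "q = (\<lambda>x. \<Sum>i\<in>A. (a i - c i) * e i x)"
  have pL: "p \<in> L2 \<Omega>" and qL: "q \<in> L2 \<Omega>"
    unfolding p_def q_def by (intro L2_diff u L2_sum L2_cmult e; assumption)+
  have i1: "integrable ?M (\<lambda>x. e i x * cnj (e j x))" if "i \<in> A" "j \<in> A" for i j
    using that by (intro L2_mult_integrable e L2_cnj)
  have i2: "integrable ?M (\<lambda>x. u x * cnj (e j x))" if "j \<in> A" for j
    using that by (intro L2_mult_integrable e L2_cnj u)
  have i3: "integrable ?M (\<lambda>x. p x * cnj (e j x))" if "j \<in> A" for j
    using that by (intro L2_mult_integrable e L2_cnj pL)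
  have pe: "(LINT x|?M. p x * cnj (e j x)) = 0" if j: "j \<in> A" for j
  proof -
    have "(LINT x|?M. p x * cnj (e j x)) = (LINT x|?M. u x * cnj (e j x) - (\<Sum>i\<in>A. a i * (e i x * cnj (e j x))))"
      by (intro Bochner_Integration.integral_cong refl) (simp add: p_def left_diff_distrib sum_distrib_right mult.assoc)
    also have "\<dots> = (LINT x|?M. u x * cnj (e j x)) - (\<Sum>i\<in>A. a i * (LINT x|?M. e i x * cnj (e j x)))"
      using i1 i2 j by simp
    also have "(\<Sum>i\<in>A. a i * (LINT x|?M. e i x * cnj (e j x))) = a j * (LINT x|?M. e j x * cnj (e j x))"
    proof -
      have "(\<Sum>i\<in>A. a i * (LINT x|?M. e i x * cnj (e j x)))
        = (\<Sum>i\<in>A. if i = j then a j * (LINT x|?M. e j x * cnj (e j x)) else 0)"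
        using orth j by (intro sum.cong) auto
      then show ?thesis using A j by simp
    qed
    also have "\<dots> = (LINT x|?M. u x * cnj (e j x))" using a[OF j] unfolding L2_norm_sq_cnj .
    finally show ?thesis by simp
  qed
  have "(LINT x|?M. p x * cnj (q x)) = (LINT x|?M. (\<Sum>j\<in>A. cnj (a j - c j) * (p x * cnj (e j x))))"
    by (intro Bochner_Integration.integral_cong refl) (simp add: q_def sum_distrib_left mult_ac)
  also have "\<dots> = 0" using i3 pe by simp
  finally have pq: "(LINT x|?M. p x * cnj (q x)) = 0" .
  have ipq: "integrable ?M (\<lambda>x. p x * cnj (q x))" by (intro L2_mult_integrable L2_cnj pL qL)
  have "(L2_norm \<Omega> (\<lambda>x. p x + q x))\<^sup>2
      = (LINT x|?M. (cmod (p x))\<^sup>2 + 2 * Re (p x * cnj (q x)) + (cmod (q x))\<^sup>2)"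
    unfolding L2_norm_sq
    by (intro Bochner_Integration.integral_cong refl, unfold cmod_power2) (simp add: power2_eq_square algebra_simps)
  also have "\<dots> = (L2_norm \<Omega> p)\<^sup>2 + 2 * Re (LINT x|?M. p x * cnj (q x)) + (L2_norm \<Omega> q)\<^sup>2"
    unfolding L2_norm_sq integral_Re[OF ipq, symmetric]
    by (intro integral_quadratic L2_integrable_sq pL qL integrable_Re ipq)
  finally have "(L2_norm \<Omega> p)\<^sup>2 \<le> (L2_norm \<Omega> (\<lambda>x. p x + q x))\<^sup>2" using pq by simp
  then have "L2_norm \<Omega> p \<le> L2_norm \<Omega> (\<lambda>x. p x + q x)" by (rule power2_le_imp_le) simp
  moreover have "(\<lambda>x. p x + q x) = (\<lambda>x. u x - (\<Sum>i\<in>A. c i * e i x))"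
    by (auto simp: p_def q_def left_diff_distrib sum_subtractf)
  ultimately show ?thesis by (simp add: p_def)
qed

section \<open>Integration over the unit square\<close>

abbreviation Q :: "(real \<times> real) set" where "Q \<equiv> unit_square"
abbreviation J :: "real set" where "J \<equiv> {0<..<1}"
abbreviation MQ :: "(real \<times> real) measure" where "MQ \<equiv> lebesgue_on Q"
abbreviation MJ :: "real measure" where "MJ \<equiv> lebesgue_on J"
abbreviation closed_square :: "(real \<times> real) set" where "closed_square \<equiv> {0..1} \<times> {0..1}"

lemma Q_simps: "(s, t) \<in> Q \<longleftrightarrow> s \<in> J \<and> t \<in> J"
  by (auto simp: unit_square_def)

lemma Q_eq_box: "Q = box (0, 0) (1, 1)"
  by (auto simp: unit_square_def box_def Basis_prod_def)

lemma open_Q: "open Q" and Q_sets [measurable, simp]: "Q \<in> sets lebesgue" "Q \<in> sets borel"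
  and Q_lmeasurable: "Q \<in> lmeasurable"
  by (auto simp: Q_eq_box)

lemma Q_subset: "Q \<subseteq> closed_square"
  by (auto simp: unit_square_def)

lemma compact_closed_square: "compact closed_square"
  by (intro compact_Times compact_Icc)

lemma continuous_imp_L2:
  assumes K: "compact K" and sub: "\<Omega> \<subseteq> K" and \<Omega>: "\<Omega> \<in> sets lebesgue" and f: "continuous_on K f"
  shows "f \<in> L2 \<Omega>" and "integrable (lebesgue_on \<Omega>) f"
proof -
  have fm: "\<Omega> \<in> lmeasurable"
    using K sub \<Omega> by (meson bounded_set_imp_lmeasurable bounded_subset compact_imp_bounded)
  interpret finite_measure "lebesgue_on \<Omega>" by (rule finite_measure_lebesgue_on[OF fm])
  obtain C where C: "\<And>x. x \<in> K \<Longrightarrow> cmod (f x) \<le> C"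
    using compact_imp_bounded[OF compact_continuous_image[OF f K]] by (auto simp: bounded_iff)
  have [measurable]: "f \<in> borel_measurable (lebesgue_on \<Omega>)"
    using continuous_on_subset[OF f sub] \<Omega> by (rule continuous_imp_measurable_on_sets_lebesgue)
  have "integrable (lebesgue_on \<Omega>) (\<lambda>x. (cmod (f x))\<^sup>2)"
  proof (rule integrable_const_bound[where B = "C\<^sup>2"])
    show "AE x in lebesgue_on \<Omega>. norm ((cmod (f x))\<^sup>2) \<le> C\<^sup>2"
      using C sub by (intro AE_I2) (auto simp: space_restrict_space intro!: power_mono)
  qed measurable
  then show "f \<in> L2 \<Omega>" by (simp add: L2_def)
  show "integrable (lebesgue_on \<Omega>) f"
    using C sub by (intro integrable_const_bound[where B = C] AE_I2) (auto simp: space_restrict_space)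
qed

lemma continuous_imp_L2_square:
  assumes "continuous_on closed_square f" shows "f \<in> L2 Q" "integrable MQ f"
  using continuous_imp_L2[OF compact_closed_square Q_subset _ assms] by auto

lemma continuous_imp_L2_ivl:
  assumes "continuous_on {0..1} f" shows "f \<in> L2 J" "integrable MJ f"
  using continuous_imp_L2[OF compact_Icc greaterThanLessThan_subseteq_atLeastAtMost_iff[THEN iffD2] _ assms] by auto

lemma L2_norm_le_sup:
  assumes \<Omega>: "\<Omega> \<in> lmeasurable" and b: "\<And>x. x \<in> \<Omega> \<Longrightarrow> cmod (u x) \<le> C" and u: "u \<in> L2 \<Omega>"
    and "0 \<le> C"
  shows "L2_norm \<Omega> u \<le> C * sqrt (measure lebesgue \<Omega>)"
proof -
  interpret finite_measure "lebesgue_on \<Omega>" by (rule finite_measure_lebesgue_on[OF \<Omega>])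
  have S: "\<Omega> \<in> sets lebesgue" using \<Omega> by auto
  have "(LINT x|lebesgue_on \<Omega>. (cmod (u x))\<^sup>2) \<le> (LINT x|lebesgue_on \<Omega>. C\<^sup>2)"
    using b S by (intro integral_mono L2_integrable_sq u integrable_const)
      (auto simp: space_restrict_space intro!: power_mono)
  also have "\<dots> = C\<^sup>2 * measure lebesgue \<Omega>"
    using S by (simp add: space_restrict_space measure_restrict_space mult.commute)
  finally have "L2_norm \<Omega> u \<le> sqrt (C\<^sup>2 * measure lebesgue \<Omega>)"
    unfolding L2_norm_def by (rule real_sqrt_le_mono)
  then show ?thesis using \<open>0 \<le> C\<close> by (simp add: real_sqrt_mult)
qed

lemma integral_J_FTC:
  fixes F :: "real \<Rightarrow> complex"
  assumes F: "\<And>t. t \<in> {0..1} \<Longrightarrow> (F has_vector_derivative f t) (at t)" and f: "continuous_on {0..1} f"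
  shows "(LINT t|MJ. f t) = F 1 - F 0"
proof -
  have "(f has_integral (F 1 - F 0)) {0..1}"
    by (rule fundamental_theorem_of_calculus) (auto intro: has_vector_derivative_at_within[OF F])
  then have "(f has_integral (F 1 - F 0)) J" by (simp add: has_integral_Icc_iff_Ioo)
  moreover have "(f has_integral (LINT t|MJ. f t)) J"
    by (intro has_integral_integral_lebesgue_on continuous_imp_L2_ivl f) auto
  ultimately show ?thesis by (rule has_integral_unique[symmetric])
qed

text \<open>Fubini's theorem is applied to a product of copies of \<open>lborel\<close>, whereas all
  norms live on the completed measure; for Borel integrands the two integrals agree.\<close>

lemma lebesgue_on_borel:
  fixes f :: "'a::euclidean_space \<Rightarrow> 'b::{banach, second_countable_topology}"
  assumes f: "f \<in> borel_measurable borel" and S: "S \<in> sets borel"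
  shows "integral\<^sup>L (lebesgue_on S) f = (LINT x|lborel. indicator S x *\<^sub>R f x)"
    and "integrable (lebesgue_on S) f \<longleftrightarrow> integrable lborel (\<lambda>x. indicator S x *\<^sub>R f x)"
proof -
  note [measurable] = f S
  have m: "(\<lambda>x. indicator S x *\<^sub>R f x) \<in> borel_measurable lborel" by measurable
  show "integral\<^sup>L (lebesgue_on S) f = (LINT x|lborel. indicator S x *\<^sub>R f x)"
    using S by (simp add: integral_restrict_space integral_completion[OF m])
  show "integrable (lebesgue_on S) f \<longleftrightarrow> integrable lborel (\<lambda>x. indicator S x *\<^sub>R f x)"
    using S by (simp add: integrable_restrict_space integrable_completion[OF m])
qed

text \<open>To treat both coordinate directions at once, the flag \<open>h\<close> selects the horizontal or the vertical
  direction; \<open>s\<close> is the coordinate in that direction and \<open>t\<close> the other one.\<close>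

definition pt :: "bool \<Rightarrow> real \<Rightarrow> real \<Rightarrow> real \<times> real" where
  "pt h s t = (if h then (s, t) else (t, s))"

lemma continuous_pt: "continuous_on A f \<Longrightarrow> continuous_on A g \<Longrightarrow> continuous_on A (\<lambda>x. pt h (f x) (g x))"
  by (cases h) (auto simp: pt_def intro!: continuous_intros)

lemma pt_mem_Q [simp]: "pt h s t \<in> Q \<longleftrightarrow> s \<in> J \<and> t \<in> J"
  by (auto simp: pt_def Q_simps)

text \<open>\<open>k\<close> lists the other coordinate first, so for true \<open>h\<close> it is
  the swapped product and otherwise the product itself. \<open>f\<close> is Borel, so that every
  slice is measurable and not just almost every one.\<close>

lemma
  fixes f :: "real \<times> real \<Rightarrow> 'b::{banach, second_countable_topology}"
  assumes f: "f \<in> borel_measurable borel" and i: "integrable MQ f"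
  shows Fubini_square: "integral\<^sup>L MQ f = (LINT t|MJ. LINT s|MJ. f (pt h s t))"
    and Fubini_square_integrable: "integrable MJ (\<lambda>t. LINT s|MJ. f (pt h s t))"
    and Fubini_square_AE: "AE t in MJ. integrable MJ (\<lambda>s. f (pt h s t))"
    and Fubini_square_measurable: "(\<lambda>t. LINT s|MJ. f (pt h s t)) \<in> borel_measurable borel"
proof -
  note [measurable] = f
  define g where "g = (\<lambda>z. indicator Q z *\<^sub>R f z)"
  have ig: "integrable (lborel \<Otimes>\<^sub>M lborel) g"
    using i by (simp add: g_def lebesgue_on_borel f lborel_prod)
  define k where "k = (\<lambda>(t, s). g (pt h s t))"
  have k_eq: "k = (if h then (\<lambda>(t, s). g (s, t)) else g)"
    by (auto simp: k_def pt_def fun_eq_iff)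
  have ik: "integrable (lborel \<Otimes>\<^sub>M lborel) k" and Ik: "integral\<^sup>L (lborel \<Otimes>\<^sub>M lborel) k = integral\<^sup>L lborel g"
    using lborel_pair.integrable_product_swap[OF ig] ig
      lborel_pair.integral_product_swap[of g] borel_measurable_integrable[OF ig]
    by (auto simp: k_eq lborel_prod)
  have [measurable]: "(\<lambda>s. f (pt h s t)) \<in> borel_measurable borel" for t
    unfolding pt_def by (cases h) auto
  have k_pt: "k (t, s) = indicator J t *\<^sub>R (indicator J s *\<^sub>R f (pt h s t))" for s t
    by (auto simp: k_def g_def indicator_def)
  have ind: "(LINT s|lborel. k (t, s)) = indicator J t *\<^sub>R (LINT s|MJ. f (pt h s t))" for t
    by (cases "t \<in> J") (simp_all add: k_pt lebesgue_on_borel)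
  have [measurable]: "(\<lambda>(t, s). f (pt h s t)) \<in> borel_measurable (borel \<Otimes>\<^sub>M borel)"
  proof -
    have "(\<lambda>(t, s). pt h s t) \<in> borel_measurable borel"
      by (auto simp: split_def intro!: borel_measurable_continuous_onI continuous_pt continuous_intros)
    from measurable_compose[OF this f] show ?thesis by (simp add: split_def borel_prod)
  qed
  have m: "(\<lambda>t. LINT s|lborel. indicator J s *\<^sub>R f (pt h s t)) \<in> borel_measurable borel"
    by measurable
  then show m2: "(\<lambda>t. LINT s|MJ. f (pt h s t)) \<in> borel_measurable borel"
    by (simp add: lebesgue_on_borel)
  have "integrable lborel (\<lambda>t. LINT s|lborel. k (t, s))" by (rule lborel_pair.integrable_fst'[OF ik])
  then show "integrable MJ (\<lambda>t. LINT s|MJ. f (pt h s t))"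
    by (simp add: ind lebesgue_on_borel m2)
  have "AE t in lborel. integrable lborel (\<lambda>s. k (t, s))" by (rule lborel_pair.AE_integrable_fst'[OF ik])
  then have "AE t in lborel. t \<in> J \<longrightarrow> integrable MJ (\<lambda>s. f (pt h s t))"
    by eventually_elim (auto simp: k_pt lebesgue_on_borel)
  then show "AE t in MJ. integrable MJ (\<lambda>s. f (pt h s t))"
    by (subst AE_restrict_space_iff) (auto intro: AE_completion)
  show "integral\<^sup>L MQ f = (LINT t|MJ. LINT s|MJ. f (pt h s t))"
    using lborel_pair.integral_fst'[OF ik]
    by (simp add: ind lebesgue_on_borel m2 Ik) (simp add: g_def lebesgue_on_borel f)
qed

lemma Fubini_square_continuous:
  fixes f :: "real \<times> real \<Rightarrow> complex"
  assumes f: "continuous_on UNIV f"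
  shows "integral\<^sup>L MQ f = (LINT t|MJ. LINT s|MJ. f (pt h s t))"
  using f by (intro Fubini_square borel_measurable_continuous_onI continuous_imp_L2_square(2)
      continuous_on_subset[OF f]) auto

lemma integral_square_tensor:
  fixes f g :: "real \<Rightarrow> complex"
  assumes f: "continuous_on UNIV f" and g: "continuous_on UNIV g"
  shows "(LINT z|MQ. f (fst z) * g (snd z)) = (LINT s|MJ. f s) * (LINT t|MJ. g t)"
proof -
  have "continuous_on UNIV (\<lambda>z::real \<times> real. f (fst z) * g (snd z))"
    by (intro continuous_intros continuous_on_compose2[OF f] continuous_on_compose2[OF g]) auto
  from Fubini_square_continuous[OF this, of True] show ?thesis
    by (simp add: pt_def)
qed

lemma L2_norm_tendsto_0:
  assumes "\<And>n::nat. h n \<in> borel_measurable (lebesgue_on \<Omega>)" and w: "integrable (lebesgue_on \<Omega>) w"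
    and b: "\<And>n. AE x in lebesgue_on \<Omega>. (cmod (h n x))\<^sup>2 \<le> w x"
    and lim: "AE x in lebesgue_on \<Omega>. (\<lambda>n. h n x) \<longlonglongrightarrow> 0"
  shows "(\<lambda>n. L2_norm \<Omega> (h n)) \<longlonglongrightarrow> 0"
proof -
  note [measurable] = assms(1)
  have "(\<lambda>n. LINT x|lebesgue_on \<Omega>. (cmod (h n x))\<^sup>2) \<longlonglongrightarrow> (LINT x|lebesgue_on \<Omega>. 0)"
  proof (rule integral_dominated_convergence[OF _ _ w])
    have "(\<lambda>n. (cmod (z n))\<^sup>2) \<longlonglongrightarrow> 0" if "z \<longlonglongrightarrow> 0" for z :: "nat \<Rightarrow> complex"
      using tendsto_power[OF tendsto_norm[OF that], of 2] by simp
    then show "AE x in lebesgue_on \<Omega>. (\<lambda>n. (cmod (h n x))\<^sup>2) \<longlonglongrightarrow> 0"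
      using lim by auto
    show "AE x in lebesgue_on \<Omega>. norm ((cmod (h n x))\<^sup>2) \<le> w x" for n
      using b[of n] by simp
  qed measurable
  from tendsto_real_sqrt[OF this] show ?thesis by (simp add: L2_norm_def)
qed

section \<open>Density in \<open>L\<^sup>2\<close> of the square\<close>

text \<open>The radial retraction onto the closed disc of radius \<open>m\<close>. Being continuous
  and bounded, it turns pointwise approximations into uniformly bounded ones.\<close>

definition clamp :: "real \<Rightarrow> complex \<Rightarrow> complex" where
  "clamp m z = of_real (m / max m (cmod z)) * z"

lemma continuous_clamp: "m > 0 \<Longrightarrow> continuous_on UNIV (clamp m)"
  unfolding clamp_def by (intro continuous_intros) auto

lemma norm_clamp: "m > 0 \<Longrightarrow> cmod (clamp m z) \<le> m"
  by (auto simp: clamp_def norm_mult norm_divide max_def field_simps)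

lemma norm_clamp_le: "m > 0 \<Longrightarrow> cmod (clamp m z) \<le> cmod z"
  by (auto simp: clamp_def norm_mult norm_divide max_def field_simps)

lemma clamp_eq: "m > 0 \<Longrightarrow> cmod z \<le> m \<Longrightarrow> clamp m z = z"
  by (auto simp: clamp_def max_def)

text \<open>At distance d from the boundary of the square, for n > 0, the value is 0 if d \<le> 1/n
  and 1 if d \<ge> 2/n. Only continuity is wanted here, so it is piecewise linear.\<close>

definition cutoff :: "nat \<Rightarrow> real \<times> real \<Rightarrow> real" where
  "cutoff n z = min 1 (max 0 (real n * min (min (fst z) (1 - fst z)) (min (snd z) (1 - snd z)) - 1))"

lemma continuous_cutoff: "continuous_on A (cutoff n)"
  unfolding cutoff_def
  by (intro continuous_on_min continuous_on_max continuous_on_diff continuous_on_mult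
      continuous_on_const continuous_on_fst continuous_on_snd continuous_on_id)

lemma cutoff_bounds: "0 \<le> cutoff n z" "cutoff n z \<le> 1"
  by (auto simp: cutoff_def)

lemma cutoff_eq_0: "cutoff n z \<noteq> 0 \<Longrightarrow> z \<in> {1 / real n..1 - 1 / real n} \<times> {1 / real n..1 - 1 / real n} \<and> n > 0"
proof -
  define d where "d = min (min (fst z) (1 - fst z)) (min (snd z) (1 - snd z))"
  assume "cutoff n z \<noteq> 0"
  then have *: "real n * d > 1"
    unfolding cutoff_def d_def[symmetric] by (cases "real n * d > 1") auto
  then have n: "n > 0" by (cases n) auto
  with * have "d > 1 / real n" by (simp add: field_simps)
  then have "1 / real n < fst z" "fst z < 1 - 1 / real n" "1 / real n < snd z" "snd z < 1 - 1 / real n"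
    by (auto simp: d_def)
  with n show ?thesis by (auto simp: mem_Times_iff simp del: divide_less_eq less_divide_eq divide_le_eq le_divide_eq)
qed

lemma cutoff_lim:
  assumes "z \<in> Q" shows "(\<lambda>n. cutoff n z) \<longlonglongrightarrow> 1"
proof -
  define d where "d = min (min (fst z) (1 - fst z)) (min (snd z) (1 - snd z))"
  have d: "d > 0" using assms by (auto simp: d_def unit_square_def)
  obtain N where N: "real N > 2 / d" using reals_Archimedean2 by blast
  have "cutoff n z = 1" if "n \<ge> N" for n
  proof -
    have "real n > 2 / d" using N that by linarith
    then have "real n * d - 1 \<ge> 1" using d by (simp add: field_simps)
    then show ?thesis by (simp add: cutoff_def d_def)
  qed
  then show ?thesis by (intro tendsto_eventually) (auto simp: eventually_sequentially)
qed

text \<open>A measurable function is an almost everywhere limit of continuous ones. Truncating these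
  by \<open>clamp\<close> makes dominated convergence applicable, once \<open>u\<close> itself has
  been truncated at small cost. The cutoff keeps \<psi> away from the boundary, which later permits
  division by a function that may vanish there.\<close>

lemma L2_approx_continuous:
  assumes u: "u \<in> L2 Q" and "\<epsilon> > 0"
  obtains \<psi> n where "continuous_on UNIV \<psi>" "\<And>z. \<psi> z \<noteq> 0 \<Longrightarrow> cutoff n z \<noteq> 0"
    "L2_norm Q (\<lambda>z. u z - \<psi> z) < \<epsilon>"
proof -
  note [measurable] = L2_measurable[OF u]
  have "(\<lambda>z. indicator Q z *\<^sub>R u z) \<in> borel_measurable lebesgue"
    using L2_measurable[OF u] by (simp add: borel_measurable_restrict_space_iff scaleR_conv_of_real)
  then have "(\<lambda>z. indicator Q z *\<^sub>R u z) measurable_on UNIV"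
    by (rule lebesgue_measurable_imp_measurable_on) simp
  then obtain N g where N: "negligible N" and g: "\<And>n. continuous_on UNIV (g n)"
    and lim: "\<And>z. z \<notin> N \<Longrightarrow> (\<lambda>n. g n z) \<longlonglongrightarrow> indicator Q z *\<^sub>R u z"
    unfolding measurable_on_def by auto
  have AEN: "AE z in MQ. z \<notin> N"
    using N by (subst AE_restrict_space_iff) (auto simp: negligible_iff_null_sets AE_not_in eventually_mono[OF AE_not_in])
  have clamp_meas: "(\<lambda>z. clamp m (u z)) \<in> borel_measurable MQ" if "m > 0" for m
    by (rule measurable_compose[OF L2_measurable[OF u] borel_measurable_continuous_onI[OF continuous_clamp[OF that]]])
  have clampL2: "(\<lambda>z. clamp m (u z)) \<in> L2 Q" if "m > 0" for m
  proof -
    note [measurable] = clamp_meas[OF that]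
    have "integrable MQ (\<lambda>z. (cmod (clamp m (u z)))\<^sup>2)"
      by (rule Bochner_Integration.integrable_bound[OF L2_integrable_sq[OF u]])
        (use norm_clamp_le[OF that] in \<open>auto intro!: power_mono\<close>)
    then show ?thesis by (simp add: L2_def)
  qed
  have "(\<lambda>m. L2_norm Q (\<lambda>z. u z - clamp (real (Suc m)) (u z))) \<longlonglongrightarrow> 0"
  proof (rule L2_norm_tendsto_0)
    show "(\<lambda>z. u z - clamp (real (Suc m)) (u z)) \<in> borel_measurable MQ" for m
      using clamp_meas[of "real (Suc m)"] by (intro borel_measurable_diff) auto
    show "integrable MQ (\<lambda>z. 4 * (cmod (u z))\<^sup>2)"
      using L2_integrable_sq[OF u] by simp
    have "(cmod (u z - clamp (real (Suc m)) (u z)))\<^sup>2 \<le> 4 * (cmod (u z))\<^sup>2" for z m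
    proof -
      have "cmod (u z - clamp (real (Suc m)) (u z)) \<le> 2 * cmod (u z)"
        using norm_triangle_ineq4[of "u z" "clamp (real (Suc m)) (u z)"] norm_clamp_le[of "real (Suc m)" "u z"]
        by simp
      from power_mono[OF this, of 2] show ?thesis by (simp add: power_mult_distrib)
    qed
    then show "AE z in MQ. (cmod (u z - clamp (real (Suc m)) (u z)))\<^sup>2 \<le> 4 * (cmod (u z))\<^sup>2" for m
      by simp
    have "(\<lambda>m. u z - clamp (real (Suc m)) (u z)) \<longlonglongrightarrow> 0" for z
    proof (rule tendsto_eventually)
      obtain M :: nat where "cmod (u z) \<le> real M" using real_arch_simple by blast
      then have "u z - clamp (real (Suc m)) (u z) = 0" if "m \<ge> M" for m
        using that by (subst clamp_eq) auto
      then show "\<forall>\<^sub>F m in sequentially. u z - clamp (real (Suc m)) (u z) = 0"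
        by (auto simp: eventually_sequentially)
    qed
    then show "AE z in MQ. (\<lambda>m. u z - clamp (real (Suc m)) (u z)) \<longlonglongrightarrow> 0" by simp
  qed
  then have "\<forall>\<^sub>F m in sequentially. L2_norm Q (\<lambda>z. u z - clamp (real (Suc m)) (u z)) < \<epsilon> / 2"
    using \<open>\<epsilon> > 0\<close> by (intro order_tendstoD) auto
  then obtain m' where m': "L2_norm Q (\<lambda>z. u z - clamp (real (Suc m')) (u z)) < \<epsilon> / 2"
    by (auto simp: eventually_sequentially)
  define m where "m = real (Suc m')"
  have m: "m > 0" and mb: "L2_norm Q (\<lambda>z. u z - clamp m (u z)) < \<epsilon> / 2" using m' by (auto simp: m_def)
  define \<psi> where "\<psi> n z = of_real (cutoff n z) * clamp m (g n z)" for n z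
  have \<psi>c: "continuous_on UNIV (\<psi> n)" for n
    unfolding \<psi>_def
    by (intro continuous_intros continuous_cutoff continuous_on_compose2[OF continuous_clamp[OF m]] g) auto
  have \<psi>L2: "\<psi> n \<in> L2 Q" for n
    using \<psi>c by (intro continuous_imp_L2_square(1)) (rule continuous_on_subset, auto)
  have "(\<lambda>n. L2_norm Q (\<lambda>z. clamp m (u z) - \<psi> n z)) \<longlonglongrightarrow> 0"
  proof (rule L2_norm_tendsto_0)
    show "(\<lambda>z. clamp m (u z) - \<psi> n z) \<in> borel_measurable MQ" for n
      by (intro borel_measurable_diff clamp_meas[OF m] L2_measurable \<psi>L2)
    interpret finite_measure MQ by (rule finite_measure_lebesgue_on[OF Q_lmeasurable])
    show "integrable MQ (\<lambda>z. (2 * m)\<^sup>2)" by (rule integrable_const)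
    have "(cmod (clamp m (u z) - \<psi> n z))\<^sup>2 \<le> (2 * m)\<^sup>2" for z n
    proof (rule power_mono)
      have "cmod (\<psi> n z) \<le> 1 * m"
        unfolding \<psi>_def norm_mult using norm_clamp[OF m] cutoff_bounds by (intro mult_mono) auto
      then show "cmod (clamp m (u z) - \<psi> n z) \<le> 2 * m"
        using norm_triangle_ineq4[of "clamp m (u z)" "\<psi> n z"] norm_clamp[OF m, of "u z"] by simp
    qed auto
    then show "AE z in MQ. (cmod (clamp m (u z) - \<psi> n z))\<^sup>2 \<le> (2 * m)\<^sup>2" for n by simp
    have pointwise: "(\<lambda>n. clamp m (u z) - \<psi> n z) \<longlonglongrightarrow> 0" if "z \<in> Q" "z \<notin> N" for z
    proof -
      have "(\<lambda>n. clamp m (g n z)) \<longlonglongrightarrow> clamp m (u z)"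
        using lim[OF that(2)] that(1) continuous_on_tendsto_compose[OF continuous_clamp[OF m], of "\<lambda>n. g n z" "u z" sequentially]
        by simp
      from tendsto_mult[OF tendsto_of_real[OF cutoff_lim[OF that(1)]] this]
      have "(\<lambda>n. \<psi> n z) \<longlonglongrightarrow> clamp m (u z)" by (simp add: \<psi>_def)
      from tendsto_diff[OF tendsto_const[of "clamp m (u z)"] this] show ?thesis by simp
    qed
    have "AE z in MQ. z \<in> Q" by (rule AE_I2) (simp add: space_restrict_space)
    with AEN show "AE z in MQ. (\<lambda>n. clamp m (u z) - \<psi> n z) \<longlonglongrightarrow> 0"
      by eventually_elim (rule pointwise)
  qed
  then have "\<forall>\<^sub>F n in sequentially. L2_norm Q (\<lambda>z. clamp m (u z) - \<psi> n z) < \<epsilon> / 2"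
    using \<open>\<epsilon> > 0\<close> by (intro order_tendstoD) auto
  then obtain n where n: "L2_norm Q (\<lambda>z. clamp m (u z) - \<psi> n z) < \<epsilon> / 2"
    by (auto simp: eventually_sequentially)
  have "L2_norm Q (\<lambda>z. u z - \<psi> n z) < \<epsilon>"
    using L2_norm_triangle_diff[OF u clampL2[OF m] \<psi>L2[of n]] mb n by simp
  then show thesis by (rule that[OF \<psi>c, of n n, rotated]) (auto simp: \<psi>_def)
qed

text \<open>Multiplication by the functions of \<open>P\<close> below preserves \<open>K\<close>, so Stone-Weierstrass yields
  uniform approximations \<open>p\<close> of \<open>\<psi> / \<sigma>\<close> with \<open>p \<sigma> \<in> K\<close>.\<close>

lemma L2_square_dense:
  fixes K :: "(real \<times> real \<Rightarrow> complex) set" and a b :: "real \<Rightarrow> real"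
  assumes add: "\<And>f g. f \<in> K \<Longrightarrow> g \<in> K \<Longrightarrow> (\<lambda>z. f z + g z) \<in> K"
    and scale: "\<And>c f. f \<in> K \<Longrightarrow> (\<lambda>z. c * f z) \<in> K"
    and a: "continuous_on {0..1} a" "inj_on a {0..1}" "\<And>f. f \<in> K \<Longrightarrow> (\<lambda>z. of_real (a (fst z)) * f z) \<in> K"
    and b: "continuous_on {0..1} b" "inj_on b {0..1}" "\<And>f. f \<in> K \<Longrightarrow> (\<lambda>z. of_real (b (snd z)) * f z) \<in> K"
    and \<sigma>: "(\<lambda>z. of_real (\<sigma> z)) \<in> K" "continuous_on UNIV \<sigma>" "\<And>z. z \<in> Q \<Longrightarrow> \<sigma> z \<noteq> 0"
    and u: "u \<in> L2 Q" and \<epsilon>: "\<epsilon> > 0"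
  obtains q where "q \<in> K" "q \<in> L2 Q" "L2_norm Q (\<lambda>z. u z - q z) < \<epsilon>"
proof -
  let ?S = "closed_square"
  define P where "P f \<longleftrightarrow> continuous_on ?S f \<and> (\<forall>h\<in>K. (\<lambda>z. of_real (f z) * h z) \<in> K)" for f :: "real \<times> real \<Rightarrow> real"
  have ca: "continuous_on ?S (\<lambda>z. a (fst z))"
    by (rule continuous_on_compose2[OF a(1)]) (auto intro: continuous_on_fst)
  have cb: "continuous_on ?S (\<lambda>z. b (snd z))"
    by (rule continuous_on_compose2[OF b(1)]) (auto intro: continuous_on_snd)
  have SW: "\<exists>g. P g \<and> (\<forall>x\<in>?S. \<bar>f x - g x\<bar> < e)" if "continuous_on ?S f" "0 < e" for f e
  proof (rule Stone_Weierstrass_HOL[OF compact_closed_square _ _ _ _ _ that])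
    show "P (\<lambda>x. c)" for c by (auto simp: P_def intro: scale)
    show "P f \<Longrightarrow> continuous_on ?S f" for f by (simp add: P_def)
    show "P (\<lambda>x. f x + g x)" if "P f \<and> P g" for f g
      using that by (auto simp: P_def distrib_right intro!: continuous_intros add)
    show "P (\<lambda>x. f x * g x)" if "P f \<and> P g" for f g
      using that by (auto simp: P_def mult.assoc intro!: continuous_intros)
    show "\<exists>f. P f \<and> f x \<noteq> f y" if "x \<in> ?S \<and> y \<in> ?S \<and> x \<noteq> y" for x y
    proof (cases "fst x = fst y")
      case False
      have "P (\<lambda>z. a (fst z))"
        unfolding P_def using ca a(3) by blast
      moreover have "a (fst x) \<noteq> a (fst y)"
        using False that inj_on_eq_iff[OF a(2), of "fst x" "fst y"] by (simp add: mem_Times_iff)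
      ultimately show ?thesis by (intro exI conjI)
    next
      case True
      have "P (\<lambda>z. b (snd z))"
        unfolding P_def using cb b(3) by blast
      moreover have "b (snd x) \<noteq> b (snd y)"
        using True that inj_on_eq_iff[OF b(2), of "snd x" "snd y"] by (simp add: mem_Times_iff prod_eq_iff)
      ultimately show ?thesis by (intro exI conjI)
    qed
  qed
  obtain \<psi> n where \<psi>: "continuous_on UNIV \<psi>" "\<And>z. \<psi> z \<noteq> 0 \<Longrightarrow> cutoff n z \<noteq> 0"
    "L2_norm Q (\<lambda>z. u z - \<psi> z) < \<epsilon> / 2"
    using L2_approx_continuous[OF u, of "\<epsilon> / 2"] \<epsilon> by auto
  have \<sigma>c: "continuous_on A \<sigma>" for A using \<sigma>(2) by (rule continuous_on_subset) simp
  define \<theta> where "\<theta> z = \<psi> z / of_real (\<sigma> z)" for z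
  let ?C = "{1 / real n..1 - 1 / real n} \<times> {1 / real n..1 - 1 / real n}"
  have CQ: "?C \<subseteq> Q" if "n > 0"
  proof -
    have "{r..1 - r} \<subseteq> J" if "r > 0" for r :: real using that by auto
    from this[of "1 / real n"] show ?thesis using that unfolding unit_square_def by (intro Sigma_mono) simp_all
  qed
  have \<psi>0: "\<psi> z = 0" if "z \<notin> ?C \<or> n = 0" for z using \<psi>(2)[of z] cutoff_eq_0[of n z] that by auto
  \<comment> \<open>Two open sets cover the plane: on \<open>Q\<close> the divisor is nonzero, and
    off \<open>?C\<close> the quotient is constantly 0. Index 0 is treated apart, since 1/0 = 0
    would make \<open>?C\<close> the closed square; there \<psi> vanishes identically.\<close>
  have \<theta>c: "continuous_on UNIV \<theta>"
  proof (cases "n = 0")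
    case True
    then show ?thesis unfolding \<theta>_def using \<psi>0 by simp
  next
    case False
    have "continuous_on Q \<theta>"
      unfolding \<theta>_def using \<sigma>(3)
      by (intro continuous_intros \<sigma>c continuous_on_subset[OF \<psi>(1)]) auto
    moreover have "continuous_on (- ?C) \<theta> \<longleftrightarrow> continuous_on (- ?C) (\<lambda>z. 0::complex)"
      by (rule continuous_on_cong) (use \<psi>0 in \<open>auto simp: \<theta>_def\<close>)
    moreover have "open (- ?C)" by (intro open_Compl closed_Times closed_atLeastAtMost)
    ultimately have "continuous_on (Q \<union> - ?C) \<theta>"
      using open_Q by (intro continuous_on_open_Un) auto
    moreover have "Q \<union> - ?C = UNIV" using CQ False by auto
    ultimately show ?thesis by simp
  qed
  have \<psi>\<theta>: "\<psi> z = \<theta> z * of_real (\<sigma> z)" if "z \<in> Q" for z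
    using \<sigma>(3)[OF that] by (simp add: \<theta>_def)
  obtain B where B: "B > 0" "\<And>z. z \<in> ?S \<Longrightarrow> \<bar>\<sigma> z\<bar> \<le> B"
    using compact_imp_bounded[OF compact_continuous_image[OF \<sigma>c compact_closed_square]]
    unfolding bounded_pos by auto
  define m where "m = sqrt (measure lebesgue Q)"
  \<comment> \<open>The final error is at most 2 \<delta> B m, which is \<epsilon>/2 times m/(m +
    1). The summand 1 keeps the denominator positive without computing the measure of
    \<open>Q\<close>.\<close>
  define \<delta> where "\<delta> = \<epsilon> / (4 * B * (m + 1))"
  have m: "m \<ge> 0" by (simp add: m_def)
  have \<delta>: "\<delta> > 0" using \<epsilon> B m by (simp add: \<delta>_def)
  have "continuous_on ?S (\<lambda>z. Re (\<theta> z))" "continuous_on ?S (\<lambda>z. Im (\<theta> z))"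
    using \<theta>c by (auto intro!: continuous_intros continuous_on_subset[OF \<theta>c])
  from SW[OF this(1) \<delta>] SW[OF this(2) \<delta>] obtain p1 p2 where
    p: "P p1" "P p2" "\<And>z. z \<in> ?S \<Longrightarrow> \<bar>Re (\<theta> z) - p1 z\<bar> < \<delta>" "\<And>z. z \<in> ?S \<Longrightarrow> \<bar>Im (\<theta> z) - p2 z\<bar> < \<delta>"
    by blast
  define q where "q = (\<lambda>z. of_real (p1 z) * of_real (\<sigma> z) + \<i> * (of_real (p2 z) * of_real (\<sigma> z)) :: complex)"
  have qK: "q \<in> K" unfolding q_def using p(1,2) \<sigma>(1) by (intro add scale) (auto simp: P_def)
  have "continuous_on ?S q" unfolding q_def using p(1,2) by (auto simp: P_def intro!: continuous_intros \<sigma>c)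
  then have qL: "q \<in> L2 Q" by (rule continuous_imp_L2_square)
  have \<psi>L: "\<psi> \<in> L2 Q" by (intro continuous_imp_L2_square continuous_on_subset[OF \<psi>(1)]) auto
  have "cmod (\<psi> z - q z) \<le> 2 * \<delta> * B" if z: "z \<in> Q" for z
  proof -
    have zS: "z \<in> ?S" using z Q_subset by auto
    have "\<psi> z - q z = (\<theta> z - Complex (p1 z) (p2 z)) * of_real (\<sigma> z)"
      by (simp add: \<psi>\<theta>[OF z] q_def Complex_eq algebra_simps)
    then have "cmod (\<psi> z - q z) = cmod (\<theta> z - Complex (p1 z) (p2 z)) * \<bar>\<sigma> z\<bar>" by (simp add: norm_mult)
    also have "\<dots> \<le> (2 * \<delta>) * B"
    proof (intro mult_mono B zS)
      show "cmod (\<theta> z - Complex (p1 z) (p2 z)) \<le> 2 * \<delta>"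
        using cmod_le[of "\<theta> z - Complex (p1 z) (p2 z)"] p(3,4)[OF zS] by simp
    qed (use \<delta> in auto)
    finally show ?thesis .
  qed
  then have "L2_norm Q (\<lambda>z. \<psi> z - q z) \<le> 2 * \<delta> * B * m"
    unfolding m_def using \<delta> B by (intro L2_norm_le_sup Q_lmeasurable L2_diff \<psi>L qL) auto
  also have "\<dots> = \<epsilon> / 2 * (m / (m + 1))" unfolding \<delta>_def using B(1) m by (simp add: divide_simps)
  also have "\<dots> \<le> \<epsilon> / 2 * 1" using m \<epsilon> by (intro mult_left_mono) auto
  finally have "L2_norm Q (\<lambda>z. u z - q z) < \<epsilon>"
    using L2_norm_triangle_diff[OF u \<psi>L qL] \<psi>(3) by simp
  with qK qL show thesis by (rule that)
qed

section \<open>Smooth functions\<close>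

lemma partial_eqI: "(\<phi> has_derivative D) (at x) \<Longrightarrow> partial b \<phi> x = D b"
  unfolding partial_def by (metis frechet_derivative_at)

lemma partial_has_derivative:
  "\<phi> differentiable_on UNIV \<Longrightarrow> (\<phi> has_derivative (\<lambda>b. partial b \<phi> x)) (at x)"
  unfolding partial_def by (auto simp: differentiable_on_def frechet_derivative_works[symmetric])

lemma C_diff_continuous: "C_diff n \<phi> \<Longrightarrow> continuous_on A \<phi>"
  by (cases n) (auto intro: continuous_on_subset differentiable_imp_continuous_on)

lemma C_diff_pred: "C_diff (Suc n) \<phi> \<Longrightarrow> C_diff n \<phi>"
proof (induction n arbitrary: \<phi>)
  case 0
  then show ?case by (simp add: differentiable_imp_continuous_on)
qed auto

lemma C_diff_const: "C_diff n (\<lambda>x. c)"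
proof (induction n arbitrary: c)
  case (Suc n)
  have "partial b (\<lambda>x. c) = (\<lambda>x. 0)" for b :: 'a
    by (auto intro!: partial_eqI[THEN trans] derivative_intros)
  then show ?case using Suc by simp
qed simp

lemma partial_add:
  assumes "f differentiable_on UNIV" "g differentiable_on UNIV"
  shows "partial b (\<lambda>x. f x + g x) = (\<lambda>x. partial b f x + partial b g x)"
  by (rule ext, rule partial_eqI[THEN trans], rule has_derivative_add[OF assms[THEN partial_has_derivative]]) simp

lemma partial_mult:
  assumes "f differentiable_on UNIV" "g differentiable_on UNIV"
  shows "partial b (\<lambda>x. f x * g x) = (\<lambda>x. f x * partial b g x + partial b f x * g x)"
  by (rule ext, rule partial_eqI[THEN trans], rule has_derivative_mult[OF assms[THEN partial_has_derivative]]) simp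

lemma C_diff_add: "C_diff n f \<Longrightarrow> C_diff n g \<Longrightarrow> C_diff n (\<lambda>x. f x + g x)"
proof (induction n arbitrary: f g)
  case 0
  then show ?case by (auto intro: continuous_intros)
next
  case (Suc n)
  then show ?case by (auto simp: partial_add intro!: differentiable_on_add)
qed

lemma C_diff_mult: "C_diff n f \<Longrightarrow> C_diff n g \<Longrightarrow> C_diff n (\<lambda>x. f x * g x)"
proof (induction n arbitrary: f g)
  case 0
  then show ?case by (auto intro: continuous_intros)
next
  case (Suc n)
  then show ?case
    using C_diff_pred[OF Suc.prems(1)] C_diff_pred[OF Suc.prems(2)]
    by (auto simp: partial_mult intro!: differentiable_on_mult C_diff_add)
qed

lemma has_derivative_real_partial:
  fixes f :: "real \<Rightarrow> complex"
  assumes "f differentiable_on UNIV"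
  shows "(f has_vector_derivative partial 1 f x) (at x)"
proof -
  have "(f has_derivative (\<lambda>b. partial b f x)) (at x)" by (rule partial_has_derivative[OF assms])
  note D = this
  have "partial (b *\<^sub>R 1) f x = b *\<^sub>R partial 1 f x" for b
    by (rule linear_cmul[OF bounded_linear.linear[OF has_derivative_bounded_linear[OF D]]])
  then have eq: "b *\<^sub>R partial 1 f x = partial b f x" for b
    unfolding real_scaleR_def mult_1_right by (rule sym)
  show ?thesis unfolding has_vector_derivative_def eq by (rule D)
qed

lemma partial_1_eqI: "(f has_vector_derivative f') (at x) \<Longrightarrow> partial 1 f x = f'"
  unfolding has_vector_derivative_def by (drule partial_eqI[where b = 1]) simp

lemma has_derivative_affine:
  fixes f :: "real \<Rightarrow> complex" and L :: "'a::euclidean_space \<Rightarrow> real"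
  assumes L: "bounded_linear L" and f: "f differentiable_on UNIV"
  shows "((\<lambda>x. f (L x + c)) has_derivative (\<lambda>b. of_real (L b) * partial 1 f (L x + c))) (at x)"
proof -
  have 1: "((\<lambda>x. L x + c) has_derivative L) (at x)"
    using has_derivative_add[OF bounded_linear_imp_has_derivative[OF L] has_derivative_const] by simp
  have "(f has_derivative (\<lambda>r. r *\<^sub>R partial 1 f (L x + c))) (at (L x + c))"
    using has_derivative_real_partial[OF f, of "L x + c"] unfolding has_vector_derivative_def .
  from has_derivative_compose[OF 1 this] show ?thesis by (simp add: scaleR_conv_of_real)
qed

lemma partial_affine:
  fixes f :: "real \<Rightarrow> complex"
  assumes "bounded_linear L" and "f differentiable_on UNIV"
  shows "partial b (\<lambda>x. f (L x + c)) = (\<lambda>x. of_real (L b) * partial 1 f (L x + c))"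
  by (rule ext) (rule partial_eqI[OF has_derivative_affine[OF assms]])

lemma C_diff_affine:
  fixes f :: "real \<Rightarrow> complex"
  assumes L: "bounded_linear L"
  shows "C_diff n f \<Longrightarrow> C_diff n (\<lambda>x. f (L x + c))"
proof (induction n arbitrary: f)
  case 0
  have "continuous_on UNIV (\<lambda>x. L x + c)"
    by (intro continuous_on_add linear_continuous_on[OF L] continuous_on_const)
  then have "continuous_on UNIV (\<lambda>x. f (L x + c))"
    using 0 by (intro continuous_on_compose2[of UNIV f UNIV "\<lambda>x. L x + c"]) auto
  then show ?case by simp
next
  case (Suc n)
  then have d: "f differentiable_on UNIV" and f': "C_diff n (partial 1 f)" by auto
  have "(\<lambda>x. f (L x + c)) differentiable_on UNIV"
    unfolding differentiable_on_def using differentiableI[OF has_derivative_affine[OF L d]] by blast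
  moreover have "C_diff n (partial b (\<lambda>x. f (L x + c)))" for b
    unfolding partial_affine[OF L d] by (intro C_diff_mult C_diff_const Suc.IH f')
  ultimately show ?case by simp
qed

lemma smooth_continuous: "smooth \<phi> \<Longrightarrow> continuous_on A \<phi>"
  unfolding smooth_def by (rule C_diff_continuous[of 0]) simp

lemma smooth_differentiable: "smooth \<phi> \<Longrightarrow> \<phi> differentiable_on UNIV"
  unfolding smooth_def using C_diff.simps(2) by blast

lemma smooth_partial: "smooth \<phi> \<Longrightarrow> b \<in> Basis \<Longrightarrow> smooth (partial b \<phi>)"
  unfolding smooth_def using C_diff.simps(2) by blast

lemma smooth_const: "smooth (\<lambda>x. c)"
  and smooth_add: "smooth f \<Longrightarrow> smooth g \<Longrightarrow> smooth (\<lambda>x. f x + g x)"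
  and smooth_mult: "smooth f \<Longrightarrow> smooth g \<Longrightarrow> smooth (\<lambda>x. f x * g x)"
  by (auto simp: smooth_def intro: C_diff_const C_diff_add C_diff_mult)

lemma smooth_sum: "(\<And>i. i \<in> A \<Longrightarrow> smooth (f i)) \<Longrightarrow> smooth (\<lambda>x. \<Sum>i\<in>A. f i x)"
  by (induction A rule: infinite_finite_induct) (auto intro: smooth_const smooth_add)

lemma partial_sum:
  assumes "\<And>i. i \<in> A \<Longrightarrow> smooth (f i)"
  shows "partial b (\<lambda>x. \<Sum>i\<in>A. f i x) = (\<lambda>x. \<Sum>i\<in>A. partial b (f i) x)"
proof (rule ext, rule partial_eqI[THEN trans])
  show "((\<lambda>x. \<Sum>i\<in>A. f i x) has_derivative (\<lambda>b. \<Sum>i\<in>A. partial b (f i) x)) (at x)" for x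
    using assms by (intro has_derivative_sum partial_has_derivative smooth_differentiable)
qed simp

lemma smooth_affine:
  fixes f :: "real \<Rightarrow> complex"
  shows "bounded_linear L \<Longrightarrow> smooth f \<Longrightarrow> smooth (\<lambda>x. f (L x + c))"
  by (auto simp: smooth_def intro: C_diff_affine)

text \<open>Closure of a family under differentiation gives all orders at once by induction; bumps,
  polynomials, trigonometric functions and exponentials each form such a family.\<close>

lemma smooth_realI:
  fixes f :: "real \<Rightarrow> complex"
  assumes "f \<in> S" and "\<And>f. f \<in> S \<Longrightarrow> \<exists>f'\<in>S. \<forall>x. (f has_vector_derivative f' x) (at x)"
  shows "smooth f"
proof -
  have "C_diff n f" if "f \<in> S" for n f
    using that
  proof (induction n arbitrary: f)
    case 0
    from assms(2)[OF 0] show ?case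
      by (auto simp: continuous_on_eq_continuous_at intro!: has_vector_derivative_continuous)
  next
    case (Suc n)
    from assms(2)[OF Suc.prems] obtain f' where f': "f' \<in> S" "\<And>x. (f has_vector_derivative f' x) (at x)"
      by blast
    have "partial 1 f = f'" using f'(2) by (auto intro: partial_1_eqI)
    moreover have "f differentiable_on UNIV"
      using f'(2) unfolding differentiable_on_def by (auto intro: differentiableI_vector)
    ultimately show ?case using Suc.IH[OF f'(1)] by simp
  qed
  then show ?thesis using assms(1) by (simp add: smooth_def)
qed

section \<open>Coordinates along a direction flag, and derivatives in that direction\<close>

definition sc :: "bool \<Rightarrow> real \<times> real \<Rightarrow> real" where "sc h = (if h then fst else snd)"
definition tc :: "bool \<Rightarrow> real \<times> real \<Rightarrow> real" where "tc h = (if h then snd else fst)"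
definition dir :: "bool \<Rightarrow> real \<times> real" where "dir h = (if h then (1, 0) else (0, 1))"

lemma sc_pt [simp]: "sc h (pt h s t) = s" and tc_pt [simp]: "tc h (pt h s t) = t"
  and pt_sc_tc [simp]: "pt h (sc h z) (tc h z) = z"
  by (auto simp: sc_def tc_def pt_def)

lemma sc_dir [simp]: "sc h (dir h) = 1" and tc_dir [simp]: "tc h (dir h) = 0"
  by (auto simp: sc_def tc_def dir_def)

lemma dir_Basis [simp]: "dir h \<in> Basis"
  by (auto simp: dir_def Basis_prod_def)

lemma Basis_dir: "Basis = {dir True, dir False}" and dir_neq: "dir True \<noteq> dir False"
  by (auto simp: dir_def Basis_prod_def)

abbreviation pd :: "bool \<Rightarrow> (real \<times> real \<Rightarrow> complex) \<Rightarrow> real \<times> real \<Rightarrow> complex" where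
  "pd h \<equiv> partial (dir h)"
abbreviation wpd :: "bool \<Rightarrow> (real \<times> real \<Rightarrow> complex) \<Rightarrow> real \<times> real \<Rightarrow> complex" where
  "wpd h \<equiv> weak_partial Q (dir h)"

lemma bounded_linear_sc: "bounded_linear (sc h)" and bounded_linear_tc: "bounded_linear (tc h)"
  by (auto simp: sc_def tc_def bounded_linear_fst bounded_linear_snd)

lemma smooth_sc: "smooth (f :: real \<Rightarrow> complex) \<Longrightarrow> smooth (\<lambda>z. f (sc h z))"
  and smooth_tc: "smooth f \<Longrightarrow> smooth (\<lambda>z. f (tc h z))"
  using smooth_affine[where c = 0, OF bounded_linear_sc] smooth_affine[where c = 0, OF bounded_linear_tc] by auto

lemma mem_Q_sc_tc: "z \<in> Q \<longleftrightarrow> sc h z \<in> J \<and> tc h z \<in> J"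
  by (auto simp: sc_def tc_def unit_square_def mem_Times_iff)

lemma pt_closed_square [simp]: "pt h s t \<in> closed_square \<longleftrightarrow> s \<in> {0..1} \<and> t \<in> {0..1}"
  by (auto simp: pt_def)

lemma partial_tensor:
  assumes "smooth f" "smooth g"
  shows "pd h (\<lambda>z. f (sc h z) * g (tc h z)) = (\<lambda>z. partial 1 f (sc h z) * g (tc h z))"
proof -
  have f: "pd h (\<lambda>z. f (sc h z)) = (\<lambda>z. partial 1 f (sc h z))"
    using partial_affine[where c = 0 and b = "dir h", OF bounded_linear_sc smooth_differentiable[OF assms(1)]] by simp
  have g: "pd h (\<lambda>z. g (tc h z)) = (\<lambda>z. 0)"
    using partial_affine[where c = 0 and b = "dir h", OF bounded_linear_tc smooth_differentiable[OF assms(2)]] by simp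
  show ?thesis
    by (subst partial_mult) (auto intro: smooth_differentiable smooth_sc smooth_tc assms simp: f g)
qed

lemma has_vector_derivative_pt:
  assumes "smooth \<phi>"
  shows "((\<lambda>s. \<phi> (pt h s t)) has_vector_derivative pd h \<phi> (pt h s t)) (at s)"
proof -
  note D = partial_has_derivative[OF smooth_differentiable[OF assms]]
  have lin: "partial (r *\<^sub>R b) \<phi> x = r *\<^sub>R partial b \<phi> x" for r b x
    by (rule linear_cmul[OF bounded_linear.linear[OF has_derivative_bounded_linear[OF D]]])
  have eq: "pt h s t = s *\<^sub>R dir h + pt h 0 t" for s
    by (auto simp: pt_def dir_def)
  have "((\<lambda>s. s *\<^sub>R dir h + pt h 0 t) has_derivative (\<lambda>r. r *\<^sub>R dir h)) (at s)"
    by (auto intro!: derivative_eq_intros)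
  then have "((\<lambda>s. pt h s t) has_derivative (\<lambda>r. r *\<^sub>R dir h)) (at s)" by (simp add: eq[symmetric])
  from has_derivative_compose[OF this D]
  show ?thesis unfolding has_vector_derivative_def lin .
qed

section \<open>Smooth functions flat at the origin\<close>

definition bump :: "real poly \<Rightarrow> real \<Rightarrow> real" where
  "bump p x = (if x \<le> 0 then 0 else poly p (1 / x) * exp (- (1 / x)))"

lemma poly_mult_exp_tendsto_0: "((\<lambda>y. poly p y * exp (- y)) \<longlongrightarrow> (0::real)) at_top"
proof -
  have "((\<lambda>y. \<Sum>i\<le>degree p. coeff p i * (y ^ i / exp y)) \<longlongrightarrow> (\<Sum>i\<le>degree p. coeff p i * 0)) at_top"
    by (intro tendsto_intros tendsto_power_div_exp_0)
  then show ?thesis by (simp add: poly_altdef exp_minus sum_divide_distrib divide_inverse[symmetric])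
qed

text \<open>With y = 1/x, the derivative of p(y) exp(-y) with respect to x is y^2 (p - p')(y)
  exp(-y), so the family \<open>bump p\<close> is closed under differentiation. At 0 the derivative
  vanishes because the exponential beats every polynomial.\<close>

lemma bump_has_derivative:
  "(bump p has_real_derivative bump ([:0, 0, 1:] * (p - pderiv p)) x) (at x)"
proof (cases x "0::real" rule: linorder_cases)
  case less
  have "((\<lambda>x. 0) has_real_derivative 0) (at x)" by simp
  moreover have "\<forall>\<^sub>F y in nhds x. bump p y = 0"
    using less by (intro eventually_nhds_in_open[THEN eventually_mono, of "{..<0}"]) (auto simp: bump_def)
  ultimately show ?thesis using less
    by (subst DERIV_cong_ev[OF refl _ refl]) (auto simp: bump_def)
next
  case greater
  have "((\<lambda>x. poly p (1 / x) * exp (- (1 / x))) has_real_derivative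
    poly ([:0, 0, 1:] * (p - pderiv p)) (1 / x) * exp (- (1 / x))) (at x)"
    using greater by (auto intro!: derivative_eq_intros simp: field_simps power2_eq_square)
  moreover have "\<forall>\<^sub>F y in nhds x. bump p y = poly p (1 / y) * exp (- (1 / y))"
    using greater by (intro eventually_nhds_in_open[THEN eventually_mono, of "{0<..}"]) (auto simp: bump_def)
  ultimately show ?thesis using greater
    by (subst DERIV_cong_ev[OF refl _ refl]) (auto simp: bump_def)
next
  case equal
  \<comment> \<open>Dividing by x replaces p(y) by y p(y), so the difference quotient at 0 is
    covered by \<open>poly_mult_exp_tendsto_0\<close> as well.\<close>
  have "((\<lambda>y. poly ([:0, 1:] * p) (inverse y) * exp (- inverse y)) \<longlongrightarrow> 0) (at_right 0)"
    using filterlim_compose[OF poly_mult_exp_tendsto_0[of "[:0, 1:] * p"] filterlim_inverse_at_top_right] .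
  then have "((\<lambda>y. (bump p y - bump p 0) / (y - 0)) \<longlongrightarrow> 0) (at_right 0)"
    by (rule Lim_transform_eventually)
      (auto simp: bump_def field_simps intro!: eventually_at_rightI[of 0 1])
  moreover have "((\<lambda>y. (bump p y - bump p 0) / (y - 0)) \<longlongrightarrow> 0) (at_left 0)"
    by (rule tendsto_eventually) (auto simp: bump_def intro!: eventually_at_leftI[of "-1" 0])
  ultimately have "((\<lambda>y. (bump p y - bump p 0) / (y - 0)) \<longlongrightarrow> 0) (at 0)"
    by (simp add: filterlim_split_at)
  then show ?thesis using equal by (simp add: has_field_derivative_iff bump_def)
qed

lemma smooth_bump: "smooth (\<lambda>x. of_real (bump p x))"
proof (rule smooth_realI[where S = "range (\<lambda>p x. of_real (bump p x))"])
  fix f :: "real \<Rightarrow> complex" assume "f \<in> range (\<lambda>p x. of_real (bump p x))"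
  then obtain p where f: "f = (\<lambda>x. of_real (bump p x))" by auto
  have "(f has_vector_derivative of_real (bump ([:0, 0, 1:] * (p - pderiv p)) x)) (at x)" for x
    unfolding f by (intro has_vector_derivative_of_real bump_has_derivative)
  then show "\<exists>f'\<in>range (\<lambda>p x. of_real (bump p x)). \<forall>x. (f has_vector_derivative f' x) (at x)"
    by (intro bexI[of _ "\<lambda>x. of_real (bump ([:0, 0, 1:] * (p - pderiv p)) x)"] allI rangeI)
qed auto

section \<open>Test functions and uniqueness of weak derivatives\<close>

text \<open>This is exp(-1/x) for x > 0 and 0 elsewhere, a smooth step increasing to 1 at
  infinity.\<close>

definition eta :: "real \<Rightarrow> real" where "eta = bump [:1:]"
definition eta' :: "real \<Rightarrow> real" where "eta' = bump [:0, 0, 1:]"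

lemma eta_has_derivative: "(eta has_real_derivative eta' x) (at x)"
  using bump_has_derivative[of "[:1:]" x] by (simp add: eta_def eta'_def)

lemma eta_bounds: "0 \<le> eta x" "eta x \<le> 1"
  by (auto simp: eta_def bump_def)

lemma eta'_nonneg: "0 \<le> eta' x"
  by (auto simp: eta'_def bump_def)

text \<open>At x = n t - 1 this bounds n t \<open>eta'\<close> (n t - 1), and thereby the derivative
  of the cutoff by 3/t independently of n. The 3 comes from exp q \<ge> 1 + q + q^2/2 at q =
  1/x.\<close>

lemma eta'_decay: "(x + 1) * eta' x \<le> 3" if "x > -1"
proof (cases "x > 0")
  case True
  define q where "q = 1 / x"
  have q: "q > 0" using True by (simp add: q_def)
  have "(x + 1) * eta' x = (q + q\<^sup>2) * exp (- q)"
    using True by (simp add: eta'_def bump_def q_def field_simps power2_eq_square)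
  also have "\<dots> = (q + q\<^sup>2) / exp q" by (simp add: exp_minus field_simps)
  also have "\<dots> \<le> 3"
  proof -
    have "1 + q + q\<^sup>2 / 2 \<le> exp q" using q by (intro exp_lower_Taylor_quadratic) simp
    then have "q + q\<^sup>2 \<le> 3 * exp q" using q zero_le_power2[of q] by linarith
    then show ?thesis by (simp add: divide_le_eq)
  qed
  finally show ?thesis .
qed (auto simp: eta'_def bump_def)

lemma eta_tendsto: "(eta \<longlongrightarrow> 1) at_top"
proof -
  have "((\<lambda>x::real. exp (- inverse x)) \<longlongrightarrow> exp (- 0)) at_top"
    by (intro tendsto_intros tendsto_inverse_0_at_top filterlim_ident)
  moreover have "\<forall>\<^sub>F x in at_top. exp (- inverse x) = eta x"
    using eventually_gt_at_top[of 0] by eventually_elim (simp add: eta_def bump_def inverse_eq_divide)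
  ultimately show ?thesis using Lim_transform_eventually by fastforce
qed

lemma eta'_tendsto: "((\<lambda>x. (x + 1) * eta' x) \<longlongrightarrow> 0) at_top"
proof -
  have "((\<lambda>x::real. (inverse x + (inverse x)\<^sup>2) * exp (- inverse x)) \<longlongrightarrow> (0 + 0\<^sup>2) * exp (- 0)) at_top"
    by (intro tendsto_intros tendsto_inverse_0_at_top filterlim_ident)
  moreover have "\<forall>\<^sub>F x in at_top. (inverse x + (inverse x)\<^sup>2) * exp (- inverse x) = (x + 1) * eta' x"
    using eventually_gt_at_top[of 0]
    by eventually_elim (simp add: eta'_def bump_def field_simps power2_eq_square)
  ultimately show ?thesis using Lim_transform_eventually by fastforce
qed

text \<open>A smooth cutoff supported in [1/n, 1 - 1/n]; the second factor is \<open>eta\<close> at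
  n(1 - t) - 1, expanded to the affine form that \<open>smooth_affine\<close> accepts. It equals 1
  nowhere and only tends to 1 as n grows, which is enough for dominated convergence.\<close>

definition chi :: "nat \<Rightarrow> real \<Rightarrow> complex" where
  "chi n t = of_real (eta (real n * t - 1)) * of_real (eta (- real n * t + (real n - 1)))"

definition chi' :: "nat \<Rightarrow> real \<Rightarrow> real" where
  "chi' n t = real n * (eta' (real n * t - 1) * eta (- real n * t + (real n - 1))
     - eta (real n * t - 1) * eta' (- real n * t + (real n - 1)))"

lemma smooth_chi: "smooth (chi n)"
proof -
  have eta: "smooth (\<lambda>x. of_real (eta x))" unfolding eta_def by (rule smooth_bump)
  have "smooth (\<lambda>t. of_real (eta (a * t + c)))" for a c
    by (rule smooth_affine[OF bounded_linear_mult_right eta])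
  from smooth_mult[OF this[of "real n" "-1"] this[of "- real n" "real n - 1"]]
  show ?thesis unfolding chi_def[abs_def] by simp
qed

lemma chi_partial: "partial 1 (chi n) t = of_real (chi' n t)"
proof (rule partial_1_eqI)
  have "((\<lambda>t. eta (real n * t - 1) * eta (- real n * t + (real n - 1))) has_real_derivative chi' n t) (at t)"
    unfolding chi'_def
    by (rule derivative_eq_intros DERIV_chain2[OF eta_has_derivative] refl)+ (simp add: algebra_simps)
  from has_vector_derivative_of_real[OF this]
  show "(chi n has_vector_derivative of_real (chi' n t)) (at t)"
    unfolding chi_def[abs_def] by simp
qed

lemma chi_le_1: "cmod (chi n t) \<le> 1"
  unfolding chi_def norm_mult using eta_bounds by (simp add: mult_le_one)

lemma chi_eq_0: "chi n t \<noteq> 0 \<Longrightarrow> t \<in> {1 / real n..1 - 1 / real n} \<and> n > 0"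
proof -
  assume "chi n t \<noteq> 0"
  then have 1: "real n * t > 1" and 2: "- real n * t + (real n - 1) > 0"
    unfolding chi_def eta_def bump_def by (auto split: if_splits)
  then have n: "n > 0" by (cases n) auto
  with 1 2 show ?thesis by (simp add: field_simps)
qed

lemma filterlim_affine_at_top: "a > 0 \<Longrightarrow> filterlim (\<lambda>n::nat. real n * a - 1) at_top sequentially"
  using filterlim_tendsto_add_at_top[OF tendsto_const[of "-1"]
      filterlim_at_top_mult_tendsto_pos[OF tendsto_const[of a] _ filterlim_real_sequentially]]
  by simp

lemma chi_tendsto: "t \<in> J \<Longrightarrow> (\<lambda>n. chi n t) \<longlonglongrightarrow> 1"
proof -
  assume t: "t \<in> J"
  have "(\<lambda>n. chi n t) \<longlonglongrightarrow> of_real 1 * of_real 1"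
    unfolding chi_def
  proof (intro tendsto_mult tendsto_of_real)
    show "(\<lambda>n. eta (real n * t - 1)) \<longlonglongrightarrow> 1"
      using t by (intro filterlim_compose[OF eta_tendsto] filterlim_affine_at_top) auto
    have "(\<lambda>n. eta (real n * (1 - t) - 1)) \<longlonglongrightarrow> 1"
      using t by (intro filterlim_compose[OF eta_tendsto] filterlim_affine_at_top) auto
    then show "(\<lambda>n. eta (- real n * t + (real n - 1))) \<longlonglongrightarrow> 1" by (simp add: algebra_simps)
  qed
  then show ?thesis by simp
qed

lemma chi'_alt:
  "chi' n t = real n * (eta' (real n * t - 1) * eta (real n * (1 - t) - 1) - eta (real n * t - 1) * eta' (real n * (1 - t) - 1))"
  by (simp add: chi'_def algebra_simps)

lemma n_eta'_bound: "t > 0 \<Longrightarrow> real n * eta' (real n * t - 1) \<le> 3 / t"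
proof (cases "n = 0")
  case False
  assume t: "t > 0"
  have "real n * t * eta' (real n * t - 1) \<le> 3"
    using eta'_decay[of "real n * t - 1"] t False by simp
  then show ?thesis using t by (simp add: field_simps)
qed simp

lemma chi'_bound:
  assumes t: "t \<in> J" shows "\<bar>chi' n t\<bar> \<le> 3 / t + 3 / (1 - t)"
proof -
  have "\<bar>chi' n t\<bar> \<le> (real n * eta' (real n * t - 1)) * eta (real n * (1 - t) - 1)
      + (real n * eta' (real n * (1 - t) - 1)) * eta (real n * t - 1)"
    unfolding chi'_alt using eta_bounds eta'_nonneg
    by (simp add: abs_le_iff algebra_simps)
  also have "\<dots> \<le> 3 / t * 1 + 3 / (1 - t) * 1"
    using t by (intro add_mono mult_mono n_eta'_bound eta_bounds) auto
  finally show ?thesis by simp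
qed

lemma chi'_tendsto: "t \<in> J \<Longrightarrow> (\<lambda>n. chi' n t) \<longlonglongrightarrow> 0"
proof -
  assume t: "t \<in> J"
  have lim: "(\<lambda>n. real n * eta' (real n * s - 1)) \<longlonglongrightarrow> 0" if "s > 0" for s
  proof -
    have "(\<lambda>n. ((real n * s - 1) + 1) * eta' (real n * s - 1) / s) \<longlonglongrightarrow> 0 / s"
      using that by (intro tendsto_divide filterlim_compose[OF eta'_tendsto] filterlim_affine_at_top tendsto_const) auto
    then show ?thesis using that by simp
  qed
  have elim: "(\<lambda>n. eta (real n * s - 1)) \<longlonglongrightarrow> 1" if "s > 0" for s
    using that by (intro filterlim_compose[OF eta_tendsto] filterlim_affine_at_top)
  have "(\<lambda>n. real n * eta' (real n * t - 1) * eta (real n * (1 - t) - 1)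
     - real n * eta' (real n * (1 - t) - 1) * eta (real n * t - 1)) \<longlonglongrightarrow> 0 * 1 - 0 * 1"
    using t by (intro tendsto_diff tendsto_mult lim elim) auto
  then show ?thesis by (simp add: chi'_alt algebra_simps)
qed

definition chi2 :: "nat \<Rightarrow> real \<times> real \<Rightarrow> complex" where
  "chi2 n z = chi n (fst z) * chi n (snd z)"

lemma chi2_sc_tc: "chi2 n = (\<lambda>z. chi n (sc h z) * chi n (tc h z))"
  by (auto simp: chi2_def sc_def tc_def mult.commute)

lemma chi2_test_function: "smooth \<psi> \<Longrightarrow> (\<lambda>z. chi2 n z * \<psi> z) \<in> test_functions Q"
proof -
  assume \<psi>: "smooth \<psi>"
  \<comment> \<open>Index 0 gets the empty set: by 1/0 = 0 the interval formula would give the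
    closed square, while \<open>chi 0\<close> vanishes identically.\<close>
  let ?K = "if n = 0 then {} else {1 / real n..1 - 1 / real n} \<times> {1 / real n..1 - 1 / real n}"
  have "smooth (\<lambda>z. chi2 n z * \<psi> z)"
    unfolding chi2_sc_tc[of n True] by (intro smooth_mult smooth_sc smooth_tc smooth_chi \<psi>)
  moreover have "compact ?K" by (auto intro: compact_Times)
  moreover have "?K \<subseteq> Q"
  proof (cases "n = 0")
    case False
    have "{r..1 - r} \<subseteq> J" if "r > 0" for r :: real using that by auto
    from this[of "1 / real n"] show ?thesis using False unfolding unit_square_def by (simp add: Sigma_mono)
  qed simp
  moreover have "chi2 n z * \<psi> z = 0" if "z \<notin> ?K" for z
    using that chi_eq_0[of n "fst z"] chi_eq_0[of n "snd z"]
    by (auto simp: chi2_def mem_Times_iff split: if_splits)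
  ultimately show ?thesis unfolding test_functions_def by blast
qed

lemma chi2_le_1: "cmod (chi2 n z) \<le> 1"
  unfolding chi2_def norm_mult using chi_le_1 by (simp add: mult_le_one)

lemma chi2_tendsto: "z \<in> Q \<Longrightarrow> (\<lambda>n. chi2 n z) \<longlonglongrightarrow> 1"
  unfolding chi2_def using tendsto_mult[OF chi_tendsto chi_tendsto, of "fst z" "snd z"]
  by (auto simp: unit_square_def mem_Times_iff)

lemma L2_imp_integrable_Q: "u \<in> L2 Q \<Longrightarrow> integrable MQ u"
  using L2_mult_integrable[of u Q "\<lambda>_. 1"] continuous_imp_L2_square(1)[of "\<lambda>_. 1"]
  by (simp add: continuous_on_const)

lemma L2_integral_tendsto_bounded:
  assumes u: "u \<in> L2 Q" and m: "\<And>n::nat. continuous_on UNIV (w n)" and m': "continuous_on UNIV w'"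
    and b: "\<And>n z. z \<in> Q \<Longrightarrow> cmod (w n z) \<le> C"
    and lim: "\<And>z. z \<in> Q \<Longrightarrow> (\<lambda>n. w n z) \<longlonglongrightarrow> w' z"
  shows "(\<lambda>n. LINT z|MQ. u z * w n z) \<longlonglongrightarrow> (LINT z|MQ. u z * w' z)"
proof (rule integral_dominated_convergence)
  note [measurable] = L2_measurable[OF u]
  have [measurable]: "w n \<in> borel_measurable MQ" for n
    by (intro L2_measurable continuous_imp_L2_square continuous_on_subset[OF m]) auto
  have [measurable]: "w' \<in> borel_measurable MQ"
    by (intro L2_measurable continuous_imp_L2_square continuous_on_subset[OF m']) auto
  show "(\<lambda>z. u z * w' z) \<in> borel_measurable MQ"
    "(\<lambda>z. u z * w n z) \<in> borel_measurable MQ" for n by measurable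
  show "integrable MQ (\<lambda>z. C * cmod (u z))"
    using L2_imp_integrable_Q[OF u] by simp
  show "AE z in MQ. (\<lambda>n. u z * w n z) \<longlonglongrightarrow> u z * w' z"
    by (rule AE_I2) (auto simp: space_restrict_space intro!: tendsto_mult lim)
  show "AE z in MQ. cmod (u z * w n z) \<le> C * cmod (u z)" for n
    using b by (intro AE_I2) (auto simp: space_restrict_space norm_mult mult.commute[of C] intro!: mult_left_mono)
qed

lemma poly_of_real_has_vector_derivative:
  fixes p :: "complex poly"
  shows "((\<lambda>x. poly p (of_real x)) has_vector_derivative poly (pderiv p) (of_real x)) (at x)"
  by (rule has_vector_derivative_real_field[OF poly_DERIV])

lemma smooth_poly:
  fixes p :: "complex poly"
  shows "smooth (\<lambda>x::real. poly p (of_real x))"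
proof (rule smooth_realI[where S = "range (\<lambda>p x. poly p (of_real x))"])
  fix f :: "real \<Rightarrow> complex" assume "f \<in> range (\<lambda>p x. poly p (of_real x))"
  then obtain p where f: "f = (\<lambda>x. poly p (of_real x))" by auto
  show "\<exists>f'\<in>range (\<lambda>p x. poly p (of_real x)). \<forall>x. (f has_vector_derivative f' x) (at x)"
    unfolding f
    by (intro bexI[of _ "\<lambda>x. poly (pderiv p) (of_real x)"] allI rangeI poly_of_real_has_vector_derivative)
qed auto

lemma smooth_dense_L2:
  assumes "u \<in> L2 Q" "\<epsilon> > 0"
  obtains q where "smooth q" "q \<in> L2 Q" "L2_norm Q (\<lambda>z. u z - q z) < \<epsilon>"
proof -
  have of_real: "smooth (\<lambda>x. of_real x)"
    using smooth_poly[of "[:0, 1:]"] by simp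
  obtain q where "q \<in> Collect smooth" "q \<in> L2 Q" "L2_norm Q (\<lambda>z. u z - q z) < \<epsilon>"
  proof (rule L2_square_dense[of "Collect smooth" "\<lambda>x. x" "\<lambda>x. x" "\<lambda>_. 1" u \<epsilon>])
    show "(\<lambda>z. of_real (fst z) * f z) \<in> Collect smooth" "(\<lambda>z. of_real (snd z) * f z) \<in> Collect smooth"
      if "f \<in> Collect smooth" for f
      using that smooth_sc[OF of_real, of True] smooth_tc[OF of_real, of True]
      by (simp_all add: sc_def tc_def smooth_mult)
  qed (simp_all add: assms smooth_add smooth_mult smooth_const)
  then show thesis by (intro that) simp_all
qed

text \<open>The difference of two weak derivatives annihilates every test function. Cutoffs extend
  this to all smooth functions; these are dense, so it annihilates its own conjugate and vanishes.
  This makes the choice in \<open>weak_partial\<close> harmless.\<close>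

lemma weak_partial_unique:
  assumes g1: "g1 \<in> L2 Q" "has_weak_partial Q b u g1" and g2: "g2 \<in> L2 Q" "has_weak_partial Q b u g2"
  shows "AE z in MQ. g1 z = g2 z"
proof -
  define d where "d = (\<lambda>z. g1 z - g2 z)"
  have d: "d \<in> L2 Q" unfolding d_def by (intro L2_diff g1 g2)
  have zero: "(LINT z|MQ. d z * \<psi> z) = 0" if \<psi>: "smooth \<psi>" for \<psi>
  proof -
    have "continuous_on closed_square \<psi>" by (rule smooth_continuous[OF \<psi>])
    then obtain C where C: "\<And>z. z \<in> closed_square \<Longrightarrow> cmod (\<psi> z) \<le> C"
      using compact_imp_bounded[OF compact_continuous_image[OF _ compact_closed_square]] by (force simp: bounded_iff)
    have c2: "smooth (\<lambda>z. chi2 n z * \<psi> z)" for n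
      using chi2_test_function[OF \<psi>, of n] by (simp add: test_functions_def)
    have "(LINT z|MQ. d z * (chi2 n z * \<psi> z)) = 0" for n
    proof -
      have t: "(\<lambda>z. chi2 n z * \<psi> z) \<in> test_functions Q" by (rule chi2_test_function[OF \<psi>])
      have L: "(\<lambda>z. chi2 n z * \<psi> z) \<in> L2 Q" by (intro continuous_imp_L2_square smooth_continuous c2)
      have "(LINT z|MQ. d z * (chi2 n z * \<psi> z))
        = (LINT z|MQ. g1 z * (chi2 n z * \<psi> z)) - (LINT z|MQ. g2 z * (chi2 n z * \<psi> z))"
        unfolding d_def left_diff_distrib
        by (intro Bochner_Integration.integral_diff L2_mult_integrable g1 g2 L)
      then show ?thesis using g1(2) g2(2) t unfolding has_weak_partial_def by fastforce
    qed
    moreover have "(\<lambda>n. LINT z|MQ. d z * (chi2 n z * \<psi> z)) \<longlonglongrightarrow> (LINT z|MQ. d z * \<psi> z)"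
    proof (rule L2_integral_tendsto_bounded[OF d, where C = "1 * C"])
      show "cmod (chi2 n z * \<psi> z) \<le> 1 * C" if "z \<in> Q" for n z
        unfolding norm_mult using that Q_subset C chi2_le_1 by (intro mult_mono) auto
      show "(\<lambda>n. chi2 n z * \<psi> z) \<longlonglongrightarrow> \<psi> z" if "z \<in> Q" for z
        using tendsto_mult_right[OF chi2_tendsto[OF that], of "\<psi> z"] by simp
    qed (auto intro: smooth_continuous c2 \<psi>)
    ultimately show ?thesis by (simp add: LIMSEQ_const_iff)
  qed
  have "L2_norm Q d = 0"
  proof (rule ccontr)
    assume "L2_norm Q d \<noteq> 0"
    then have pos: "L2_norm Q d > 0" using L2_norm_nonneg[of Q d] by linarith
    \<comment> \<open>The tolerance is the norm of \<open>d\<close> itself: Cauchy-Schwarz will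
      bound that norm by the distance from \<open>cnj d\<close> to \<open>q\<close>, a
      contradiction.\<close>
    obtain q where q: "smooth q" "q \<in> L2 Q" "L2_norm Q (\<lambda>z. cnj (d z) - q z) < L2_norm Q d"
      using smooth_dense_L2[OF L2_cnj[OF d] pos] .
    have "of_real ((L2_norm Q d)\<^sup>2) = (LINT z|MQ. d z * cnj (d z))" by (rule L2_norm_sq_cnj)
    also have "\<dots> = (LINT z|MQ. d z * (cnj (d z) - q z)) + (LINT z|MQ. d z * q z)"
      by (subst Bochner_Integration.integral_add[symmetric])
        (auto intro!: L2_mult_integrable d L2_diff L2_cnj q simp: right_diff_distrib)
    also have "\<dots> = (LINT z|MQ. d z * (cnj (d z) - q z))" using zero[OF q(1)] by simp
    finally have "cmod (of_real ((L2_norm Q d)\<^sup>2)) \<le> L2_norm Q d * L2_norm Q (\<lambda>z. cnj (d z) - q z)"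
      using L2_Cauchy_Schwarz[OF d L2_diff[OF L2_cnj[OF d] q(2)]] by (simp only:)
    then have "L2_norm Q d * L2_norm Q d \<le> L2_norm Q d * L2_norm Q (\<lambda>z. cnj (d z) - q z)"
      by (simp only: norm_of_real abs_power2) (simp only: power2_eq_square)
    then have "L2_norm Q d \<le> L2_norm Q (\<lambda>z. cnj (d z) - q z)"
      using pos by (rule mult_left_le_imp_le)
    with q show False by simp
  qed
  from L2_norm_eq_0_AE[OF d this] show ?thesis by (simp add: d_def)
qed

section \<open>Integration by parts\<close>

lemma weak_partial_props:
  assumes "u \<in> H1 \<Omega>" "b \<in> Basis"
  shows weak_partial_L2: "weak_partial \<Omega> b u \<in> L2 \<Omega>"
    and weak_partial_has: "has_weak_partial \<Omega> b u (weak_partial \<Omega> b u)"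
proof -
  from assms have "\<exists>g. g \<in> L2 \<Omega> \<and> has_weak_partial \<Omega> b u g" by (auto simp: H1_def)
  from someI_ex[OF this] show "weak_partial \<Omega> b u \<in> L2 \<Omega>" "has_weak_partial \<Omega> b u (weak_partial \<Omega> b u)"
    by (auto simp: weak_partial_def)
qed

lemma H1_L2: "u \<in> H1 \<Omega> \<Longrightarrow> u \<in> L2 \<Omega>"
  by (simp add: H1_def)

lemma H1I:
  assumes "u \<in> L2 Q" "\<And>h. g h \<in> L2 Q" "\<And>h. has_weak_partial Q (dir h) u (g h)"
  shows "u \<in> H1 Q"
  unfolding H1_def Basis_dir using assms by auto

lemma weak_partial_AE:
  assumes "g \<in> L2 Q" "has_weak_partial Q b u g"
  shows "weak_partial Q b u \<in> L2 Q" "AE z in MQ. weak_partial Q b u z = g z"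
proof -
  have "\<exists>g. g \<in> L2 Q \<and> has_weak_partial Q b u g" using assms by blast
  from someI_ex[OF this] have 1: "weak_partial Q b u \<in> L2 Q" "has_weak_partial Q b u (weak_partial Q b u)"
    by (auto simp: weak_partial_def)
  from 1(1) show "weak_partial Q b u \<in> L2 Q" .
  show "AE z in MQ. weak_partial Q b u z = g z"
    by (rule weak_partial_unique[OF 1 assms])
qed

lemma smooth_L2: "smooth \<phi> \<Longrightarrow> \<phi> \<in> L2 Q"
  by (intro continuous_imp_L2_square smooth_continuous)

lemma smooth_partial_dir: "smooth \<phi> \<Longrightarrow> smooth (pd h \<phi>)"
  by (rule smooth_partial) simp_all

lemma smooth_pt: "smooth \<phi> \<Longrightarrow> continuous_on A (\<lambda>t. \<phi> (pt h s t))"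
  by (rule continuous_on_compose2[OF smooth_continuous[of \<phi> UNIV]]) (auto intro!: continuous_pt continuous_intros)

lemma smooth_divergence:
  assumes \<phi>: "smooth \<phi>"
  shows "(LINT z|MQ. pd h \<phi> z)
    = (LINT t|MJ. \<phi> (pt h 1 t)) - (LINT t|MJ. \<phi> (pt h 0 t))"
proof -
  have c: "continuous_on UNIV (pd h \<phi>)" by (intro smooth_continuous smooth_partial_dir \<phi>)
  have "(LINT z|MQ. pd h \<phi> z) =
     (LINT t|MJ. LINT s|MJ. pd h \<phi> (pt h s t))"
    by (rule Fubini_square_continuous[OF c])
  also have "\<dots> = (LINT t|MJ. \<phi> (pt h 1 t) - \<phi> (pt h 0 t))"
  proof (intro Bochner_Integration.integral_cong refl integral_J_FTC has_vector_derivative_pt \<phi>)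
    show "continuous_on {0..1} (\<lambda>s. pd h \<phi> (pt h s t))" for t
      by (rule continuous_on_compose2[OF c]) (auto intro!: continuous_pt continuous_intros)
  qed
  also have "\<dots> = (LINT t|MJ. \<phi> (pt h 1 t)) - (LINT t|MJ. \<phi> (pt h 0 t))"
    by (intro Bochner_Integration.integral_diff continuous_imp_L2_ivl smooth_pt \<phi>)
  finally show ?thesis .
qed

lemma smooth_Green:
  assumes \<phi>: "smooth \<phi>" and \<psi>: "smooth \<psi>"
  shows "(LINT z|MQ. pd h \<phi> z * \<psi> z) + (LINT z|MQ. \<phi> z * pd h \<psi> z)
    = (LINT t|MJ. \<phi> (pt h 1 t) * \<psi> (pt h 1 t)) - (LINT t|MJ. \<phi> (pt h 0 t) * \<psi> (pt h 0 t))"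
proof -
  have "(LINT z|MQ. pd h \<phi> z * \<psi> z) + (LINT z|MQ. \<phi> z * pd h \<psi> z)
    = (LINT z|MQ. pd h \<phi> z * \<psi> z + \<phi> z * pd h \<psi> z)"
    by (intro Bochner_Integration.integral_add[symmetric] L2_mult_integrable smooth_L2 smooth_partial_dir \<phi> \<psi>)
  also have "\<dots> = (LINT z|MQ. pd h (\<lambda>z. \<phi> z * \<psi> z) z)"
    by (simp add: partial_mult smooth_differentiable \<phi> \<psi> add.commute)
  also have "\<dots> = (LINT t|MJ. \<phi> (pt h 1 t) * \<psi> (pt h 1 t)) - (LINT t|MJ. \<phi> (pt h 0 t) * \<psi> (pt h 0 t))"
    by (intro smooth_divergence smooth_mult \<phi> \<psi>)
  finally show ?thesis .
qed

lemma smooth_has_weak_partial: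
  assumes \<phi>: "smooth \<phi>"
  shows "has_weak_partial Q (dir h) \<phi> (pd h \<phi>)"
  unfolding has_weak_partial_def
proof
  fix \<psi> assume "\<psi> \<in> test_functions Q"
  then obtain K where \<psi>: "smooth \<psi>" and K: "K \<subseteq> Q" "\<And>z. z \<notin> K \<Longrightarrow> \<psi> z = 0"
    by (auto simp: test_functions_def)
  have "\<psi> (pt h 1 t) = 0" "\<psi> (pt h 0 t) = 0" for t
    by (rule K(2), use K(1) pt_mem_Q[of h 1 t] pt_mem_Q[of h 0 t] in \<open>auto simp del: pt_mem_Q\<close>)+
  then have "(LINT z|MQ. pd h \<phi> z * \<psi> z) + (LINT z|MQ. \<phi> z * pd h \<psi> z) = 0"
    using smooth_Green[OF \<phi> \<psi>, of h] by simp
  then show "(LINT z|MQ. \<phi> z * pd h \<psi> z) = - (LINT z|MQ. pd h \<phi> z * \<psi> z)"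
    by (simp add: add_eq_0_iff2 add.commute)
qed

lemma smooth_H1: "smooth \<phi> \<Longrightarrow> \<phi> \<in> H1 Q"
  by (rule H1I[where g = "\<lambda>h. pd h \<phi>"]) (auto intro: smooth_L2 smooth_partial_dir smooth_has_weak_partial)

lemma has_weak_partial_diff:
  assumes u: "u \<in> L2 Q" "g \<in> L2 Q" "has_weak_partial Q (dir h) u g"
    and v: "v \<in> L2 Q" "g' \<in> L2 Q" "has_weak_partial Q (dir h) v g'"
  shows "has_weak_partial Q (dir h) (\<lambda>z. u z - v z) (\<lambda>z. g z - g' z)"
  unfolding has_weak_partial_def
proof
  fix \<psi> assume t: "\<psi> \<in> test_functions Q"
  then have \<psi>: "smooth \<psi>" by (simp add: test_functions_def)
  have "(LINT z|MQ. (u z - v z) * pd h \<psi> z)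
    = (LINT z|MQ. u z * pd h \<psi> z) - (LINT z|MQ. v z * pd h \<psi> z)"
    unfolding left_diff_distrib
    by (intro Bochner_Integration.integral_diff L2_mult_integrable u v smooth_L2 smooth_partial_dir \<psi>)
  also have "\<dots> = - ((LINT z|MQ. g z * \<psi> z) - (LINT z|MQ. g' z * \<psi> z))"
    using u(3) v(3) t by (simp add: has_weak_partial_def)
  also have "(LINT z|MQ. g z * \<psi> z) - (LINT z|MQ. g' z * \<psi> z)
    = (LINT z|MQ. (g z - g' z) * \<psi> z)"
    unfolding left_diff_distrib
    by (intro Bochner_Integration.integral_diff[symmetric] L2_mult_integrable u v smooth_L2 \<psi>)
  finally show "(LINT z|MQ. (u z - v z) * pd h \<psi> z) = - (LINT z|MQ. (g z - g' z) * \<psi> z)" .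
qed

text \<open>The mean value inequality along a segment in direction \<open>h\<close>. For \<psi>
  vanishing at both ends it bounds \<psi> by \<open>B\<close> times the distance to either
  side.\<close>

lemma smooth_normal_bound:
  assumes \<psi>: "smooth \<psi>" and B: "\<And>z. z \<in> closed_square \<Longrightarrow> cmod (pd h \<psi> z) \<le> B"
    and "s \<in> {0..1}" "r \<in> {0..1}" "t \<in> {0..1}"
  shows "cmod (\<psi> (pt h s t) - \<psi> (pt h r t)) \<le> B * \<bar>s - r\<bar>"
proof -
  have "norm (\<psi> (pt h s t) - \<psi> (pt h r t)) \<le> B * norm (s - r)"
  proof (rule differentiable_bound[where S = "{0..1}" and f' = "\<lambda>s d. d *\<^sub>R pd h \<psi> (pt h s t)"])
    show "((\<lambda>s. \<psi> (pt h s t)) has_derivative (\<lambda>d. d *\<^sub>R pd h \<psi> (pt h x t))) (at x within {0..1})" for x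
      using has_vector_derivative_pt[OF \<psi>, of h t x] unfolding has_vector_derivative_def
      by (rule has_derivative_at_withinI)
    show "onorm (\<lambda>d. d *\<^sub>R pd h \<psi> (pt h x t)) \<le> B" if "x \<in> {0..1}" for x
    proof (rule onorm_le)
      show "norm (d *\<^sub>R pd h \<psi> (pt h x t)) \<le> B * norm d" for d
        using mult_left_mono[OF B[of "pt h x t"], of "\<bar>d\<bar>"] that assms(5) by (simp add: mult.commute)
    qed
  qed (use assms in auto)
  then show ?thesis by simp
qed

text \<open>The boundary values of \<open>\<psi>\<close> vanish only in the direction of differentiation; the derivative
  of the cutoff blows up no faster than the reciprocal of the distance to the boundary and is
  compensated by \<open>\<psi>\<close>.\<close>

lemma weak_partial_ibp:
  assumes u: "u \<in> L2 Q" and g: "g \<in> L2 Q" and ug: "has_weak_partial Q (dir h) u g"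
    and \<psi>: "smooth \<psi>" and 0: "\<And>t. \<psi> (pt h 0 t) = 0" "\<And>t. \<psi> (pt h 1 t) = 0"
  shows "(LINT z|MQ. u z * pd h \<psi> z) = - (LINT z|MQ. g z * \<psi> z)"
proof -
  have "continuous_on closed_square (pd h \<psi>)" by (intro smooth_continuous smooth_partial_dir \<psi>)
  from compact_imp_bounded[OF compact_continuous_image[OF this compact_closed_square]]
  obtain B where B: "\<And>z. z \<in> closed_square \<Longrightarrow> cmod (pd h \<psi> z) \<le> B"
    by (auto simp: bounded_iff)
  have B0: "B \<ge> 0" using order_trans[OF norm_ge_zero B[of "(0, 0)"]] by simp
  have b0: "cmod (\<psi> z) \<le> B * sc h z" "cmod (\<psi> z) \<le> B * (1 - sc h z)" if "z \<in> Q" for z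
    using that smooth_normal_bound[OF \<psi> B, of "sc h z" 0 "tc h z"]
      smooth_normal_bound[OF \<psi> B, of "sc h z" 1 "tc h z"] mem_Q_sc_tc[of z h]
    by (auto simp: 0)
  have bB: "cmod (\<psi> z) \<le> B" if "z \<in> Q" for z
    using b0(1)[OF that] that mem_Q_sc_tc[of z h] B0 mult_left_le[of "sc h z" B] by auto
  have test: "(\<lambda>z. chi2 n z * \<psi> z) \<in> test_functions Q" for n by (rule chi2_test_function[OF \<psi>])
  have c2: "smooth (chi2 n)" for n
    unfolding chi2_sc_tc[of n True] by (intro smooth_mult smooth_sc smooth_tc smooth_chi)
  have pc: "pd h (chi2 n) = (\<lambda>z. of_real (chi' n (sc h z)) * chi n (tc h z))" for n
    unfolding chi2_sc_tc[of n h] by (simp add: partial_tensor smooth_chi chi_partial)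
  have part: "pd h (\<lambda>z. chi2 n z * \<psi> z)
    = (\<lambda>z. chi2 n z * pd h \<psi> z + of_real (chi' n (sc h z)) * chi n (tc h z) * \<psi> z)" for n
    by (simp add: partial_mult smooth_differentiable c2 \<psi> pc)
  let ?w = "\<lambda>n z. pd h (\<lambda>z. chi2 n z * \<psi> z) z"
  have wc: "continuous_on UNIV (?w n)" for n
    by (intro smooth_continuous smooth_partial_dir smooth_mult c2 \<psi>)
  \<comment> \<open>The bound 7 B consists of B from the term with \<open>pd h \<psi>\<close> and of
    3 B from each of the singular parts 3/s and 3/(1 - s) of the derivative of the cutoff, set
    against B s and B (1 - s) for \<psi>.\<close>
  have "(\<lambda>n. LINT z|MQ. u z * ?w n z) \<longlonglongrightarrow> (LINT z|MQ. u z * pd h \<psi> z)"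
  proof (rule L2_integral_tendsto_bounded[OF u wc, where C = "7 * B"])
    show "continuous_on UNIV (pd h \<psi>)" by (intro smooth_continuous smooth_partial_dir \<psi>)
    fix z assume z: "z \<in> Q"
    from this have s: "sc h z \<in> J" and t: "tc h z \<in> J" unfolding mem_Q_sc_tc[of z h] by auto
    show "cmod (?w n z) \<le> 7 * B" for n
    proof -
      have "cmod (?w n z) \<le> cmod (chi2 n z) * cmod (pd h \<psi> z) + \<bar>chi' n (sc h z)\<bar> * cmod (chi n (tc h z)) * cmod (\<psi> z)"
        unfolding part by (rule order_trans[OF norm_triangle_ineq]) (simp add: norm_mult)
      also have "\<dots> \<le> 1 * B + (3 / sc h z + 3 / (1 - sc h z)) * 1 * cmod (\<psi> z)"
        using z Q_subset s by (intro add_mono mult_mono chi2_le_1 B chi'_bound chi_le_1) auto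
      also have "(3 / sc h z + 3 / (1 - sc h z)) * 1 * cmod (\<psi> z)
          = 3 / sc h z * cmod (\<psi> z) + 3 / (1 - sc h z) * cmod (\<psi> z)" by (simp add: algebra_simps)
      also have "\<dots> \<le> 3 / sc h z * (B * sc h z) + 3 / (1 - sc h z) * (B * (1 - sc h z))"
        using s b0[OF z] by (intro add_mono mult_left_mono) auto
      also have "\<dots> = 6 * B" using s by simp
      finally show ?thesis by simp
    qed
    have "(\<lambda>n. chi2 n z * pd h \<psi> z + of_real (chi' n (sc h z)) * chi n (tc h z) * \<psi> z)
      \<longlonglongrightarrow> 1 * pd h \<psi> z + of_real 0 * 1 * \<psi> z"
      by (intro tendsto_add tendsto_mult tendsto_of_real chi2_tendsto chi_tendsto chi'_tendsto tendsto_const z s t)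
    then show "(\<lambda>n. ?w n z) \<longlonglongrightarrow> pd h \<psi> z" by (simp add: part)
  qed
  moreover have "(\<lambda>n. LINT z|MQ. g z * (chi2 n z * \<psi> z)) \<longlonglongrightarrow> (LINT z|MQ. g z * \<psi> z)"
  proof (rule L2_integral_tendsto_bounded[OF g, where C = "1 * B"])
    show "cmod (chi2 n z * \<psi> z) \<le> 1 * B" if "z \<in> Q" for n z
      unfolding norm_mult using that bB chi2_le_1 by (intro mult_mono) auto
    show "(\<lambda>n. chi2 n z * \<psi> z) \<longlonglongrightarrow> \<psi> z" if "z \<in> Q" for z
      using tendsto_mult_right[OF chi2_tendsto[OF that], of "\<psi> z"] by simp
  qed (auto intro: smooth_continuous smooth_mult c2 \<psi>)
  moreover have "(LINT z|MQ. u z * ?w n z) = - (LINT z|MQ. g z * (chi2 n z * \<psi> z))" for n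
    using ug test unfolding has_weak_partial_def by blast
  ultimately show ?thesis
    using LIMSEQ_unique[OF _ tendsto_minus] by simp
qed

section \<open>Trigonometric modes\<close>

text \<open>The eigenfunctions of the second derivative on \<open>(0,1)\<close>; \<open>d\<close> and \<open>e\<close> select a Dirichlet
  (otherwise Neumann) condition at \<open>0\<close> and \<open>1\<close>. For two Dirichlet conditions the index \<open>0\<close> yields
  the zero function.\<close>

definition freq :: "bool \<Rightarrow> bool \<Rightarrow> nat \<Rightarrow> real" where
  "freq d e n = (real n + (if d = e then 0 else 1 / 2)) * pi"

definition mode :: "bool \<Rightarrow> bool \<Rightarrow> nat \<Rightarrow> real \<Rightarrow> real" where
  "mode d e n t = (if d then sin else cos) (freq d e n * t)"

definition dmode :: "bool \<Rightarrow> bool \<Rightarrow> nat \<Rightarrow> real \<Rightarrow> real" where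
  "dmode d e n t = freq d e n * (if d then cos (freq d e n * t) else - sin (freq d e n * t))"

abbreviation cmode :: "bool \<Rightarrow> bool \<Rightarrow> nat \<Rightarrow> real \<Rightarrow> complex" where
  "cmode d e n \<equiv> \<lambda>t. of_real (mode d e n t)"

lemma mode_has_derivative: "(mode d e n has_real_derivative dmode d e n t) (at t)"
  by (cases d) (auto simp: mode_def[abs_def] dmode_def intro!: derivative_eq_intros)

lemma dmode_has_derivative: "(dmode d e n has_real_derivative - (freq d e n)\<^sup>2 * mode d e n t) (at t)"
  by (cases d) (auto simp: mode_def dmode_def[abs_def] power2_eq_square intro!: derivative_eq_intros)

lemma cos_half_odd: "cos ((real n + 1 / 2) * pi) = 0"
  by (simp add: cos_zero_iff_int2) (auto intro!: exI[of _ "int n"] simp: algebra_simps)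

lemma mode_boundary:
  "d \<Longrightarrow> mode d e n 0 = 0" "\<not> d \<Longrightarrow> dmode d e n 0 = 0"
  "e \<Longrightarrow> mode d e n 1 = 0" "\<not> e \<Longrightarrow> dmode d e n 1 = 0"
  using cos_half_odd[of n] by (cases d; cases e; simp add: mode_def dmode_def freq_def)+

lemma smooth_trig: "smooth (\<lambda>t. of_real (a * cos (c * t) + b * sin (c * t)))"
proof (rule smooth_realI[where S = "range (\<lambda>(a, b) t. of_real (a * cos (c * t) + b * sin (c * t)))"])
  fix f :: "real \<Rightarrow> complex" assume "f \<in> range (\<lambda>(a, b) t. of_real (a * cos (c * t) + b * sin (c * t)))"
  then obtain a b where f: "f = (\<lambda>t. of_real (a * cos (c * t) + b * sin (c * t)))" by auto
  have "((\<lambda>t. a * cos (c * t) + b * sin (c * t)) has_real_derivative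
      (b * c) * cos (c * t) + (- a * c) * sin (c * t)) (at t)" for t
    by (auto intro!: derivative_eq_intros)
  then have "(f has_vector_derivative of_real ((b * c) * cos (c * t) + (- a * c) * sin (c * t))) (at t)" for t
    unfolding f by (rule has_vector_derivative_of_real)
  then show "\<exists>f'\<in>range (\<lambda>(a, b) t. of_real (a * cos (c * t) + b * sin (c * t))). \<forall>t. (f has_vector_derivative f' t) (at t)"
    by (intro bexI[of _ "\<lambda>t. of_real ((b * c) * cos (c * t) + (- a * c) * sin (c * t))"] allI image_eqI[of _ _ "(b * c, - a * c)"]) auto
qed (auto intro!: image_eqI[of _ _ "(a, b)"])

lemma smooth_cmode: "smooth (cmode d e n)"
  using smooth_trig[of 1 "freq d e n" 0] smooth_trig[of 0 "freq d e n" 1] by (cases d) (auto simp: mode_def)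

lemma partial_cmode: "partial 1 (cmode d e n) = (\<lambda>t. of_real (dmode d e n t))"
  by (rule ext) (intro partial_1_eqI has_vector_derivative_of_real mode_has_derivative)

lemma partial_dmode:
  "partial 1 (\<lambda>t. of_real (dmode d e n t)) = (\<lambda>t. - of_real ((freq d e n)\<^sup>2) * cmode d e n t)"
  by (rule ext, rule partial_1_eqI, rule has_vector_derivative_eq_rhs,
      rule has_vector_derivative_of_real[OF dmode_has_derivative]) simp

lemma continuous_cmode: "continuous_on A (cmode d e n)"
  by (rule smooth_continuous[OF smooth_cmode])

lemma freq_nonneg: "0 \<le> freq d e n"
  by (simp add: freq_def)

lemma freq_inj: "freq d e n = freq d e m \<longleftrightarrow> n = m"
  by (simp add: freq_def)

text \<open>\<open>F\<close> is, up to sign, the Wronskian of the two modes. Its derivative is their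
  product times the difference of the squared frequencies, and it vanishes at both ends because the
  modes share the end conditions.\<close>

lemma mode_orthogonal:
  assumes "n \<noteq> m" shows "(LINT t|MJ. cmode d e n t * cmode d e m t) = 0"
proof -
  define K where "K = (freq d e m)\<^sup>2 - (freq d e n)\<^sup>2"
  have K: "K \<noteq> 0"
    using assms freq_nonneg[of d e n] freq_nonneg[of d e m] freq_inj[of d e n m]
    by (simp add: K_def power2_eq_iff_nonneg)
  define F where "F = (\<lambda>t. dmode d e n t * mode d e m t - mode d e n t * dmode d e m t)"
  have "(F has_real_derivative K * (mode d e n t * mode d e m t)) (at t)" for t
    unfolding F_def K_def
    by (rule derivative_eq_intros mode_has_derivative dmode_has_derivative refl)+ (simp add: algebra_simps)
  then have D: "((\<lambda>t. of_real (F t)) has_vector_derivative of_real K * (cmode d e n t * cmode d e m t)) (at t)" for t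
    using has_vector_derivative_of_real[of F] by fastforce
  have "continuous_on {0..1} (\<lambda>t. of_real K * (cmode d e n t * cmode d e m t))"
    by (intro continuous_intros continuous_cmode)
  then have "(LINT t|MJ. of_real K * (cmode d e n t * cmode d e m t)) = of_real (F 1) - of_real (F 0)"
    using D by (intro integral_J_FTC)
  also have "F 1 = 0" unfolding F_def using mode_boundary(3,4) by (cases e) auto
  also have "F 0 = 0" unfolding F_def using mode_boundary(1,2) by (cases d) auto
  finally show ?thesis using K by simp
qed

text \<open>The product-to-sum formula involves the two neighbouring indices. At index 0 the lower
  neighbour has a negative frequency and is folded back by parity, to index 1 for equal and to index
  0 for mixed end conditions; hence the existential. Thus multiplication by cos(\<pi> t) preserves
  the span of the modes, as \<open>L2_square_dense\<close> requires.\<close>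

lemma mode_cos_product: "\<exists>c m. \<forall>t. cos (pi * t) * mode d e n t = 1 / 2 * mode d e (Suc n) t + c * mode d e m t"
proof (cases n)
  case 0
  show ?thesis
  proof (cases "d = e")
    case True
    then show ?thesis using 0
      by (intro exI[of _ "if d then - 1/2 else 1/2"] exI[of _ 1]) (auto simp: mode_def freq_def)
  next
    case False
    have *: "freq d e 0 * t = pi * t / 2" "freq d e 1 * t = pi * t + pi * t / 2" for t
      using False by (auto simp: freq_def algebra_simps)
    have **: "sin (pi * t / 2) = sin (pi * t - pi * t / 2)" "cos (pi * t / 2) = cos (pi * t - pi * t / 2)" for t
      by (simp_all add: field_simps)
    have "cos (pi * t) * mode d e 0 t = 1 / 2 * mode d e (Suc 0) t + (if d then - 1 / 2 else 1 / 2) * mode d e 0 t" for t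
    proof (cases d)
      case True
      have "sin (x + y) - sin (x - y) = 2 * cos x * sin y" for x y :: real
        by (simp add: sin_add sin_diff)
      from this[of "pi * t" "pi * t / 2"] show ?thesis
        using True unfolding mode_def *(1) One_nat_def[symmetric] *(2) **(1)[of t, symmetric] by simp
    next
      case nd: False
      have "cos (x + y) + cos (x - y) = 2 * cos x * cos y" for x y :: real
        by (simp add: cos_add cos_diff)
      from this[of "pi * t" "pi * t / 2"] show ?thesis
        using nd unfolding mode_def *(1) One_nat_def[symmetric] *(2) **(2)[of t, symmetric] by simp
    qed
    then show ?thesis using 0 by blast
  qed
next
  case (Suc m)
  have f: "freq d e (Suc n) * t = freq d e n * t + pi * t" "freq d e m * t = freq d e n * t - pi * t" for t
    using Suc by (auto simp: freq_def algebra_simps)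
  have "cos (pi * t) * mode d e n t = 1 / 2 * mode d e (Suc n) t + 1 / 2 * mode d e m t" for t
    unfolding mode_def f by (cases d) (simp_all add: sin_add sin_diff cos_add cos_diff field_simps)
  then show ?thesis by blast
qed

text \<open>Supplies the factor \<sigma> by which the density argument divides. For two Dirichlet
  ends the index is 1, since index 0 gives the zero function.\<close>

lemma mode_nonzero: "\<exists>n. \<forall>t\<in>J. mode d e n t \<noteq> 0"
proof (cases "d = e")
  case True
  show ?thesis
  proof (cases d)
    case d: True
    have "sin (pi * t) > 0" if "t \<in> J" for t using that by (intro sin_gt_zero) auto
    then show ?thesis using d True by (intro exI[of _ 1]) (fastforce simp: mode_def freq_def)
  qed (use True in \<open>auto simp: mode_def freq_def intro: exI[of _ 0]\<close>)
next
  case False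
  have pos: "sin (pi / 2 * t) > 0 \<and> cos (pi / 2 * t) > 0" if "t \<in> J" for t
  proof -
    have "0 < pi / 2 * t" "pi / 2 * t < pi / 2" using that by auto
    then show ?thesis by (intro conjI sin_gt_zero cos_gt_zero_pi) linarith+
  qed
  have f: "freq d e 0 = pi / 2" using False by (simp add: freq_def)
  have "mode d e 0 t \<noteq> 0" if "t \<in> J" for t
    using pos[OF that] unfolding mode_def f by (cases d) auto
  then show ?thesis by (intro exI ballI)
qed

section \<open>Finite linear combinations, and the density of products of modes\<close>

definition lin_span :: "('i \<Rightarrow> 'a \<Rightarrow> complex) \<Rightarrow> ('a \<Rightarrow> complex) set" where
  "lin_span e = {f. \<exists>A c. finite A \<and> f = (\<lambda>z. \<Sum>k\<in>A. c k * e k z)}"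

lemma lin_span_extend:
  fixes c :: "'i \<Rightarrow> complex"
  assumes "finite B" "A \<subseteq> B"
  shows "(\<lambda>z. \<Sum>k\<in>A. c k * e k z) = (\<lambda>z. \<Sum>k\<in>B. (if k \<in> A then c k else 0) * e k z)"
proof
  fix z
  have "(\<Sum>k\<in>B. (if k \<in> A then c k else 0) * e k z) = (\<Sum>k\<in>A. (if k \<in> A then c k else 0) * e k z)"
    using assms by (intro sum.mono_neutral_right) auto
  then show "(\<Sum>k\<in>A. c k * e k z) = (\<Sum>k\<in>B. (if k \<in> A then c k else 0) * e k z)" by simp
qed

lemma lin_span_base: "(\<lambda>z. c * e k z) \<in> lin_span e"
  unfolding lin_span_def by (intro CollectI exI[of _ "{k}"] exI[of _ "\<lambda>_. c"]) auto

lemma lin_span_add: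
  assumes "f \<in> lin_span e" "g \<in> lin_span e" shows "(\<lambda>z. f z + g z) \<in> lin_span e"
proof -
  from assms obtain A c B d where "finite A" "f = (\<lambda>z. \<Sum>k\<in>A. c k * e k z)"
    "finite B" "g = (\<lambda>z. \<Sum>k\<in>B. d k * e k z)" unfolding lin_span_def by auto
  then have "(\<lambda>z. f z + g z) = (\<lambda>z. \<Sum>k\<in>A \<union> B. ((if k \<in> A then c k else 0) + (if k \<in> B then d k else 0)) * e k z)"
    using lin_span_extend[of "A \<union> B" A c e] lin_span_extend[of "A \<union> B" B d e]
    by (auto simp: fun_eq_iff sum.distrib distrib_right)
  moreover have "finite (A \<union> B)" using \<open>finite A\<close> \<open>finite B\<close> by simp
  ultimately show ?thesis unfolding lin_span_def mem_Collect_eq by (intro exI conjI)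
qed

lemma lin_span_scale:
  assumes "f \<in> lin_span e" shows "(\<lambda>z. c * f z) \<in> lin_span e"
proof -
  from assms obtain A d where "finite A" "f = (\<lambda>z. \<Sum>k\<in>A. d k * e k z)" unfolding lin_span_def by auto
  then have "finite A \<and> (\<lambda>z. c * f z) = (\<lambda>z. \<Sum>k\<in>A. (c * d k) * e k z)" by (auto simp: sum_distrib_left mult.assoc)
  then show ?thesis unfolding lin_span_def mem_Collect_eq by (intro exI)
qed

lemma lin_span_mult:
  assumes w: "\<And>k. (\<lambda>z. w z * e k z) \<in> lin_span e" and "f \<in> lin_span e"
  shows "(\<lambda>z. w z * f z) \<in> lin_span e"
proof -
  from assms obtain A d where A: "finite A" and f: "f = (\<lambda>z. \<Sum>k\<in>A. d k * e k z)" unfolding lin_span_def by auto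
  have "(\<lambda>z. \<Sum>k\<in>A. d k * (w z * e k z)) \<in> lin_span e"
    using A
  proof (induction A rule: finite_induct)
    case empty
    show ?case unfolding lin_span_def by (auto intro!: exI[of _ "{}"])
  next
    case (insert k A)
    then show ?case using lin_span_add[OF lin_span_scale[OF w[of k]]] by simp
  qed
  then show ?thesis by (simp add: f sum_distrib_left mult_ac)
qed

text \<open>Each flag chooses sines (\<open>True\<close>) or cosines (\<open>False\<close>) of
  integer multiples of \<pi>. Differentiating the product of cosines in direction \<open>h\<close>
  leads to the flags \<open>h\<close> and \<open>\<not> h\<close>: a sine in that direction and a
  cosine in the other.\<close>

definition tensor_mode :: "bool \<Rightarrow> bool \<Rightarrow> nat \<times> nat \<Rightarrow> real \<times> real \<Rightarrow> complex" where
  "tensor_mode a b k z = cmode a a (fst k) (fst z) * cmode b b (snd k) (snd z)"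

lemma smooth_tensor_mode: "smooth (tensor_mode a b k)"
  unfolding tensor_mode_def[abs_def]
  using smooth_mult[OF smooth_sc[OF smooth_cmode, where h = True] smooth_tc[OF smooth_cmode, where h = True]]
  by (simp add: sc_def tc_def)

lemma tensor_mode_orthogonal:
  assumes "k \<noteq> l"
  shows "(LINT z|MQ. tensor_mode a b k z * cnj (tensor_mode a b l z)) = 0"
proof -
  define F G where "F = (\<lambda>t. cmode a a (fst k) t * cmode a a (fst l) t)"
    and "G = (\<lambda>t. cmode b b (snd k) t * cmode b b (snd l) t)"
  have FG: "continuous_on UNIV F" "continuous_on UNIV G"
    unfolding F_def G_def by (intro continuous_on_mult continuous_cmode)+
  have eq: "(\<lambda>z. tensor_mode a b k z * cnj (tensor_mode a b l z)) = (\<lambda>z. F (fst z) * G (snd z))"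
    unfolding tensor_mode_def F_def G_def complex_cnj_mult complex_cnj_complex_of_real
    by (rule ext) (simp only: mult.assoc mult.left_commute)
  have "integral\<^sup>L MJ F = 0 \<or> integral\<^sup>L MJ G = 0"
  proof (cases "fst k = fst l")
    case True
    then have "snd k \<noteq> snd l" using assms by (simp add: prod_eq_iff)
    then show ?thesis unfolding G_def by (intro disjI2 mode_orthogonal)
  next
    case False
    then show ?thesis unfolding F_def by (intro disjI1 mode_orthogonal)
  qed
  then show ?thesis unfolding eq integral_square_tensor[OF FG] by (simp only: mult_eq_0_iff)
qed

lemma cos_pi_inj: "continuous_on {0..1} (\<lambda>t. cos (pi * t))" "inj_on (\<lambda>t. cos (pi * t)) {0..1}"
proof -
  show "inj_on (\<lambda>t. cos (pi * t)) {0..1}"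
  proof (rule inj_onI)
    fix s t :: real assume *: "s \<in> {0..1}" "t \<in> {0..1}" "cos (pi * s) = cos (pi * t)"
    have "0 \<le> pi * r \<and> pi * r \<le> pi" if "r \<in> {0..1}" for r
      using that mult_left_le[of r pi] by simp
    with * have "pi * s = pi * t" using cos_inj_pi[of "pi * s" "pi * t"] by metis
    then show "s = t" by simp
  qed
qed (intro continuous_intros)

text \<open>The separating functions are cos(\<pi> x) and cos(\<pi> y), injective on the closed
  interval: multiplication by them maps modes to combinations of modes, unlike multiplication by a
  coordinate.\<close>

lemma tensor_mode_dense:
  assumes u: "u \<in> L2 Q" and \<epsilon>: "\<epsilon> > 0"
  obtains A c where "finite A" "L2_norm Q (\<lambda>z. u z - (\<Sum>k\<in>A. c k * tensor_mode a b k z)) < \<epsilon>"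
proof -
  let ?K = "lin_span (tensor_mode a b)"
  obtain n m where nm: "\<forall>t\<in>J. mode a a n t \<noteq> 0" "\<forall>t\<in>J. mode b b m t \<noteq> 0"
    using mode_nonzero by metis
  obtain q where q: "q \<in> ?K" "q \<in> L2 Q" "L2_norm Q (\<lambda>z. u z - q z) < \<epsilon>"
  proof (rule L2_square_dense[of ?K "\<lambda>t. cos (pi * t)" "\<lambda>t. cos (pi * t)" "\<lambda>z. mode a a n (fst z) * mode b b m (snd z)" u \<epsilon>])
    have x: "(\<lambda>z. of_real (cos (pi * fst z)) * tensor_mode a b k z) \<in> ?K" for k
    proof -
      obtain c i where *: "\<And>t. cos (pi * t) * mode a a (fst k) t = 1 / 2 * mode a a (Suc (fst k)) t + c * mode a a i t"
        using mode_cos_product[of a a "fst k"] by blast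
      have "of_real (cos (pi * fst z)) * tensor_mode a b k z
        = of_real (cos (pi * fst z) * mode a a (fst k) (fst z)) * cmode b b (snd k) (snd z)" for z
        unfolding tensor_mode_def by simp
      then have "of_real (cos (pi * fst z)) * tensor_mode a b k z
        = of_real (1 / 2) * tensor_mode a b (Suc (fst k), snd k) z + of_real c * tensor_mode a b (i, snd k) z" for z
        unfolding * by (simp add: tensor_mode_def algebra_simps)
      note eq = this
      show ?thesis unfolding eq by (rule lin_span_add[OF lin_span_base lin_span_base])
    qed
    have y: "(\<lambda>z. of_real (cos (pi * snd z)) * tensor_mode a b k z) \<in> ?K" for k
    proof -
      obtain c i where *: "\<And>t. cos (pi * t) * mode b b (snd k) t = 1 / 2 * mode b b (Suc (snd k)) t + c * mode b b i t"
        using mode_cos_product[of b b "snd k"] by blast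
      have "of_real (cos (pi * snd z)) * tensor_mode a b k z
        = cmode a a (fst k) (fst z) * of_real (cos (pi * snd z) * mode b b (snd k) (snd z))" for z
        unfolding tensor_mode_def by simp
      then have "of_real (cos (pi * snd z)) * tensor_mode a b k z
        = of_real (1 / 2) * tensor_mode a b (fst k, Suc (snd k)) z + of_real c * tensor_mode a b (fst k, i) z" for z
        unfolding * by (simp add: tensor_mode_def algebra_simps)
      note eq = this
      show ?thesis unfolding eq by (rule lin_span_add[OF lin_span_base lin_span_base])
    qed
    show "(\<lambda>z. of_real (cos (pi * fst z)) * f z) \<in> ?K" if "f \<in> ?K" for f by (rule lin_span_mult[OF x that])
    show "(\<lambda>z. of_real (cos (pi * snd z)) * f z) \<in> ?K" if "f \<in> ?K" for f by (rule lin_span_mult[OF y that])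
    show "(\<lambda>z. of_real (mode a a n (fst z) * mode b b m (snd z))) \<in> ?K"
      using lin_span_base[of 1 "tensor_mode a b" "(n, m)"] by (simp add: tensor_mode_def)
    have mc: "continuous_on A (mode d e i)" for A d e i
      by (rule DERIV_continuous_on[OF has_field_derivative_at_within[OF mode_has_derivative]])
    show "continuous_on UNIV (\<lambda>z::real \<times> real. mode a a n (fst z) * mode b b m (snd z))"
      by (intro continuous_intros continuous_on_compose2[OF mc[of UNIV]]) auto
    show "mode a a n (fst z) * mode b b m (snd z) \<noteq> 0" if "z \<in> Q" for z
      using that nm by (auto simp: unit_square_def mem_Times_iff)
  qed (simp_all only: u \<epsilon> cos_pi_inj lin_span_add lin_span_scale)
  from q(1) obtain A c where "finite A" "q = (\<lambda>z. \<Sum>k\<in>A. c k * tensor_mode a b k z)"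
    unfolding lin_span_def by auto
  with q(3) show thesis by (intro that) auto
qed

section \<open>Density of smooth functions in \<open>H\<^sup>1\<close> and traces\<close>

definition ix :: "bool \<Rightarrow> nat \<times> nat \<Rightarrow> nat" where "ix h k = (if h then fst k else snd k)"

lemma tensor_mode_sc_tc:
  "tensor_mode False False k = (\<lambda>z. cmode False False (ix h k) (sc h z) * cmode False False (ix (\<not> h) k) (tc h z))"
  "tensor_mode h (\<not> h) k = (\<lambda>z. cmode True True (ix h k) (sc h z) * cmode False False (ix (\<not> h) k) (tc h z))"
  by (cases h; simp add: tensor_mode_def fun_eq_iff ix_def sc_def tc_def)+

lemma partial_tensor_mode:
  "pd h (tensor_mode False False k) = (\<lambda>z. - of_real (real (ix h k) * pi) * tensor_mode h (\<not> h) k z)"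
  "pd h (tensor_mode h (\<not> h) k) = (\<lambda>z. of_real (real (ix h k) * pi) * tensor_mode False False k z)"
proof -
  have d: "dmode False False n t = - (real n * pi) * mode True True n t"
    "dmode True True n t = (real n * pi) * mode False False n t" for n t
    by (simp_all add: dmode_def mode_def freq_def)
  show "pd h (tensor_mode False False k) = (\<lambda>z. - of_real (real (ix h k) * pi) * tensor_mode h (\<not> h) k z)"
    unfolding tensor_mode_sc_tc[where h = h] partial_tensor[OF smooth_cmode smooth_cmode] partial_cmode d
    by (simp add: mult.assoc)
  show "pd h (tensor_mode h (\<not> h) k) = (\<lambda>z. of_real (real (ix h k) * pi) * tensor_mode False False k z)"
    unfolding tensor_mode_sc_tc[where h = h] partial_tensor[OF smooth_cmode smooth_cmode] partial_cmode d
    by (simp add: mult.assoc)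
qed

lemma tensor_mode_cnj: "cnj (tensor_mode a b k z) = tensor_mode a b k z"
  by (simp add: tensor_mode_def)

lemma tensor_mode_boundary: "tensor_mode h (\<not> h) k (pt h 0 t) = 0" "tensor_mode h (\<not> h) k (pt h 1 t) = 0"
  unfolding tensor_mode_sc_tc(2) by (simp_all add: mode_boundary)

text \<open>Green's formula for the cosine and the sine product has no boundary terms and equates
  the two sides. The factor cannot be cancelled: at index 0 the sine product is zero and the cosine
  product is not.\<close>

lemma tensor_mode_norms:
  "real (ix h k) * pi * (L2_norm Q (tensor_mode False False k))\<^sup>2 = real (ix h k) * pi * (L2_norm Q (tensor_mode h (\<not> h) k))\<^sup>2"
proof -
  let ?C = "tensor_mode False False k" and ?S = "tensor_mode h (\<not> h) k" and ?w = "of_real (real (ix h k) * pi) :: complex"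
  have "(LINT z|MQ. pd h ?C z * ?S z) + (LINT z|MQ. ?C z * pd h ?S z) = 0"
    by (subst smooth_Green[OF smooth_tensor_mode smooth_tensor_mode]) (simp add: tensor_mode_boundary)
  moreover have "(LINT z|MQ. pd h ?C z * ?S z) = - ?w * of_real ((L2_norm Q ?S)\<^sup>2)"
    unfolding partial_tensor_mode L2_norm_sq_cnj tensor_mode_cnj mult.assoc by (rule integral_mult_right_zero)
  moreover have "(LINT z|MQ. ?C z * pd h ?S z) = ?w * of_real ((L2_norm Q ?C)\<^sup>2)"
    unfolding partial_tensor_mode L2_norm_sq_cnj tensor_mode_cnj mult.left_commute[of "?C _"]
    by (rule integral_mult_right_zero)
  ultimately have "?w * of_real ((L2_norm Q ?C)\<^sup>2) = ?w * of_real ((L2_norm Q ?S)\<^sup>2)"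
    by (simp only: mult_minus_left) (simp only: add.commute[of "- _"] add_eq_0_iff2 minus_minus)
  then show ?thesis unfolding of_real_mult[symmetric] of_real_eq_iff .
qed

text \<open>Optimal coefficients do not depend on the index set, so enlarging it never worsens the
  error. This lets a single index set serve a function and both of its derivatives.\<close>

lemma L2_best_approximation_superset:
  fixes e :: "'i \<Rightarrow> 'a::euclidean_space \<Rightarrow> complex"
  assumes A: "finite A" "B \<subseteq> A" and e: "\<And>i. e i \<in> L2 \<Omega>" and u: "u \<in> L2 \<Omega>"
    and orth: "\<And>i j. i \<noteq> j \<Longrightarrow> (LINT x|lebesgue_on \<Omega>. e i x * cnj (e j x)) = 0"
    and a: "\<And>i. a i * of_real ((L2_norm \<Omega> (e i))\<^sup>2) = (LINT x|lebesgue_on \<Omega>. u x * cnj (e i x))"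
    and \<epsilon>: "L2_norm \<Omega> (\<lambda>x. u x - (\<Sum>i\<in>B. c i * e i x)) < \<epsilon>"
  shows "L2_norm \<Omega> (\<lambda>x. u x - (\<Sum>i\<in>A. a i * e i x)) < \<epsilon>"
proof -
  have eq: "(\<Sum>i\<in>B. c i * e i x) = (\<Sum>i\<in>A. (if i \<in> B then c i else 0) * e i x)" for x
    using fun_cong[OF lin_span_extend[OF A], of c e x] .
  show ?thesis
    by (rule le_less_trans[OF L2_best_approximation[OF A(1) e u orth a] \<epsilon>[unfolded eq]])
qed

text \<open>The cosine expansion of \<open>u\<close> may be differentiated termwise: the derivatives of its partial
  sums are the partial sums of the expansions of the weak derivatives.\<close>

lemma H1_smooth_dense:
  assumes u: "u \<in> H1 Q" and \<epsilon>: "\<epsilon> > 0"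
  obtains \<phi> where "smooth \<phi>" "L2_norm Q (\<lambda>z. u z - \<phi> z) < \<epsilon>"
    "\<And>h. L2_norm Q (\<lambda>z. wpd h u z - pd h \<phi> z) < \<epsilon>"
proof -
  let ?C = "tensor_mode False False" and ?w = "\<lambda>h k. of_real (real (ix h k) * pi) :: complex"
  let ?g = "\<lambda>h. wpd h u"
  note uL = H1_L2[OF u] and gL = weak_partial_L2[OF u dir_Basis]
  have EL: "tensor_mode a b k \<in> L2 Q" for a b k by (rule smooth_L2[OF smooth_tensor_mode])
  define a where "a k = (LINT z|MQ. u z * ?C k z) / of_real ((L2_norm Q (?C k))\<^sup>2)" for k
  have a: "a k * of_real ((L2_norm Q (?C k))\<^sup>2) = (LINT z|MQ. u z * cnj (?C k z))" for k
  proof (cases "L2_norm Q (?C k) = 0")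
    case True
    then have "(LINT z|MQ. u z * ?C k z) = 0"
      using L2_Cauchy_Schwarz[OF uL EL[of False False k]] by simp
    then show ?thesis by (simp add: a_def tensor_mode_cnj)
  qed (simp add: a_def tensor_mode_cnj)
  \<comment> \<open>Integration by parts puts the derivative on the sine product, which vanishes on
    the two sides concerned, so the boundary values of \<open>u\<close> do not enter. The result is
    the expansion coefficient of the weak derivative, again in undivided form.\<close>
  have a': "(- ?w h k * a k) * of_real ((L2_norm Q (tensor_mode h (\<not> h) k))\<^sup>2)
      = (LINT z|MQ. ?g h z * cnj (tensor_mode h (\<not> h) k z))" for h k
  proof -
    have "(LINT z|MQ. ?g h z * tensor_mode h (\<not> h) k z)
        = - (LINT z|MQ. u z * pd h (tensor_mode h (\<not> h) k) z)"
      using weak_partial_ibp[OF uL gL weak_partial_has[OF u dir_Basis] smooth_tensor_mode tensor_mode_boundary, of h k]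
      by simp
    also have "\<dots> = - (?w h k * (LINT z|MQ. u z * ?C k z))"
      unfolding partial_tensor_mode mult.left_commute[of "u _"] integral_mult_right_zero ..
    also have "\<dots> = - (a k * of_real (real (ix h k) * pi * (L2_norm Q (?C k))\<^sup>2))"
      unfolding a[of k, unfolded tensor_mode_cnj, symmetric] of_real_mult by (simp only: mult_ac)
    finally show ?thesis
      unfolding tensor_mode_cnj tensor_mode_norms of_real_mult by (simp only: mult_ac mult_minus_left mult_minus_right)
  qed
  obtain A0 c0 where A0: "finite A0" "L2_norm Q (\<lambda>z. u z - (\<Sum>k\<in>A0. c0 k * ?C k z)) < \<epsilon>"
    using tensor_mode_dense[OF uL \<epsilon>] .
  obtain B1 c1 where 1: "finite B1" "L2_norm Q (\<lambda>z. ?g True z - (\<Sum>k\<in>B1. c1 k * tensor_mode True False k z)) < \<epsilon>"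
    using tensor_mode_dense[OF gL \<epsilon>] .
  obtain B2 c2 where 2: "finite B2" "L2_norm Q (\<lambda>z. ?g False z - (\<Sum>k\<in>B2. c2 k * tensor_mode False True k z)) < \<epsilon>"
    using tensor_mode_dense[OF gL \<epsilon>] .
  define B where "B h = (if h then B1 else B2)" for h
  define c where "c h = (if h then c1 else c2)" for h
  have B: "finite (B h)" "L2_norm Q (\<lambda>z. ?g h z - (\<Sum>k\<in>B h. c h k * tensor_mode h (\<not> h) k z)) < \<epsilon>" for h
    using 1 2 by (cases h; simp add: B_def c_def)+
  define A where "A = A0 \<union> B True \<union> B False"
  have A: "finite A" "A0 \<subseteq> A" and BA: "B h \<subseteq> A" for h using A0(1) B(1) by (cases h; auto simp: A_def)+
  define \<phi> where "\<phi> = (\<lambda>z. \<Sum>k\<in>A. a k * ?C k z)"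
  have \<phi>k: "smooth (\<lambda>z. a k * ?C k z)" for k by (intro smooth_mult smooth_const smooth_tensor_mode)
  have part: "pd h \<phi> z = (\<Sum>k\<in>A. (- ?w h k * a k) * tensor_mode h (\<not> h) k z)" for h z
  proof -
    have "pd h (\<lambda>z. a k * ?C k z) z = (- ?w h k * a k) * tensor_mode h (\<not> h) k z" for k
    proof -
      have "pd h (\<lambda>z. a k) = (\<lambda>z. 0)" by (rule ext) (rule partial_eqI[OF has_derivative_const])
      then show ?thesis
        by (simp add: partial_mult smooth_differentiable smooth_const smooth_tensor_mode partial_tensor_mode mult_ac)
    qed
    then show ?thesis unfolding \<phi>_def using partial_sum[of A "\<lambda>k z. a k * ?C k z" "dir h"] \<phi>k by simp
  qed
  show thesis
  proof (rule that[of \<phi>])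
    show "smooth \<phi>" unfolding \<phi>_def by (intro smooth_sum \<phi>k)
    show "L2_norm Q (\<lambda>z. u z - \<phi> z) < \<epsilon>"
      unfolding \<phi>_def by (rule L2_best_approximation_superset[OF A EL uL tensor_mode_orthogonal a A0(2)])
    show "L2_norm Q (\<lambda>z. ?g h z - pd h \<phi> z) < \<epsilon>" for h
      unfolding part by (rule L2_best_approximation_superset[OF A(1) BA EL gL tensor_mode_orthogonal a' B(2)])
  qed
qed

section \<open>Borel representatives and averages over slices\<close>

lemma ex_borel_version:
  fixes F :: "'a::euclidean_space \<Rightarrow> complex"
  assumes F: "F \<in> borel_measurable (lebesgue_on S)" and S: "S \<in> sets lebesgue"
  obtains F' where "F' \<in> borel_measurable borel" "AE z in lebesgue_on S. F z = F' z"
proof -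
  have "(\<lambda>z. indicator S z *\<^sub>R F z) \<in> borel_measurable lebesgue"
    using F S by (simp add: borel_measurable_restrict_space_iff)
  then have "(\<lambda>z. Re (indicator S z *\<^sub>R F z)) \<in> borel_measurable lebesgue"
    "(\<lambda>z. Im (indicator S z *\<^sub>R F z)) \<in> borel_measurable lebesgue" by measurable
  from completion_ex_borel_measurable_real[OF this(1)] completion_ex_borel_measurable_real[OF this(2)]
  obtain p q where [measurable]: "p \<in> borel_measurable borel" "q \<in> borel_measurable borel"
    and pq: "AE z in lborel. Re (indicator S z *\<^sub>R F z) = p z" "AE z in lborel. Im (indicator S z *\<^sub>R F z) = q z"
    by auto
  have "AE z in lebesgue. Re (indicator S z *\<^sub>R F z) = p z \<and> Im (indicator S z *\<^sub>R F z) = q z"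
    using pq by (intro AE_completion) (rule AE_conjI)
  then have "AE z in lebesgue. z \<in> S \<longrightarrow> F z = of_real (p z) + \<i> * of_real (q z)"
    by eventually_elim (auto simp: complex_eq_iff)
  then have "AE z in lebesgue_on S. F z = of_real (p z) + \<i> * of_real (q z)"
    using S by (subst AE_restrict_space_iff) auto
  then show thesis by (intro that[of "\<lambda>z. of_real (p z) + \<i> * of_real (q z)"]) measurable
qed

lemma L2_norm_1_J: "L2_norm J (\<lambda>_. 1) \<le> 1"
  using L2_norm_le_sup[of J "\<lambda>_. 1" 1] continuous_imp_L2_ivl(1)[of "\<lambda>_. 1"]
  by (simp add: continuous_on_const)

text \<open>Cauchy-Schwarz on a slice of length 1 bounds the squared average by the average of the
  square; Fubini then integrates over the slices.\<close>

lemma slice_average_bound: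
  assumes D: "D \<in> borel_measurable borel" "D \<in> L2 Q"
  shows "(\<lambda>t. LINT s|MJ. D (pt h s t)) \<in> L2 J"
    and "L2_norm J (\<lambda>t. LINT s|MJ. D (pt h s t)) \<le> L2_norm Q D"
proof -
  note [measurable] = D(1)
  let ?A = "\<lambda>t. LINT s|MJ. D (pt h s t)" and ?B = "\<lambda>t. LINT s|MJ. (cmod (D (pt h s t)))\<^sup>2"
  have m2: "(\<lambda>z. (cmod (D z))\<^sup>2) \<in> borel_measurable borel" by measurable
  note sq = L2_integrable_sq[OF D(2)]
  have Am: "?A \<in> borel_measurable MJ"
    using Fubini_square_measurable[OF D(1) L2_imp_integrable_Q[OF D(2)], of h]
    by (intro measurable_restrict_space1 measurable_completion) simp
  have Ds: "(\<lambda>s. D (pt h s t)) \<in> borel_measurable MJ" for t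
  proof (intro measurable_restrict_space1 measurable_completion)
    have "(\<lambda>s. pt h s t) \<in> borel_measurable lborel"
      by (auto intro!: borel_measurable_continuous_onI continuous_pt continuous_intros)
    from measurable_compose[OF this D(1)] show "(\<lambda>s. D (pt h s t)) \<in> borel_measurable lborel" by simp
  qed
  have one: "(\<lambda>_. 1) \<in> L2 J" by (rule continuous_imp_L2_ivl) (rule continuous_on_const)
  have bound: "(cmod (?A t))\<^sup>2 \<le> ?B t" if "integrable MJ (\<lambda>s. (cmod (D (pt h s t)))\<^sup>2)" for t
  proof -
    have L: "(\<lambda>s. D (pt h s t)) \<in> L2 J" using Ds that by (simp add: L2_def)
    have "cmod (?A t) \<le> L2_norm J (\<lambda>s. D (pt h s t)) * L2_norm J (\<lambda>_. 1)"
      using L2_Cauchy_Schwarz[OF L one] by simp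
    also have "\<dots> \<le> L2_norm J (\<lambda>s. D (pt h s t))"
      using mult_left_mono[OF L2_norm_1_J] by simp
    finally have "(cmod (?A t))\<^sup>2 \<le> (L2_norm J (\<lambda>s. D (pt h s t)))\<^sup>2" by (intro power_mono) auto
    then show ?thesis by (simp only: L2_norm_sq)
  qed
  have AEb: "AE t in MJ. (cmod (?A t))\<^sup>2 \<le> ?B t"
    using Fubini_square_AE[OF m2 sq, of h] by eventually_elim (rule bound)
  have iB: "integrable MJ ?B" by (rule Fubini_square_integrable[OF m2 sq])
  have iA: "integrable MJ (\<lambda>t. (cmod (?A t))\<^sup>2)"
  proof (rule Bochner_Integration.integrable_bound[OF iB])
    show "(\<lambda>t. (cmod (?A t))\<^sup>2) \<in> borel_measurable MJ" using Am by measurable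
    show "AE t in MJ. norm ((cmod (?A t))\<^sup>2) \<le> norm (?B t)" using AEb by eventually_elim simp
  qed
  show "?A \<in> L2 J" using Am iA by (simp add: L2_def)
  have "(L2_norm J ?A)\<^sup>2 \<le> (LINT t|MJ. ?B t)"
    unfolding L2_norm_sq by (rule integral_mono_AE[OF iA iB AEb])
  also have "\<dots> = (L2_norm Q D)\<^sup>2"
    unfolding L2_norm_sq by (rule Fubini_square[OF m2 sq, symmetric])
  finally show "L2_norm J ?A \<le> L2_norm Q D" by (rule power2_le_imp_le) simp
qed

text \<open>\<open>A\<close> is the slice average of a Borel representative of \<open>F\<close>, so
  that Fubini applies. It is fixed before \<open>G\<close> varies, which allows passage to the limit
  along smooth approximations.\<close>

lemma ex_slice_average:
  assumes F: "F \<in> L2 Q"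
  obtains A where "A \<in> L2 J"
    "\<And>G. continuous_on UNIV G \<Longrightarrow> L2_norm J (\<lambda>t. A t - (LINT s|MJ. G (pt h s t))) \<le> L2_norm Q (\<lambda>z. F z - G z)"
proof -
  obtain F' where F': "F' \<in> borel_measurable borel" "AE z in MQ. F z = F' z"
    using ex_borel_version[OF L2_measurable[OF F]] by auto
  have F'm: "F' \<in> borel_measurable MQ"
    using F'(1) by (intro measurable_restrict_space1 measurable_completion) simp
  have F'L: "F' \<in> L2 Q" by (rule L2_cong_AE[OF F F'm F'(2)])
  define A where "A t = (LINT s|MJ. F' (pt h s t))" for t
  have AL: "A \<in> L2 J" unfolding A_def by (rule slice_average_bound[OF F'(1) F'L])
  show thesis
  proof (rule that[OF AL])
    fix G :: "real \<times> real \<Rightarrow> complex" assume G: "continuous_on UNIV G"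
    have GL: "G \<in> L2 Q" by (intro continuous_imp_L2_square continuous_on_subset[OF G]) simp
    have Gm: "G \<in> borel_measurable borel" using G by (rule borel_measurable_continuous_onI)
    define D where "D = (\<lambda>z. F' z - G z)"
    have D: "D \<in> borel_measurable borel" "D \<in> L2 Q"
      unfolding D_def using F'(1) Gm F'L GL by (auto intro: L2_diff)
    have GJ: "(\<lambda>t. LINT s|MJ. G (pt h s t)) \<in> L2 J" by (rule slice_average_bound[OF Gm GL])
    have "AE t in MJ. A t - (LINT s|MJ. G (pt h s t)) = (LINT s|MJ. D (pt h s t))"
      using Fubini_square_AE[OF F'(1) L2_imp_integrable_Q[OF F'L], of h]
        Fubini_square_AE[OF Gm L2_imp_integrable_Q[OF GL], of h]
      by eventually_elim (simp add: A_def D_def)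
    then have "L2_norm J (\<lambda>t. A t - (LINT s|MJ. G (pt h s t))) = L2_norm J (\<lambda>t. LINT s|MJ. D (pt h s t))"
      by (intro L2_norm_cong_AE L2_measurable L2_diff AL GJ slice_average_bound[OF D])
    also have "\<dots> \<le> L2_norm Q D" by (rule slice_average_bound[OF D])
    also have "L2_norm Q D = L2_norm Q (\<lambda>z. F z - G z)"
    proof (rule L2_norm_cong_AE)
      show "AE z in MQ. D z = F z - G z" using F'(2) by eventually_elim (simp add: D_def)
    qed (intro L2_measurable D L2_diff F GL)+
    finally show "L2_norm J (\<lambda>t. A t - (LINT s|MJ. G (pt h s t))) \<le> L2_norm Q (\<lambda>z. F z - G z)" .
  qed
qed

text \<open>\<open>h\<close> gives the direction of the normal, and \<open>p\<close> tells whether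
  the outward normal is positive, that is, whether the coordinate in that direction is 1 on the
  side.\<close>

definition sd :: "bool \<Rightarrow> bool \<Rightarrow> side" where
  "sd h p = (if h then if p then Side2 else Side4 else if p then Side3 else Side1)"

lemma side_cases_sd: obtains h p where "j = sd h p"
  by (cases j) (auto intro: that[of False False] that[of True True] that[of False True] that[of True False] simp: sd_def)

lemma side_point_sd: "side_point (sd h p) t = pt h (of_bool p) t"
  by (auto simp: sd_def pt_def)

section \<open>Existence, uniqueness and bounds of traces\<close>

lemma smooth_pt_normal: "smooth \<phi> \<Longrightarrow> continuous_on A (\<lambda>s. \<phi> (pt h s t))"
  by (rule continuous_on_compose2[OF smooth_continuous[of \<phi> UNIV]]) (auto intro!: continuous_pt continuous_intros)

text \<open>The weight is s for the side at 1 and s - 1 for the side at 0: it has derivative 1 and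
  vanishes on the opposite side, so the integrand is an exact derivative. A boundary value thus
  becomes an integral of \<phi> and its derivative, and these are controlled by the
  \<open>H1\<close> norm.\<close>

lemma smooth_trace_formula:
  assumes \<phi>: "smooth \<phi>"
  shows "(LINT s|MJ. \<phi> (pt h s t) + of_real (s - 1 + of_bool p) * pd h \<phi> (pt h s t)) = \<phi> (side_point (sd h p) t)"
proof -
  let ?F = "\<lambda>s. of_real (s - 1 + of_bool p) * \<phi> (pt h s t)"
  have "(?F has_vector_derivative \<phi> (pt h s t) + of_real (s - 1 + of_bool p) * pd h \<phi> (pt h s t)) (at s)" for s
  proof -
    have 1: "((\<lambda>s. of_real (s - 1 + of_bool p) :: complex) has_vector_derivative of_real 1) (at s)"
      by (intro has_vector_derivative_of_real) (auto intro!: derivative_eq_intros)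
    from has_vector_derivative_mult[OF 1 has_vector_derivative_pt[OF \<phi>, of h t s]]
    show ?thesis by (simp add: add.commute)
  qed
  then have "(LINT s|MJ. \<phi> (pt h s t) + of_real (s - 1 + of_bool p) * pd h \<phi> (pt h s t)) = ?F 1 - ?F 0"
    by (rule integral_J_FTC) (intro continuous_on_add continuous_on_mult smooth_pt_normal \<phi> smooth_partial_dir continuous_on_of_real
        continuous_on_diff continuous_on_const continuous_on_id)
  also have "\<dots> = \<phi> (side_point (sd h p) t)" by (cases p) (simp_all add: side_point_sd)
  finally show ?thesis .
qed

text \<open>The integral in \<open>smooth_trace_formula\<close> makes sense for \<open>u\<close> and
  its weak derivative and serves as the trace. Since the weight is at most 1 in modulus, no further
  constants appear in the bound.\<close>

lemma ex_trace_candidate: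
  assumes u: "u \<in> H1 Q"
  obtains g where "g \<in> L2 J"
    "\<And>\<phi>. smooth \<phi> \<Longrightarrow> L2_norm J (\<lambda>t. g t - \<phi> (side_point (sd h p) t))
      \<le> L2_norm Q (\<lambda>z. u z - \<phi> z) + L2_norm Q (\<lambda>z. wpd h u z - pd h \<phi> z)"
proof -
  define w :: "real \<times> real \<Rightarrow> complex" where "w = (\<lambda>z. of_real (sc h z - 1 + of_bool p))"
  have wc: "continuous_on A w" for A
    unfolding w_def by (intro continuous_on_of_real continuous_on_add continuous_on_diff continuous_on_const
        linear_continuous_on bounded_linear_sc)
  have wb: "cmod (w z) \<le> 1" if "z \<in> Q" for z
    using that unfolding mem_Q_sc_tc[of z h] w_def norm_of_real by (cases p) auto
  have wm: "w \<in> borel_measurable MQ"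
    by (intro L2_measurable continuous_imp_L2_square wc)
  note uL = H1_L2[OF u] and gL = weak_partial_L2[OF u dir_Basis[of h]]
  let ?g = "wpd h u"
  have FL: "(\<lambda>z. u z + ?g z * w z) \<in> L2 Q"
    by (intro L2_add uL L2_mult_bounded[OF gL wm wb]) simp_all
  show thesis
  proof (rule ex_slice_average[OF FL, of h], rule that)
    fix g
    assume "g \<in> L2 J"
    then show "g \<in> L2 J" .
  next
    fix g
    assume g: "\<And>G. continuous_on UNIV G \<Longrightarrow>
      L2_norm J (\<lambda>t. g t - (LINT s|MJ. G (pt h s t))) \<le> L2_norm Q (\<lambda>z. (u z + ?g z * w z) - G z)"
    fix \<phi> :: "real \<times> real \<Rightarrow> complex" assume \<phi>: "smooth \<phi>"
    define G where "G = (\<lambda>z. \<phi> z + w z * pd h \<phi> z)"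
    have Gc: "continuous_on UNIV G"
      unfolding G_def by (intro continuous_on_add continuous_on_mult wc smooth_continuous smooth_partial_dir \<phi>)
    have dL: "(\<lambda>z. ?g z - pd h \<phi> z) \<in> L2 Q" and d0: "(\<lambda>z. u z - \<phi> z) \<in> L2 Q"
      by (intro L2_diff gL uL smooth_L2 smooth_partial_dir \<phi>)+
    have "(LINT s|MJ. G (pt h s t)) = \<phi> (side_point (sd h p) t)" for t
      unfolding G_def w_def sc_pt by (rule smooth_trace_formula[OF \<phi>])
    then have "L2_norm J (\<lambda>t. g t - \<phi> (side_point (sd h p) t)) \<le> L2_norm Q (\<lambda>z. (u z + ?g z * w z) - G z)"
      using g[OF Gc] by simp
    also have "(\<lambda>z. (u z + ?g z * w z) - G z) = (\<lambda>z. (u z - \<phi> z) + (?g z - pd h \<phi> z) * w z)"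
      by (rule ext) (simp add: G_def algebra_simps)
    also have "L2_norm Q \<dots> \<le> L2_norm Q (\<lambda>z. u z - \<phi> z) + L2_norm Q (\<lambda>z. (?g z - pd h \<phi> z) * w z)"
      by (intro L2_norm_triangle d0 L2_mult_bounded[OF dL wm wb]) simp_all
    also have "L2_norm Q (\<lambda>z. (?g z - pd h \<phi> z) * w z) \<le> L2_norm Q (\<lambda>z. ?g z - pd h \<phi> z)"
      by (rule L2_norm_mult_le[OF dL wm wb]) simp_all
    finally show "L2_norm J (\<lambda>t. g t - \<phi> (side_point (sd h p) t))
      \<le> L2_norm Q (\<lambda>z. u z - \<phi> z) + L2_norm Q (\<lambda>z. ?g z - pd h \<phi> z)" by simp
  qed
qed

lemma grad_norm_sq:
  assumes "\<And>h. wpd h u \<in> L2 Q"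
  shows "(grad_norm Q u)\<^sup>2 = (L2_norm Q (wpd True u))\<^sup>2 + (L2_norm Q (wpd False u))\<^sup>2"
proof -
  have "(LINT x|MQ. (\<Sum>b\<in>Basis. (cmod (weak_partial Q b u x))\<^sup>2))
    = (LINT x|MQ. (cmod (wpd True u x))\<^sup>2 + (cmod (wpd False u x))\<^sup>2)"
    by (simp add: Basis_dir dir_neq)
  also have "\<dots> = (L2_norm Q (wpd True u))\<^sup>2 + (L2_norm Q (wpd False u))\<^sup>2"
    unfolding L2_norm_sq by (intro Bochner_Integration.integral_add L2_integrable_sq assms)
  finally show ?thesis
    unfolding grad_norm_def by (simp only: real_sqrt_pow2_iff) (simp add: add_nonneg_nonneg)
qed

text \<open>\<open>H1_norm\<close> refers to the derivative that \<open>SOME\<close> picks for the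
  difference; by uniqueness it agrees almost everywhere with the difference of the
  derivatives.\<close>

lemma H1_norm_diff:
  assumes u: "u \<in> H1 Q" and \<phi>: "smooth \<phi>"
  shows "(H1_norm Q (\<lambda>x. \<phi> x - u x))\<^sup>2 = (L2_norm Q (\<lambda>z. u z - \<phi> z))\<^sup>2
    + (L2_norm Q (\<lambda>z. wpd True u z - pd True \<phi> z))\<^sup>2
    + (L2_norm Q (\<lambda>z. wpd False u z - pd False \<phi> z))\<^sup>2"
proof -
  note uL = H1_L2[OF u] and gL = weak_partial_L2[OF u dir_Basis]
  have dL: "(\<lambda>z. pd h \<phi> z - wpd h u z) \<in> L2 Q" for h
    by (intro L2_diff gL smooth_L2 smooth_partial_dir \<phi>)
  have wp: "has_weak_partial Q (dir h) (\<lambda>z. \<phi> z - u z) (\<lambda>z. pd h \<phi> z - wpd h u z)" for h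
    by (intro has_weak_partial_diff uL gL smooth_L2 smooth_partial_dir \<phi> smooth_has_weak_partial weak_partial_has u dir_Basis)
  have "L2_norm Q (wpd h (\<lambda>z. \<phi> z - u z)) = L2_norm Q (\<lambda>z. wpd h u z - pd h \<phi> z)" for h
    unfolding L2_norm_minus_commute[of Q "wpd h u"]
    by (intro L2_norm_cong_AE L2_measurable weak_partial_AE[OF dL wp] dL)
  moreover have "wpd h (\<lambda>z. \<phi> z - u z) \<in> L2 Q" for h by (rule weak_partial_AE[OF dL wp])
  ultimately show ?thesis
    unfolding H1_norm_def by (simp add: grad_norm_sq L2_norm_minus_commute[of Q \<phi> u])
qed

lemma H1_norm_ge:
  assumes u: "u \<in> H1 Q" and \<phi>: "smooth \<phi>"
  shows "L2_norm Q (\<lambda>z. u z - \<phi> z) \<le> H1_norm Q (\<lambda>x. \<phi> x - u x)"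
    and "L2_norm Q (\<lambda>z. wpd h u z - pd h \<phi> z) \<le> H1_norm Q (\<lambda>x. \<phi> x - u x)"
proof -
  have 0: "0 \<le> H1_norm Q (\<lambda>x. \<phi> x - u x)" by (simp add: H1_norm_def)
  show "L2_norm Q (\<lambda>z. u z - \<phi> z) \<le> H1_norm Q (\<lambda>x. \<phi> x - u x)"
    by (rule power2_le_imp_le[OF _ 0]) (simp add: H1_norm_diff[OF u \<phi>])
  show "L2_norm Q (\<lambda>z. wpd h u z - pd h \<phi> z) \<le> H1_norm Q (\<lambda>x. \<phi> x - u x)"
    by (rule power2_le_imp_le[OF _ 0], cases h) (simp_all add: H1_norm_diff[OF u \<phi>])
qed

lemma smooth_side_L2: "smooth \<phi> \<Longrightarrow> (\<lambda>t. \<phi> (side_point j t)) \<in> L2 J"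
  by (rule side_cases_sd[of j]) (simp add: side_point_sd continuous_imp_L2_ivl(1) smooth_pt)

lemma H1_approx_sequence:
  assumes u: "u \<in> H1 Q"
  obtains \<phi> where "\<forall>n::nat. smooth (\<phi> n)" "(\<lambda>n. L2_norm Q (\<lambda>z. u z - \<phi> n z)) \<longlonglongrightarrow> 0"
    "\<forall>h. (\<lambda>n. L2_norm Q (\<lambda>z. wpd h u z - pd h (\<phi> n) z)) \<longlonglongrightarrow> 0"
proof -
  have "\<exists>\<phi>. smooth \<phi> \<and> L2_norm Q (\<lambda>z. u z - \<phi> z) < inverse (real (Suc n)) \<and>
    (\<forall>h. L2_norm Q (\<lambda>z. wpd h u z - pd h \<phi> z) < inverse (real (Suc n)))" for n
  proof (rule H1_smooth_dense[OF u, of "inverse (real (Suc n))"])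
    fix \<phi> assume "smooth \<phi>" "L2_norm Q (\<lambda>z. u z - \<phi> z) < inverse (real (Suc n))"
      "\<And>h. L2_norm Q (\<lambda>z. wpd h u z - pd h \<phi> z) < inverse (real (Suc n))"
    then show ?thesis by (intro exI[of _ \<phi>] conjI allI)
  qed simp
  from choice[OF allI[OF this]] obtain \<phi> where *: "\<forall>n. smooth (\<phi> n) \<and> L2_norm Q (\<lambda>z. u z - \<phi> n z) < inverse (real (Suc n)) \<and>
    (\<forall>h. L2_norm Q (\<lambda>z. wpd h u z - pd h (\<phi> n) z) < inverse (real (Suc n)))" ..
  note \<phi> = *[THEN spec, THEN conjunct1] *[THEN spec, THEN conjunct2, THEN conjunct1]
    *[THEN spec, THEN conjunct2, THEN conjunct2, THEN spec]
  show thesis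
  proof (rule that[of \<phi>])
    show "(\<lambda>n. L2_norm Q (\<lambda>z. u z - \<phi> n z)) \<longlonglongrightarrow> 0"
      by (rule tendsto_sandwich[OF _ _ tendsto_const LIMSEQ_inverse_real_of_nat])
        (use \<phi>(2) in \<open>auto intro!: always_eventually less_imp_le\<close>)
    have "(\<lambda>n. L2_norm Q (\<lambda>z. wpd h u z - pd h (\<phi> n) z)) \<longlonglongrightarrow> 0" for h
      by (rule tendsto_sandwich[OF _ _ tendsto_const LIMSEQ_inverse_real_of_nat])
        (use \<phi>(3)[of h] in \<open>auto intro!: always_eventually less_imp_le\<close>)
    then show "\<forall>h. (\<lambda>n. L2_norm Q (\<lambda>z. wpd h u z - pd h (\<phi> n) z)) \<longlonglongrightarrow> 0" ..
  qed (intro allI \<phi>(1))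
qed

text \<open>The candidate shows that a trace exists. Its bound also holds along any approximating
  sequence, so every function satisfying \<open>has_trace\<close> agrees with it almost everywhere;
  in particular \<open>trace\<close>, chosen by \<open>SOME\<close>, inherits the bound.\<close>

lemma
  assumes u: "u \<in> H1 Q"
  shows trace_L2: "trace (sd h p) u \<in> L2 J"
    and trace_bound: "smooth \<phi> \<Longrightarrow> L2_norm J (\<lambda>t. trace (sd h p) u t - \<phi> (side_point (sd h p) t))
      \<le> L2_norm Q (\<lambda>z. u z - \<phi> z) + L2_norm Q (\<lambda>z. wpd h u z - pd h \<phi> z)"
proof -
  let ?j = "sd h p"
  obtain g where gL: "g \<in> L2 J" and g: "\<forall>\<phi>. smooth \<phi> \<longrightarrow> L2_norm J (\<lambda>t. g t - \<phi> (side_point ?j t))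
      \<le> L2_norm Q (\<lambda>z. u z - \<phi> z) + L2_norm Q (\<lambda>z. wpd h u z - pd h \<phi> z)"
  proof (rule ex_trace_candidate[OF u, of h p])
    fix g assume "g \<in> L2 J" "\<And>\<phi>. smooth \<phi> \<Longrightarrow> L2_norm J (\<lambda>t. g t - \<phi> (side_point ?j t))
      \<le> L2_norm Q (\<lambda>z. u z - \<phi> z) + L2_norm Q (\<lambda>z. wpd h u z - pd h \<phi> z)"
    then show thesis by (intro that[of g] allI impI)
  qed
  obtain \<psi> where \<psi>: "\<forall>n::nat. smooth (\<psi> n)" and \<psi>0: "(\<lambda>n. L2_norm Q (\<lambda>z. u z - \<psi> n z)) \<longlonglongrightarrow> 0"
    and \<psi>1: "\<forall>h. (\<lambda>n. L2_norm Q (\<lambda>z. wpd h u z - pd h (\<psi> n) z)) \<longlonglongrightarrow> 0"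
    using H1_approx_sequence[OF u] .
  note \<psi> = \<psi>[THEN spec] and \<psi>1 = \<psi>1[THEN spec]
  have "has_trace ?j u g"
    unfolding has_trace_def
  proof (intro conjI gL exI[of _ \<psi>] allI \<psi>)
    have "(\<lambda>n. sqrt ((L2_norm Q (\<lambda>z. u z - \<psi> n z))\<^sup>2
      + (L2_norm Q (\<lambda>z. wpd True u z - pd True (\<psi> n) z))\<^sup>2
      + (L2_norm Q (\<lambda>z. wpd False u z - pd False (\<psi> n) z))\<^sup>2)) \<longlonglongrightarrow> sqrt (0\<^sup>2 + 0\<^sup>2 + 0\<^sup>2)"
      by (intro tendsto_real_sqrt tendsto_add tendsto_power \<psi>0 \<psi>1)
    moreover have "0 \<le> H1_norm Q v" for v by (simp add: H1_norm_def)
    ultimately show "(\<lambda>n. H1_norm unit_square (\<lambda>x. \<psi> n x - u x)) \<longlonglongrightarrow> 0"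
      unfolding H1_norm_diff[OF u \<psi>, symmetric] by simp
    show "(\<lambda>n. L2_norm J (\<lambda>t. \<psi> n (side_point ?j t) - g t)) \<longlonglongrightarrow> 0"
    proof (rule tendsto_sandwich[OF _ _ tendsto_const])
      show "\<forall>\<^sub>F n in sequentially. L2_norm J (\<lambda>t. \<psi> n (side_point ?j t) - g t) \<le>
        L2_norm Q (\<lambda>z. u z - \<psi> n z) + L2_norm Q (\<lambda>z. wpd h u z - pd h (\<psi> n) z)"
        using g \<psi> unfolding L2_norm_minus_commute[of J "\<lambda>t. \<psi> _ (side_point ?j t)"]
        by (intro always_eventually allI) simp
      show "(\<lambda>n. L2_norm Q (\<lambda>z. u z - \<psi> n z) + L2_norm Q (\<lambda>z. wpd h u z - pd h (\<psi> n) z)) \<longlonglongrightarrow> 0"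
        using tendsto_add[OF \<psi>0 \<psi>1[of h]] by simp
    qed simp
  qed
  then have tr: "has_trace ?j u (trace ?j u)" unfolding trace_def by (rule someI[of "has_trace (sd h p) u"])
  then show tL: "trace ?j u \<in> L2 J" unfolding has_trace_def by (rule conjunct1)
  from tr obtain \<omega> :: "nat \<Rightarrow> real \<times> real \<Rightarrow> complex" where \<omega>: "\<And>n. smooth (\<omega> n)"
    and \<omega>0: "(\<lambda>n. H1_norm Q (\<lambda>x. \<omega> n x - u x)) \<longlonglongrightarrow> 0"
    and \<omega>1: "(\<lambda>n. L2_norm J (\<lambda>t. \<omega> n (side_point ?j t) - trace ?j u t)) \<longlonglongrightarrow> 0"
    unfolding has_trace_def by auto
  \<comment> \<open>The factor 2 counts the two norms in the bound for \<open>g\<close>, each at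
    most the \<open>H1\<close> norm.\<close>
  have "(\<lambda>n. 2 * H1_norm Q (\<lambda>x. \<omega> n x - u x) + L2_norm J (\<lambda>t. \<omega> n (side_point ?j t) - trace ?j u t)) \<longlonglongrightarrow> 2 * 0 + 0"
    by (intro tendsto_add tendsto_mult tendsto_const \<omega>0 \<omega>1)
  moreover have "L2_norm J (\<lambda>t. g t - trace ?j u t) \<le> 2 * H1_norm Q (\<lambda>x. \<omega> n x - u x) + L2_norm J (\<lambda>t. \<omega> n (side_point ?j t) - trace ?j u t)" for n
  proof -
    have "L2_norm J (\<lambda>t. g t - \<omega> n (side_point ?j t)) \<le> 2 * H1_norm Q (\<lambda>x. \<omega> n x - u x)"
      using g[rule_format, OF \<omega>[of n]] H1_norm_ge(1)[OF u \<omega>[of n]]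
        H1_norm_ge(2)[OF u \<omega>[of n], of h] by linarith
    then show ?thesis
      using L2_norm_triangle_diff[OF gL smooth_side_L2[OF \<omega>[of n], of ?j] tL] by linarith
  qed
  ultimately have "L2_norm J (\<lambda>t. g t - trace ?j u t) \<le> 2 * 0 + 0"
    by (intro LIMSEQ_le_const) auto
  then have "L2_norm J (\<lambda>t. g t - trace ?j u t) = 0" using L2_norm_nonneg[of J] by (simp add: antisym)
  from L2_norm_eq_0_AE[OF L2_diff[OF gL tL] this]
  have AEg: "AE t in MJ. g t = trace ?j u t" by simp
  show "L2_norm J (\<lambda>t. trace ?j u t - \<phi> (side_point ?j t))
      \<le> L2_norm Q (\<lambda>z. u z - \<phi> z) + L2_norm Q (\<lambda>z. wpd h u z - pd h \<phi> z)" if \<phi>: "smooth \<phi>"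
  proof -
    have "L2_norm J (\<lambda>t. trace ?j u t - \<phi> (side_point ?j t)) = L2_norm J (\<lambda>t. g t - \<phi> (side_point ?j t))"
    proof (rule L2_norm_cong_AE)
      show "AE t in MJ. trace ?j u t - \<phi> (side_point ?j t) = g t - \<phi> (side_point ?j t)"
        using AEg by eventually_elim simp
    qed (intro L2_measurable L2_diff gL tL smooth_side_L2 \<phi>)+
    then show ?thesis using g \<phi> by simp
  qed
qed

lemma smooth_weak_partial_AE:
  "smooth \<phi> \<Longrightarrow> AE z in MQ. wpd h \<phi> z = pd h \<phi> z"
  by (intro weak_partial_AE smooth_L2 smooth_partial_dir smooth_has_weak_partial)

lemma trace_smooth:
  assumes \<phi>: "smooth \<phi>" shows "AE t in MJ. trace j \<phi> t = \<phi> (side_point j t)"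
proof -
  obtain h p where j: "j = sd h p" by (rule side_cases_sd)
  note u = smooth_H1[OF \<phi>]
  have "L2_norm Q (\<lambda>z. wpd h \<phi> z - pd h \<phi> z) = L2_norm Q (\<lambda>z. 0)"
  proof (rule L2_norm_cong_AE)
    show "AE z in MQ. wpd h \<phi> z - pd h \<phi> z = 0"
      using smooth_weak_partial_AE[OF \<phi>] by eventually_elim simp
  qed (intro L2_measurable L2_0 L2_diff weak_partial_L2[OF u dir_Basis] smooth_L2 smooth_partial_dir \<phi>)+
  then have "L2_norm J (\<lambda>t. trace j \<phi> t - \<phi> (side_point j t)) \<le> 0"
    using trace_bound[OF u \<phi>, of h p] by (simp add: j L2_norm_def)
  then have "L2_norm J (\<lambda>t. trace j \<phi> t - \<phi> (side_point j t)) = 0"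
    using L2_norm_nonneg[of J] by (simp add: antisym)
  from L2_norm_eq_0_AE[OF L2_diff[OF _ smooth_side_L2[OF \<phi>]] this] trace_L2[OF u, of h p]
  show ?thesis by (simp add: j)
qed

text \<open>Both sides depend continuously on \<open>u\<close>, the left by Cauchy-Schwarz and the
  right by the trace bound, so the identity passes to the limit from smooth functions. \<psi> stays
  smooth, which is enough for duality.\<close>

lemma H1_Green:
  assumes u: "u \<in> H1 Q" and \<psi>: "smooth \<psi>"
  shows "(LINT z|MQ. wpd h u z * \<psi> z) + (LINT z|MQ. u z * pd h \<psi> z)
    = (LINT t|MJ. trace (sd h True) u t * \<psi> (pt h 1 t)) - (LINT t|MJ. trace (sd h False) u t * \<psi> (pt h 0 t))"
proof -
  obtain \<phi> where \<phi>: "\<forall>n::nat. smooth (\<phi> n)" and \<phi>0: "(\<lambda>n. L2_norm Q (\<lambda>z. u z - \<phi> n z)) \<longlonglongrightarrow> 0"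
    and \<phi>1: "\<forall>h. (\<lambda>n. L2_norm Q (\<lambda>z. wpd h u z - pd h (\<phi> n) z)) \<longlonglongrightarrow> 0"
    using H1_approx_sequence[OF u] .
  note \<phi> = \<phi>[THEN spec] and \<phi>1 = \<phi>1[THEN spec]
  have tr: "(\<lambda>n. L2_norm J (\<lambda>t. \<phi> n (side_point (sd h p) t) - trace (sd h p) u t)) \<longlonglongrightarrow> 0" for p
  proof (rule tendsto_sandwich[OF _ _ tendsto_const])
    show "\<forall>\<^sub>F n in sequentially. L2_norm J (\<lambda>t. \<phi> n (side_point (sd h p) t) - trace (sd h p) u t) \<le>
        L2_norm Q (\<lambda>z. u z - \<phi> n z) + L2_norm Q (\<lambda>z. wpd h u z - pd h (\<phi> n) z)"
      unfolding L2_norm_minus_commute[of J "\<lambda>t. \<phi> _ (side_point (sd h p) t)"]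
      by (intro always_eventually allI trace_bound u \<phi>)
    show "(\<lambda>n. L2_norm Q (\<lambda>z. u z - \<phi> n z) + L2_norm Q (\<lambda>z. wpd h u z - pd h (\<phi> n) z)) \<longlonglongrightarrow> 0"
      using tendsto_add[OF \<phi>0 \<phi>1[of h]] by simp
  qed simp
  have lb: "(\<lambda>n. LINT t|MJ. \<phi> n (side_point (sd h p) t) * \<psi> (side_point (sd h p) t))
      \<longlonglongrightarrow> (LINT t|MJ. trace (sd h p) u t * \<psi> (side_point (sd h p) t))" for p
    by (rule L2_integral_tendsto[OF trace_L2[OF u] smooth_side_L2[OF \<psi>] smooth_side_L2[OF \<phi>] tr])
  have l0: "(\<lambda>n. LINT z|MQ. \<phi> n z * pd h \<psi> z) \<longlonglongrightarrow> (LINT z|MQ. u z * pd h \<psi> z)"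
    by (rule L2_integral_tendsto[OF H1_L2[OF u] smooth_L2[OF smooth_partial_dir[OF \<psi>]] smooth_L2[OF \<phi>]])
      (subst L2_norm_minus_commute, rule \<phi>0)
  have l1: "(\<lambda>n. LINT z|MQ. pd h (\<phi> n) z * \<psi> z) \<longlonglongrightarrow> (LINT z|MQ. wpd h u z * \<psi> z)"
    by (rule L2_integral_tendsto[OF weak_partial_L2[OF u dir_Basis] smooth_L2[OF \<psi>] smooth_L2[OF smooth_partial_dir[OF \<phi>]]])
      (subst L2_norm_minus_commute, rule \<phi>1)
  have "(LINT z|MQ. pd h (\<phi> n) z * \<psi> z) + (LINT z|MQ. \<phi> n z * pd h \<psi> z)
    = (LINT t|MJ. \<phi> n (side_point (sd h True) t) * \<psi> (side_point (sd h True) t))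
      - (LINT t|MJ. \<phi> n (side_point (sd h False) t) * \<psi> (side_point (sd h False) t))" for n
    using smooth_Green[OF \<phi> \<psi>] by (simp add: side_point_sd)
  from LIMSEQ_unique[OF tendsto_add[OF l1 l0, unfolded this] tendsto_diff[OF lb lb]]
  show ?thesis by (simp add: side_point_sd)
qed

section \<open>The problem for a single mode\<close>

lemma smooth_has_vector_derivative:
  fixes w :: "real \<Rightarrow> complex"
  shows "smooth w \<Longrightarrow> (w has_vector_derivative partial 1 w x) (at x)"
  by (rule has_derivative_real_partial[OF smooth_differentiable])

lemma smooth_partial_1: "smooth (w :: real \<Rightarrow> complex) \<Longrightarrow> smooth (partial 1 w)"
  by (rule smooth_partial) simp_all

lemma smooth_L2_J: "smooth w \<Longrightarrow> w \<in> L2 J"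
  by (intro continuous_imp_L2_ivl smooth_continuous)

text \<open>The impedance case carries +ik, opposite to the original condition: conjugation in the
  adjoint problem reverses the sign.\<close>

definition end_op :: "real \<Rightarrow> boundary_condition \<Rightarrow> (real \<Rightarrow> complex) \<Rightarrow> complex" where
  "end_op k bc w = (case bc of Dirichlet \<Rightarrow> w 1 | Neumann \<Rightarrow> partial 1 w 1
     | Impedance \<Rightarrow> partial 1 w 1 + \<i> * of_real k * w 1)"

text \<open>For a mode of frequency \<lambda> the parameter is \<mu> = k^2 - \<lambda>^2, of which
  only the upper bound is recorded; it may be negative. The outward normal at 0 points to the left,
  so the adjoint impedance condition there reads w' = ikw.\<close>

locale mode_solution =
  fixes k \<mu> :: real and bc :: boundary_condition and w g :: "real \<Rightarrow> complex"
  assumes k: "k > 0" and \<mu>: "\<mu> \<le> k\<^sup>2" and w: "smooth w" and g: "continuous_on UNIV g"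
    and ode: "\<And>x. partial 1 (partial 1 w) x = - of_real \<mu> * w x - g x"
    and bc0: "partial 1 w 0 = \<i> * of_real k * w 0" and bc1: "end_op k bc w = 0"
begin

abbreviation "w' \<equiv> partial 1 w"
abbreviation "W \<equiv> L2_norm J w"
abbreviation "D \<equiv> L2_norm J w'"
abbreviation "G \<equiv> L2_norm J g"

lemma wL: "w \<in> L2 J" and w'L: "w' \<in> L2 J" and gL: "g \<in> L2 J"
  by (intro smooth_L2_J smooth_partial_1 w continuous_imp_L2_ivl continuous_on_subset[OF g] subset_UNIV)+

lemma w_deriv: "(w has_vector_derivative w' x) (at x)"
  and w'_deriv: "(w' has_vector_derivative (- of_real \<mu> * w x - g x)) (at x)"
  using smooth_has_vector_derivative[OF w] smooth_has_vector_derivative[OF smooth_partial_1[OF w]]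
  by (simp_all add: ode)

lemma continuous_w: "continuous_on A w" "continuous_on A w'" "continuous_on A g"
  by (intro smooth_continuous w smooth_partial_1 continuous_on_subset[OF g] subset_UNIV)+

text \<open>The equation is multiplied by the conjugate of \<open>w\<close> and integrated. The real
  part is used to control \<open>D\<close>, the imaginary part to control the value at 0.\<close>

lemma energy_identity:
  "of_real (D\<^sup>2) - of_real \<mu> * of_real (W\<^sup>2) - (LINT x|MJ. g x * cnj (w x))
    = w' 1 * cnj (w 1) - \<i> * of_real (k * (cmod (w 0))\<^sup>2)"
proof -
  have F: "((\<lambda>x. w' x * cnj (w x)) has_vector_derivative
      w' x * cnj (w' x) - of_real \<mu> * (w x * cnj (w x)) - g x * cnj (w x)) (at x)" for x
    using has_vector_derivative_mult[OF w'_deriv has_vector_derivative_cnj[OF w_deriv], of x]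
    by (simp add: algebra_simps)
  have "(LINT x|MJ. w' x * cnj (w' x) - of_real \<mu> * (w x * cnj (w x)) - g x * cnj (w x)) = w' 1 * cnj (w 1) - w' 0 * cnj (w 0)"
    by (rule integral_J_FTC[OF F])
      (intro continuous_on_diff continuous_on_mult continuous_on_cnj continuous_w continuous_on_const)
  also have "(LINT x|MJ. w' x * cnj (w' x) - of_real \<mu> * (w x * cnj (w x)) - g x * cnj (w x))
    = (LINT x|MJ. w' x * cnj (w' x)) - of_real \<mu> * (LINT x|MJ. w x * cnj (w x)) - (LINT x|MJ. g x * cnj (w x))"
  proof -
    have "integrable MJ (\<lambda>x. w' x * cnj (w' x))" "integrable MJ (\<lambda>x. w x * cnj (w x))"
      "integrable MJ (\<lambda>x. g x * cnj (w x))"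
      by (intro L2_mult_integrable L2_cnj wL w'L gL)+
    then show ?thesis by simp
  qed
  also have "w' 0 * cnj (w 0) = \<i> * of_real (k * (cmod (w 0))\<^sup>2)"
    by (simp add: bc0 mult.assoc flip: complex_norm_square)
  finally show ?thesis by (simp only: L2_norm_sq_cnj)
qed

text \<open>Dirichlet and Neumann conditions make the product zero, the impedance condition makes it
  -ik|w(1)|^2. This sign is the one that lets the term be dropped in
  \<open>impedance_bound\<close>.\<close>

lemma end_value: "Re (w' 1 * cnj (w 1)) = 0 \<and> Im (w' 1 * cnj (w 1)) \<le> 0"
proof (cases bc)
  case Impedance
  then have "w' 1 = - (\<i> * of_real k * w 1)" using bc1 by (simp add: end_op_def add_eq_0_iff2)
  then have "w' 1 * cnj (w 1) = - \<i> * of_real (k * (cmod (w 1))\<^sup>2)"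
    by (simp add: mult.assoc flip: complex_norm_square)
  then show ?thesis using k by simp
qed (use bc1 in \<open>simp_all add: end_op_def\<close>)

lemma CS: "cmod (LINT x|MJ. g x * cnj (w x)) \<le> G * W"
  using L2_Cauchy_Schwarz[OF gL L2_cnj[OF wL]] by (simp add: L2_norm_cnj)

lemma impedance_bound: "k * (cmod (w 0))\<^sup>2 \<le> G * W"
proof -
  have "Im (LINT x|MJ. g x * cnj (w x)) = k * (cmod (w 0))\<^sup>2 - Im (w' 1 * cnj (w 1))"
    using arg_cong[OF energy_identity, of Im] by simp
  then show ?thesis
    using abs_Im_le_cmod[of "LINT x|MJ. g x * cnj (w x)"] CS end_value by linarith
qed

lemma energy_bound: "D\<^sup>2 - \<mu> * W\<^sup>2 \<le> G * W"
proof -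
  have "D\<^sup>2 - \<mu> * W\<^sup>2 = Re (LINT x|MJ. g x * cnj (w x))"
    using arg_cong[OF energy_identity, of Re] end_value by simp
  then show ?thesis
    using complex_Re_le_cmod[of "LINT x|MJ. g x * cnj (w x)"] CS by linarith
qed

text \<open>The multiplier \<open>(1 - x) w'\<close> vanishes at the right end point, whatever the condition there.\<close>

lemma Rellich_bound: "D\<^sup>2 + \<mu> * W\<^sup>2 \<le> 2 * k\<^sup>2 * (cmod (w 0))\<^sup>2 + 2 * G * D"
proof -
  define m :: "real \<Rightarrow> complex" where "m x = of_real (1 - x)" for x
  have mc: "continuous_on A m" for A
    unfolding m_def by (intro continuous_on_of_real continuous_on_diff continuous_on_const continuous_on_id)
  have mm: "m \<in> borel_measurable MJ" by (intro L2_measurable continuous_imp_L2_ivl mc)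
  have mb: "cmod (m x) \<le> 1" if "x \<in> J" for x using that unfolding m_def norm_of_real by auto
  have md: "(m has_vector_derivative - 1) (at x)" for x
  proof -
    have "((\<lambda>x. of_real (1 - x) :: complex) has_vector_derivative of_real (- 1)) (at x)"
      by (intro has_vector_derivative_of_real) (auto intro!: derivative_eq_intros)
    then show ?thesis unfolding m_def[abs_def] by simp
  qed
  \<comment> \<open>The conserved quantity of the homogeneous equation: its derivative contains only
    source terms.\<close>
  let ?E = "\<lambda>x. w' x * cnj (w' x) + of_real \<mu> * (w x * cnj (w x))"
  let ?H = "\<lambda>x. g x * (cnj (w' x) * m x) + cnj (g x) * (w' x * m x)"
  have E: "(?E has_vector_derivative - (g x * cnj (w' x) + cnj (g x) * w' x)) (at x)" for x
    by (rule has_vector_derivative_eq_rhs,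
        rule has_vector_derivative_add[OF has_vector_derivative_mult[OF w'_deriv has_vector_derivative_cnj[OF w'_deriv]]
          has_vector_derivative_mult_right[OF has_vector_derivative_mult[OF w_deriv has_vector_derivative_cnj[OF w_deriv]]]])
      (simp add: algebra_simps)
  have F: "((\<lambda>x. m x * ?E x) has_vector_derivative - ?E x - ?H x) (at x)" for x
    by (rule has_vector_derivative_eq_rhs, rule has_vector_derivative_mult[OF md E]) (simp add: algebra_simps)
  have "(LINT x|MJ. - ?E x - ?H x) = m 1 * ?E 1 - m 0 * ?E 0"
    by (rule integral_J_FTC[OF F])
      (intro continuous_on_diff continuous_on_minus continuous_on_add continuous_on_mult continuous_on_cnj
        continuous_w continuous_on_const mc)
  also have "(LINT x|MJ. - ?E x - ?H x)
    = - ((LINT x|MJ. w' x * cnj (w' x)) + of_real \<mu> * (LINT x|MJ. w x * cnj (w x)))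
      - ((LINT x|MJ. g x * (cnj (w' x) * m x)) + (LINT x|MJ. cnj (g x) * (w' x * m x)))"
  proof -
    have "integrable MJ (\<lambda>x. w' x * cnj (w' x))" "integrable MJ (\<lambda>x. w x * cnj (w x))"
      "integrable MJ (\<lambda>x. g x * (cnj (w' x) * m x))" "integrable MJ (\<lambda>x. cnj (g x) * (w' x * m x))"
      by (intro L2_mult_integrable L2_mult_bounded[OF _ mm mb] L2_cnj wL w'L gL; simp)+
    then show ?thesis by simp
  qed
  \<comment> \<open>The left condition turns |w'(0)|^2 into k^2 |w(0)|^2.\<close>
  also have "m 1 * ?E 1 - m 0 * ?E 0 = - of_real ((k\<^sup>2 + \<mu>) * (cmod (w 0))\<^sup>2)"
    by (simp add: m_def bc0 complex_norm_square[symmetric] algebra_simps power2_eq_square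
        flip: of_real_mult of_real_power)
  finally have *: "- (of_real (D\<^sup>2) + of_real \<mu> * of_real (W\<^sup>2))
      - ((LINT x|MJ. g x * (cnj (w' x) * m x)) + (LINT x|MJ. cnj (g x) * (w' x * m x)))
    = - of_real ((k\<^sup>2 + \<mu>) * (cmod (w 0))\<^sup>2)"
    unfolding L2_norm_sq_cnj .
  have "a = b - c" if "- a - c = - b" for a b c :: complex
    using that by algebra
  from this[OF *] have "of_real (D\<^sup>2 + \<mu> * W\<^sup>2) = of_real ((k\<^sup>2 + \<mu>) * (cmod (w 0))\<^sup>2)
     - ((LINT x|MJ. g x * (cnj (w' x) * m x)) + (LINT x|MJ. cnj (g x) * (w' x * m x)))"
    unfolding of_real_add of_real_mult .
  from arg_cong[OF this, of Re]
  have "D\<^sup>2 + \<mu> * W\<^sup>2 = (k\<^sup>2 + \<mu>) * (cmod (w 0))\<^sup>2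
     - (Re (LINT x|MJ. g x * (cnj (w' x) * m x)) + Re (LINT x|MJ. cnj (g x) * (w' x * m x)))"
    by (simp only: minus_complex.sel plus_complex.sel Re_complex_of_real)
  moreover have "cmod (LINT x|MJ. g x * (cnj (w' x) * m x)) \<le> G * D"
  proof -
    have "cmod (LINT x|MJ. g x * (cnj (w' x) * m x)) \<le> G * L2_norm J (\<lambda>x. cnj (w' x) * m x)"
      by (intro L2_Cauchy_Schwarz gL L2_mult_bounded[OF _ mm mb] L2_cnj w'L) simp_all
    also have "\<dots> \<le> G * L2_norm J (\<lambda>x. cnj (w' x))"
      by (intro mult_left_mono L2_norm_mult_le mm mb L2_cnj w'L) simp_all
    finally show ?thesis by (simp only: L2_norm_cnj)
  qed
  moreover have "cmod (LINT x|MJ. cnj (g x) * (w' x * m x)) \<le> G * D"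
  proof -
    have "cmod (LINT x|MJ. cnj (g x) * (w' x * m x)) \<le> L2_norm J (\<lambda>x. cnj (g x)) * L2_norm J (\<lambda>x. w' x * m x)"
      by (intro L2_Cauchy_Schwarz gL L2_mult_bounded[OF _ mm mb] L2_cnj w'L) simp_all
    also have "\<dots> \<le> L2_norm J (\<lambda>x. cnj (g x)) * D"
      by (intro mult_left_mono L2_norm_mult_le mm mb w'L) simp_all
    finally show ?thesis by (simp only: L2_norm_cnj)
  qed
  moreover have "(k\<^sup>2 + \<mu>) * (cmod (w 0))\<^sup>2 \<le> 2 * k\<^sup>2 * (cmod (w 0))\<^sup>2"
    using \<mu> by (intro mult_right_mono) auto
  ultimately show ?thesis
    using abs_Re_le_cmod[of "LINT x|MJ. g x * (cnj (w' x) * m x)"]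
      abs_Re_le_cmod[of "LINT x|MJ. cnj (g x) * (w' x * m x)"] by linarith
qed

text \<open>Adding \<open>energy_bound\<close> and \<open>Rellich_bound\<close> cancels \<mu>, and
  \<open>impedance_bound\<close> replaces the boundary value.\<close>

lemma derivative_bound: "2 * D\<^sup>2 \<le> 2 * k * (G * W) + 2 * G * D + G * W"
proof -
  have "2 * k\<^sup>2 * (cmod (w 0))\<^sup>2 = 2 * k * (k * (cmod (w 0))\<^sup>2)" by (simp add: power2_eq_square)
  also have "\<dots> \<le> 2 * k * (G * W)" using impedance_bound k by (intro mult_left_mono) auto
  finally show ?thesis using energy_bound Rellich_bound by linarith
qed

text \<open>The integral of |w'| over the whole unit interval is at most its \<open>L2\<close> norm
  by Cauchy-Schwarz.\<close>

lemma oscillation_bound: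
  assumes "0 \<le> a" "a \<le> b" "b \<le> 1" shows "cmod (w b - w a) \<le> D"
proof -
  have n: "(\<lambda>x. cmod (w' x)) integrable_on {c..d}" for c d
    by (intro integrable_continuous_real continuous_on_norm continuous_w)
  have "(w' has_integral (w b - w a)) {a..b}"
    by (rule fundamental_theorem_of_calculus[OF assms(2)]) (rule has_vector_derivative_at_within[OF w_deriv])
  then have "w b - w a = integral {a..b} w'" by (rule integral_unique[symmetric])
  also have "cmod \<dots> \<le> integral {a..b} (\<lambda>x. cmod (w' x))"
    by (intro integral_norm_bound_integral n integrable_continuous_real continuous_w) simp
  also have "\<dots> \<le> integral {0..1} (\<lambda>x. cmod (w' x))"
    by (intro integral_subset_le n) (use assms in auto)
  also have "\<dots> = integral J (\<lambda>x. cmod (w' x))" by (rule integral_open_interval_real)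
  also have "\<dots> = (LINT x|MJ. cmod (w' x))"
    by (rule lebesgue_integral_eq_integral[symmetric])
      (intro integrable_norm continuous_imp_L2_ivl continuous_w, simp)
  also have "\<dots> \<le> D"
  proof -
    have L: "(\<lambda>x. of_real (cmod (w' x))) \<in> L2 J"
      by (intro continuous_imp_L2_ivl continuous_on_of_real continuous_on_norm continuous_w)
    have 1: "(\<lambda>_. 1) \<in> L2 J" by (intro continuous_imp_L2_ivl continuous_on_const)
    have "cmod (LINT x|MJ. of_real (cmod (w' x)) * 1) \<le> L2_norm J (\<lambda>x. of_real (cmod (w' x))) * L2_norm J (\<lambda>_. 1)"
      by (rule L2_Cauchy_Schwarz[OF L 1])
    also have "L2_norm J (\<lambda>x. of_real (cmod (w' x))) = D" by (simp add: L2_norm_def)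
    also have "D * L2_norm J (\<lambda>_. 1) \<le> D" using mult_left_mono[OF L2_norm_1_J, of D] by simp
    finally show ?thesis by (simp add: integral_complex_of_real)
  qed
  finally show ?thesis .
qed

lemma norm_le_sup: "(\<And>x. x \<in> J \<Longrightarrow> cmod (w x) \<le> C) \<Longrightarrow> 0 \<le> C \<Longrightarrow> W \<le> C"
  using L2_norm_le_sup[of J w C] wL by simp

lemma Poincare: "W \<le> cmod (w 0) + D"
proof (rule norm_le_sup)
  fix x :: real assume "x \<in> J"
  then show "cmod (w x) \<le> cmod (w 0) + D"
    using oscillation_bound[of 0 x] norm_triangle_ineq2[of "w x" "w 0"] by simp
qed simp

lemma Poincare_Dirichlet:
  assumes "bc = Dirichlet" shows "W \<le> D"
proof (rule norm_le_sup)
  have "w 1 = 0" using bc1 assms by (simp add: end_op_def)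
  then show "cmod (w x) \<le> D" if "x \<in> J" for x
    using oscillation_bound[of x 1] that by simp
qed simp

text \<open>With W \<le> D, \<open>derivative_bound\<close> becomes 2 D^2 \<le> (2k + 3) G D. Hence
  D \<le> (k + 3/2) G, and k + 3/2 \<le> 5/2 max(k, 1).\<close>

lemma bound_Dirichlet:
  assumes "bc = Dirichlet" shows "W \<le> 5 / 2 * max k 1 * G"
proof -
  have WD: "W \<le> D" by (rule Poincare_Dirichlet[OF assms])
  have "D * D \<le> ((k + 3 / 2) * G) * D"
  proof -
    have "G * W \<le> G * D" "k * (G * W) \<le> k * (G * D)" using WD k by (auto intro!: mult_left_mono)
    then have "2 * D\<^sup>2 \<le> 2 * (k * (G * D)) + 2 * (G * D) + G * D"
      using derivative_bound by linarith
    then show ?thesis by (simp add: power2_eq_square algebra_simps)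
  qed
  then have "D \<le> (k + 3 / 2) * G"
  proof (cases "D = 0")
    case False
    then have "D > 0" using L2_norm_nonneg[of J w'] by linarith
    with \<open>D * D \<le> _\<close> show ?thesis by (rule mult_right_le_imp_le)
  qed (use k in simp)
  also have "\<dots> \<le> 5 / 2 * max k 1 * G" by (intro mult_right_mono) (auto simp: max_def)
  finally show ?thesis using WD by linarith
qed

text \<open>Here W is controlled only by |w(0)| + D. If the bound failed, then G and M G would be at
  most q = W/9; \<open>impedance_bound\<close> would give |w(0)| \<le> 3q and
  \<open>derivative_bound\<close> D \<le> 9q/2, so W \<le> 15q/2, against W = 9q. The 1/k in M pays
  for dividing \<open>impedance_bound\<close> by k.\<close>

lemma bound_general: "W \<le> 9 * max k (1 / k) * G"
proof -
  define M where "M = max k (1 / k)"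
  have M: "M > 0" "k \<le> M" "1 / k \<le> M" using k by (auto simp: M_def max_def)
  have M1: "1 \<le> M"
  proof (cases "k \<ge> 1")
    case False
    then show ?thesis using M(3) k by (smt (verit) less_divide_eq_1_pos)
  qed (use M in auto)
  show ?thesis
  proof (rule ccontr)
    assume "\<not> ?thesis"
    then have less: "9 * M * G < W" by (simp add: M_def)
    have G0: "G \<ge> 0" by simp
    have W0: "W > 0" using less mult_nonneg_nonneg[of "9 * M" G] M by (auto intro: le_less_trans[OF _ less])
    define q where "q = W / 9"
    have GM: "M * G \<le> q" using less by (simp add: q_def)
    have q: "q > 0" using W0 by (simp add: q_def)
    have "G * 1 \<le> G * M" using M1 by (intro mult_left_mono) auto
    then have Gq: "G \<le> q" using GM by (simp add: mult.commute)
    have "(cmod (w 0))\<^sup>2 \<le> (1 / k) * (G * W)"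
      using impedance_bound k by (simp add: field_simps)
    also have "\<dots> \<le> M * (G * W)" using M by (intro mult_right_mono) auto
    also have "\<dots> \<le> q * W" using GM W0 by (simp add: mult.assoc[symmetric])
    also have "\<dots> = (3 * q)\<^sup>2" by (simp add: q_def power2_eq_square)
    finally have w0: "cmod (w 0) \<le> 3 * q" by (rule power2_le_imp_le) (use q in simp)
    have "k * (G * W) \<le> M * (G * W)" using M W0 by (intro mult_right_mono) auto
    also have "\<dots> \<le> q * W" using GM W0 by (simp add: mult.assoc[symmetric])
    finally have 1: "k * (G * W) \<le> 9 * q * q" by (simp add: q_def)
    have 2: "G * W \<le> q * W" using Gq W0 by (intro mult_right_mono) auto
    have 3: "G * D \<le> q * D" using Gq by (intro mult_right_mono) auto
    have "2 * D\<^sup>2 \<le> 18 * q * q + 2 * (q * D) + 9 * q * q"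
      using derivative_bound 1 2 3 by (simp add: q_def)
    then have "D\<^sup>2 - q * D \<le> 27 / 2 * (q * q)" by simp
    \<comment> \<open>Completing the square in \<open>D\<close> leaves 27/2 + 1/4 on the right,
      which is rounded up to 16, a square.\<close>
    moreover have "(x - q / 2)\<^sup>2 = x\<^sup>2 - q * x + 1 / 4 * (q * q)" for x
      by (simp add: power2_eq_square field_simps)
    note this[of D]
    moreover have "(4 * q)\<^sup>2 = 16 * (q * q)" by (simp add: power2_eq_square)
    moreover have "0 \<le> q * q" by simp
    ultimately have "(D - q / 2)\<^sup>2 \<le> (4 * q)\<^sup>2" by linarith
    then have "D - q / 2 \<le> 4 * q" by (rule power2_le_imp_le) (use q in simp)
    then have "W \<le> 3 * q + (q / 2 + 4 * q)" using Poincare w0 by linarith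
    then show False using q by (simp add: q_def)
  qed
qed

end

section \<open>Explicit solutions of the coefficient equation\<close>

lemma poly_antiderivative: "\<exists>q. pderiv q = (p :: complex poly)"
proof
  have pderiv_sum: "pderiv (sum f A) = (\<Sum>i\<in>A. pderiv (f i))" for f :: "nat \<Rightarrow> complex poly" and A
    by (induction A rule: infinite_finite_induct) (auto simp: pderiv_add)
  show "pderiv (\<Sum>i\<le>degree p. monom (coeff p i / of_nat (Suc i)) (Suc i)) = p"
    by (simp add: pderiv_sum pderiv_monom poly_as_sum_of_monoms del: of_nat_Suc)
qed

text \<open>For \<mu> \<noteq> 0 the guess -p/\<mu> leaves a multiple of p'' as remainder, of
  smaller degree, and induction on the degree corrects it. For \<mu> = 0 two antiderivatives
  suffice.\<close>

lemma poly_ode_solution: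
  fixes \<mu> :: complex
  shows "\<exists>q. pderiv (pderiv q) = - smult \<mu> q - p"
proof (cases "\<mu> = 0")
  case True
  obtain q1 where "pderiv q1 = - p" using poly_antiderivative by blast
  moreover obtain q where "pderiv q = q1" using poly_antiderivative by blast
  ultimately show ?thesis using True by (intro exI[of _ q]) simp
next
  case False
  show ?thesis
  proof (induction "degree p" arbitrary: p rule: less_induct)
    case less
    define p' where "p' = smult (- (1 / \<mu>)) (pderiv (pderiv p))"
    have "\<exists>r. pderiv (pderiv r) = - smult \<mu> r - p'"
    \<comment> \<open>A constant cannot lose degree, but then the remainder is zero.\<close>
    proof (cases "degree p = 0")
      case True
      then have "p' = 0" by (auto simp: p'_def elim!: degree_eq_zeroE)
      then show ?thesis by (intro exI[of _ 0]) simp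
    next
      case False
      then have "degree p' < degree p" using \<open>\<mu> \<noteq> 0\<close> by (simp add: p'_def degree_pderiv)
      then show ?thesis by (rule less)
    qed
    then obtain r where r: "pderiv (pderiv r) = - smult \<mu> r - p'" ..
    have "pderiv (pderiv (smult (- (1 / \<mu>)) p + r)) = - smult \<mu> (smult (- (1 / \<mu>)) p + r) - p"
      using \<open>\<mu> \<noteq> 0\<close> by (simp add: pderiv_add pderiv_diff pderiv_minus pderiv_smult r p'_def smult_add_right smult_diff_right)
    then show ?case ..
  qed
qed

lemma partial_poly: "partial 1 (\<lambda>x. poly p (of_real x)) = (\<lambda>x. poly (pderiv p) (of_real x :: complex))"
  by (rule ext) (rule partial_1_eqI[OF poly_of_real_has_vector_derivative])

lemma exp_has_vector_derivative:
  fixes a c :: complex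
  shows "((\<lambda>x. a * exp (c * of_real x)) has_vector_derivative a * c * exp (c * of_real x)) (at x)"
  by (rule has_vector_derivative_real_field[where f = "\<lambda>z. a * exp (c * z)"]) (auto intro!: derivative_eq_intros)

lemma smooth_exp: "smooth (\<lambda>x::real. a * exp (c * of_real x))"
proof (rule smooth_realI[where S = "range (\<lambda>a x. a * exp (c * of_real x))"])
  fix f :: "real \<Rightarrow> complex" assume "f \<in> range (\<lambda>a x. a * exp (c * of_real x))"
  then obtain a where f: "f = (\<lambda>x. a * exp (c * of_real x))" by auto
  show "\<exists>f'\<in>range (\<lambda>a x. a * exp (c * of_real x)). \<forall>x. (f has_vector_derivative f' x) (at x)"
    unfolding f by (intro bexI[of _ "\<lambda>x. a * c * exp (c * of_real x)"] allI exp_has_vector_derivative rangeI)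
qed auto

lemma partial_exp: "partial 1 (\<lambda>x. a * exp (c * of_real x)) = (\<lambda>x. a * c * exp (c * of_real x))"
  by (rule ext) (rule partial_1_eqI[OF exp_has_vector_derivative])

lemma partial_1_add:
  "smooth f \<Longrightarrow> smooth g \<Longrightarrow> partial b (\<lambda>x. f x + g x) = (\<lambda>x. partial b f x + partial b g x)"
  by (intro partial_add smooth_differentiable)

lemma partial_const_mult:
  assumes "smooth f" shows "partial b (\<lambda>x. c * f x) = (\<lambda>x. c * partial b f x)"
proof -
  have "partial b (\<lambda>x. c) = (\<lambda>x. 0)" by (rule ext) (rule partial_eqI[OF has_derivative_const])
  then show ?thesis by (simp add: partial_mult smooth_differentiable smooth_const assms)
qed

text \<open>With c a square root of -\<mu>, the exponentials of cx and -cx cover the oscillating and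
  the decaying case together; for \<mu> = 0 they coincide, and the solution is affine.\<close>

lemma homogeneous_solution:
  fixes \<mu> \<alpha> \<beta> :: complex
  obtains y where "smooth y" "partial 1 (partial 1 y) = (\<lambda>x. - \<mu> * y x)" "y (0::real) = \<alpha>" "partial 1 y 0 = \<beta>"
proof (cases "\<mu> = 0")
  case True
  have "smooth (\<lambda>x::real. poly [:\<alpha>, \<beta>:] (of_real x))" by (rule smooth_poly)
  then show thesis
    by (rule that[of "\<lambda>x. poly [:\<alpha>, \<beta>:] (of_real x)"]) (simp_all only: partial_poly, simp_all add: True pderiv_pCons)
next
  case False
  define c where "c = csqrt (- \<mu>)"
  have c: "c * c = - \<mu>" using power2_csqrt[of "- \<mu>"] by (simp add: c_def power2_eq_square)
  then have c0: "c \<noteq> 0" using False by auto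
  define a b where "a = (\<alpha> + \<beta> / c) / 2" and "b = (\<alpha> - \<beta> / c) / 2"
  let ?y = "\<lambda>x::real. a * exp (c * of_real x) + b * exp ((- c) * of_real x)"
  have p1: "partial 1 ?y = (\<lambda>x. a * c * exp (c * of_real x) + b * (- c) * exp ((- c) * of_real x))"
    unfolding partial_1_add[OF smooth_exp smooth_exp] partial_exp ..
  have p2: "partial 1 (partial 1 ?y) = (\<lambda>x. a * c * c * exp (c * of_real x) + b * (- c) * (- c) * exp ((- c) * of_real x))"
    unfolding p1 partial_1_add[OF smooth_exp smooth_exp] partial_exp ..
  show thesis
  proof (rule that[of ?y])
    show "smooth ?y" by (intro smooth_add smooth_exp)
    show "partial 1 (partial 1 ?y) = (\<lambda>x. - \<mu> * ?y x)"
      unfolding p2 c[symmetric] by (rule ext) (simp add: algebra_simps)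
    show "?y 0 = \<alpha>" by (simp add: a_def b_def field_simps)
    show "partial 1 ?y 0 = \<beta>" unfolding p1 using c0 by (simp add: a_def b_def field_simps)
  qed
qed

lemma end_op_add:
  "smooth v \<Longrightarrow> smooth w \<Longrightarrow> end_op k bc (\<lambda>x. v x + w x) = end_op k bc v + end_op k bc w"
  by (cases bc) (simp_all add: end_op_def partial_1_add algebra_simps)

lemma end_op_mult: "smooth w \<Longrightarrow> end_op k bc (\<lambda>x. c * w x) = c * end_op k bc w"
  by (cases bc) (simp_all add: end_op_def partial_const_mult algebra_simps)

text \<open>A particular solution meeting the left condition is corrected by a multiple of the
  homogeneous solution \<open>y\<close>, which meets it too. This succeeds unless \<open>y\<close>
  also meets the right condition; but then \<open>y\<close> would solve the problem with zero
  source, and \<open>impedance_bound\<close> would force y(0) = 0 against y(0) = 1.\<close>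

lemma mode_solution_exists:
  fixes p :: "complex poly"
  assumes k: "k > 0" and \<mu>: "\<mu> \<le> k\<^sup>2"
  obtains w where "mode_solution k \<mu> bc w (\<lambda>x. poly p (of_real x))"
proof -
  let ?\<mu> = "of_real \<mu> :: complex"
  obtain q where q: "pderiv (pderiv q) = - smult ?\<mu> q - p" using poly_ode_solution by blast
  let ?q = "\<lambda>x::real. poly q (of_real x)"
  obtain y where y: "smooth y" "partial 1 (partial 1 y) = (\<lambda>x. - ?\<mu> * y x)" "y (0::real) = 1" "partial 1 y 0 = \<i> * of_real k"
    using homogeneous_solution .
  obtain s where s: "smooth s" "partial 1 (partial 1 s) = (\<lambda>x. - ?\<mu> * s x)" "s (0::real) = 0" "partial 1 s 0 = 1"
    using homogeneous_solution .
  have E: "end_op k bc y \<noteq> 0"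
  proof
    assume "end_op k bc y = 0"
    then interpret mode_solution k \<mu> bc y "\<lambda>x. 0"
      using k \<mu> y by unfold_locales auto
    have "L2_norm J (\<lambda>x. 0) = 0" by (simp add: L2_norm_def)
    then show False using impedance_bound k y(3) by simp
  qed
  \<comment> \<open>Since s(0) = 0 and s'(0) = 1, this is exactly the defect of the polynomial
    solution in the left condition.\<close>
  define b where "b = \<i> * of_real k * poly q 0 - poly (pderiv q) 0"
  define v where "v = (\<lambda>x. ?q x + b * s x)"
  have bs: "smooth (\<lambda>x. b * s x)" by (intro smooth_mult smooth_const s)
  have v: "smooth v" unfolding v_def by (intro smooth_add smooth_poly bs)
  have v': "partial 1 v = (\<lambda>x. poly (pderiv q) (of_real x) + b * partial 1 s x)"
    unfolding v_def partial_1_add[OF smooth_poly bs] partial_poly partial_const_mult[OF s(1)] ..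
  have bs': "smooth (\<lambda>x. b * partial 1 s x)" by (intro smooth_mult smooth_const smooth_partial_1 s)
  have "partial 1 (partial 1 v) = (\<lambda>x. poly (- smult ?\<mu> q - p) (of_real x) + b * (- ?\<mu> * s x))"
    unfolding v' partial_1_add[OF smooth_poly bs'] partial_poly partial_const_mult[OF smooth_partial_1[OF s(1)]] q s(2) ..
  then have v'': "partial 1 (partial 1 v) = (\<lambda>x. - ?\<mu> * v x - poly p (of_real x))"
    by (simp add: v_def algebra_simps)
  have v0: "partial 1 v 0 = \<i> * of_real k * v 0"
    unfolding v' by (simp add: v_def s b_def)
  define a where "a = - end_op k bc v / end_op k bc y"
  define w where "w = (\<lambda>x. v x + a * y x)"
  have ay: "smooth (\<lambda>x. a * y x)" by (intro smooth_mult smooth_const y)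
  have ay': "smooth (\<lambda>x. a * partial 1 y x)" by (intro smooth_mult smooth_const smooth_partial_1 y)
  have w': "partial 1 w = (\<lambda>x. partial 1 v x + a * partial 1 y x)"
    unfolding w_def partial_1_add[OF v ay] partial_const_mult[OF y(1)] ..
  show thesis
  proof (rule that[of w], unfold_locales)
    show "smooth w" unfolding w_def by (intro smooth_add v ay)
    show "continuous_on UNIV (\<lambda>x::real. poly p (of_real x))" by (rule smooth_continuous[OF smooth_poly])
    show "partial 1 (partial 1 w) x = - ?\<mu> * w x - poly p (of_real x)" for x
      unfolding w' partial_1_add[OF smooth_partial_1[OF v] ay'] v'' partial_const_mult[OF smooth_partial_1[OF y(1)]] y(2)
      by (simp add: w_def algebra_simps)
    show "partial 1 w 0 = \<i> * of_real k * w 0"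
      unfolding w' v0 y by (simp add: w_def y algebra_simps)
    show "end_op k bc w = 0"
    proof -
      have "end_op k bc w = end_op k bc v + a * end_op k bc y"
        unfolding w_def end_op_add[OF v ay] end_op_mult[OF y(1)] ..
      then show ?thesis using E by (simp add: a_def)
    qed
  qed (rule k, rule \<mu>)
qed

section \<open>Duality\<close>

lemma C_diff_cnj: "C_diff n f \<Longrightarrow> C_diff n (\<lambda>x. cnj (f x))"
  and partial_cnj: "f differentiable_on UNIV \<Longrightarrow> partial b (\<lambda>x. cnj (f x)) = (\<lambda>x. cnj (partial b f x))"
proof -
  have D: "((\<lambda>x. cnj (f x)) has_derivative (\<lambda>b. cnj (partial b f x))) (at x)" if "f differentiable_on UNIV"
    for f :: "'a::euclidean_space \<Rightarrow> complex" and x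
    by (rule has_derivative_cnj[OF partial_has_derivative[OF that]])
  have p: "partial b (\<lambda>x. cnj (f x)) = (\<lambda>x. cnj (partial b f x))" if "f differentiable_on UNIV"
    for f :: "'a::euclidean_space \<Rightarrow> complex" and b
    by (rule ext) (rule partial_eqI[OF D[OF that]])
  have d: "(\<lambda>x. cnj (f x)) differentiable_on UNIV" if "f differentiable_on UNIV" for f :: "'a::euclidean_space \<Rightarrow> complex"
    unfolding differentiable_on_def using differentiableI[OF D[OF that]] by blast
  show "C_diff n f \<Longrightarrow> C_diff n (\<lambda>x. cnj (f x))" for f :: "'a::euclidean_space \<Rightarrow> complex"
  proof (induction n arbitrary: f)
    case 0
    then show ?case by (simp add: continuous_on_cnj)
  next
    case (Suc n)
    then show ?case by (simp add: p d)
  qed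
  show "partial b (\<lambda>x. cnj (f x)) = (\<lambda>x. cnj (partial b f x))" if "f differentiable_on UNIV" for f :: "'a::euclidean_space \<Rightarrow> complex"
    by (rule p[OF that])
qed

lemma smooth_cnj: "smooth f \<Longrightarrow> smooth (\<lambda>x. cnj (f x))"
  by (simp add: smooth_def C_diff_cnj)

definition tns :: "(real \<Rightarrow> complex) \<Rightarrow> (real \<Rightarrow> complex) \<Rightarrow> real \<times> real \<Rightarrow> complex" where
  "tns f g z = f (fst z) * g (snd z)"

lemma tns_sc_tc: "tns f g = (\<lambda>z. f (sc True z) * g (tc True z))" "tns f g = (\<lambda>z. g (sc False z) * f (tc False z))"
  by (auto simp: tns_def fun_eq_iff sc_def tc_def)

lemma smooth_tns: "smooth f \<Longrightarrow> smooth g \<Longrightarrow> smooth (tns f g)"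
  unfolding tns_sc_tc(1) by (intro smooth_mult smooth_sc smooth_tc)

lemma partial_tns:
  assumes "smooth f" "smooth g"
  shows "pd True (tns f g) = tns (partial 1 f) g" "pd False (tns f g) = tns f (partial 1 g)"
proof -
  show "pd True (tns f g) = tns (partial 1 f) g"
    unfolding tns_sc_tc(1) by (rule partial_tensor[OF assms])
  show "pd False (tns f g) = tns f (partial 1 g)"
    unfolding tns_sc_tc(2) by (rule partial_tensor[OF assms(2,1)])
qed

text \<open>Orthogonality in the second variable alone removes the mixed terms. The modes are not
  normalised; their norms act as weights, the same ones for the adjoint solution and its source, so
  bounds on the coefficients carry over.\<close>

lemma tensor_sum_norm:
  assumes N: "finite N" and a: "\<And>n. continuous_on UNIV (a n)"
  shows "(L2_norm Q (\<lambda>z. \<Sum>n\<in>N. tns (a n) (cmode d e n) z))\<^sup>2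
    = (\<Sum>n\<in>N. (L2_norm J (a n))\<^sup>2 * (L2_norm J (cmode d e n))\<^sup>2)"
proof -
  let ?I = "\<lambda>n m. LINT x|MJ. a n x * cnj (a m x)"
    and ?K = "\<lambda>n m. LINT t|MJ. cmode d e n t * cmode d e m t"
    and ?F = "\<lambda>n m x. a n x * cnj (a m x)" and ?G = "\<lambda>n m t. cmode d e n t * cmode d e m t"
  have F: "continuous_on UNIV (?F n m)" and G: "continuous_on UNIV (?G n m)" for n m
    by (intro continuous_on_mult continuous_on_cnj a continuous_cmode)+
  have tc: "continuous_on UNIV (tns (?F n m) (?G n m))" for n m
    unfolding tns_def[abs_def]
    by (intro continuous_on_mult continuous_on_compose2[OF F] continuous_on_compose2[OF G]
        continuous_on_fst continuous_on_snd continuous_on_id) auto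
  have i: "integrable MQ (tns (?F n m) (?G n m))" for n m
    by (intro continuous_imp_L2_square continuous_on_subset[OF tc] subset_UNIV)
  have int: "integral\<^sup>L MQ (tns (?F n m) (?G n m)) = ?I n m * ?K n m" for n m
    unfolding tns_def[abs_def] by (rule integral_square_tensor[OF F G])
  have "of_real ((L2_norm Q (\<lambda>z. \<Sum>n\<in>N. tns (a n) (cmode d e n) z))\<^sup>2)
    = (LINT z|MQ. (\<Sum>n\<in>N. \<Sum>m\<in>N. tns (?F n m) (?G n m) z))"
    unfolding L2_norm_sq_cnj
    by (intro Bochner_Integration.integral_cong refl) (simp add: tns_def sum_product mult_ac)
  also have "\<dots> = (\<Sum>n\<in>N. \<Sum>m\<in>N. integral\<^sup>L MQ (tns (?F n m) (?G n m)))"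
    using i by simp
  also have "\<dots> = (\<Sum>n\<in>N. \<Sum>m\<in>N. if m = n then ?I n n * ?K n n else 0)"
    unfolding int using mode_orthogonal by (intro sum.cong) auto
  also have "\<dots> = (\<Sum>n\<in>N. ?I n n * ?K n n)" using N by simp
  also have "\<dots> = (\<Sum>n\<in>N. of_real ((L2_norm J (a n))\<^sup>2) * of_real ((L2_norm J (cmode d e n))\<^sup>2))"
    unfolding L2_norm_sq_cnj by simp
  also have "\<dots> = of_real (\<Sum>n\<in>N. (L2_norm J (a n))\<^sup>2 * (L2_norm J (cmode d e n))\<^sup>2)" by simp
  finally show ?thesis unfolding of_real_eq_iff .
qed

lemma sd_simps: "sd True True = Side2" "sd True False = Side4" "sd False True = Side3" "sd False False = Side1"
  by (simp_all add: sd_def)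

lemma sum_Impedance_sides:
  fixes X :: "side \<Rightarrow> complex"
  assumes "B Side1 \<noteq> Impedance" "B Side3 \<noteq> Impedance" "B Side4 = Impedance"
  shows "(\<Sum>j | B j = Impedance. X j) = (if B Side2 = Impedance then X Side2 else 0) + X Side4"
proof -
  have "{j. B j = Impedance} = (if B Side2 = Impedance then {Side2, Side4} else {Side4})"
  proof (rule set_eqI)
    show "j \<in> {j. B j = Impedance} \<longleftrightarrow> j \<in> (if B Side2 = Impedance then {Side2, Side4} else {Side4})" for j
      using assms by (cases j) simp_all
  qed
  then show ?thesis by simp
qed

lemma weak_solution_H1: "weak_solution B k f u \<Longrightarrow> u \<in> H1 Q"
  by (simp add: weak_solution_def energy_space_def)

text \<open>Testing with a smooth \<open>v\<close> and integrating by parts moves the Helmholtz operator to \<open>v\<close>; the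
  boundary conditions on \<open>v\<close> are those of the adjoint problem.\<close>

lemma weak_solution_adjoint:
  assumes f: "f \<in> L2 Q"
    and B: "B Side1 \<noteq> Impedance" "B Side3 \<noteq> Impedance" "B Side4 = Impedance"
    and sol: "weak_solution B k f u" and v: "smooth v"
    and D: "\<And>j t. B j = Dirichlet \<Longrightarrow> v (side_point j t) = 0"
    and N: "\<And>h p t. B (sd h p) = Neumann \<Longrightarrow> pd h v (side_point (sd h p) t) = 0"
    and R4: "\<And>t. pd True v (side_point Side4 t) = \<i> * of_real k * v (side_point Side4 t)"
    and R2: "\<And>t. B Side2 = Impedance \<Longrightarrow> pd True v (side_point Side2 t) = - \<i> * of_real k * v (side_point Side2 t)"
  shows "(LINT z|MQ. u z * cnj (- pd True (pd True v) z
      - pd False (pd False v) z - of_real (k\<^sup>2) * v z)) = (LINT z|MQ. f z * cnj (v z))"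
proof -
  note u = weak_solution_H1[OF sol]
  note uL = H1_L2[OF u] and gL = weak_partial_L2[OF u dir_Basis]
  let ?v = "\<lambda>h. pd h v" and ?vv = "\<lambda>h. pd h (pd h v)"
  have vE: "v \<in> energy_space B"
    unfolding energy_space_def mem_Collect_eq
  proof (intro conjI allI impI smooth_H1[OF v])
    fix j assume "B j = Dirichlet"
    then show "AE t in MJ. trace j v t = 0"
      using trace_smooth[OF v, of j] D[of j] by simp
  qed
  have tL: "trace j w \<in> L2 J" if "w \<in> H1 Q" for j w
    using trace_L2[OF that] by (cases j) (metis sd_simps)+
  have uD: "AE t in MJ. trace j u t = 0" if "B j = Dirichlet" for j
    using sol that by (simp add: weak_solution_def energy_space_def)
  have cL: "(\<lambda>z. cnj (w z)) \<in> L2 Q" if "smooth w" for w by (intro smooth_L2 smooth_cnj that)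
  define X where "X j = (LINT t|MJ. trace j u t * cnj (v (side_point j t)))" for j
  have X: "(LINT t|MJ. trace j u t * cnj (trace j v t)) = X j" for j
    unfolding X_def
  proof (rule integral_cong_AE)
    show "AE t in MJ. trace j u t * cnj (trace j v t) = trace j u t * cnj (v (side_point j t))"
      using trace_smooth[OF v, of j] by eventually_elim simp
  qed (intro borel_measurable_integrable L2_mult_integrable L2_cnj tL u smooth_H1 v smooth_side_L2)+
  define Y where "Y h p = (LINT t|MJ. trace (sd h p) u t * cnj (?v h (side_point (sd h p) t)))" for h p
  \<comment> \<open>Off the impedance sides the boundary term vanishes for one of two reasons: a
    Dirichlet condition kills the trace of \<open>u\<close>, a Neumann condition the normal
    derivative of \<open>v\<close>.\<close>
  have Y0: "Y h p = 0" if "B (sd h p) \<noteq> Impedance" for h p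
  proof (cases "B (sd h p)")
    case Dirichlet
    have "Y h p = (LINT t|MJ. 0)"
      unfolding Y_def
    proof (rule integral_cong_AE)
      show "AE t in MJ. trace (sd h p) u t * cnj (?v h (side_point (sd h p) t)) = 0"
        using uD[OF Dirichlet] by eventually_elim simp
    qed (intro borel_measurable_integrable L2_mult_integrable L2_cnj tL u smooth_partial_dir v smooth_side_L2, simp)
    then show ?thesis by simp
  next
    case Neumann
    then show ?thesis unfolding Y_def by (simp add: N)
  qed (use that in simp)
  have Y4: "Y True False = - \<i> * of_real k * X Side4"
    unfolding Y_def X_def sd_simps R4 by (simp add: mult.left_commute[of "trace _ _ _"])
  have Y2: "Y True True = (if B Side2 = Impedance then \<i> * of_real k * X Side2 else 0)"
  proof (cases "B Side2 = Impedance")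
    case True
    then show ?thesis unfolding Y_def X_def sd_simps R2[OF True] by (simp add: mult.left_commute[of "trace _ _ _"])
  next
    case False
    then show ?thesis using Y0[of True True] by (simp add: sd_simps)
  qed
  have green: "(LINT z|MQ. wpd h u z * cnj (?v h z))
    = - (LINT z|MQ. u z * cnj (?vv h z)) + Y h True - Y h False" for h
    using H1_Green[OF u smooth_cnj[OF smooth_partial_dir[OF v]], of h h]
    unfolding Y_def partial_cnj[OF smooth_differentiable[OF smooth_partial_dir[OF v]]] side_point_sd
    by (simp add: eq_diff_eq add_eq_0_iff2 algebra_simps)
  have w: "(LINT x|MQ. (\<Sum>b\<in>Basis. weak_partial Q b u x * cnj (weak_partial Q b v x)) - of_real (k\<^sup>2) * u x * cnj (v x))
      - \<i> * of_real k * (\<Sum>j | B j = Impedance. LINT t|MJ. trace j u t * cnj (trace j v t))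
    = (LINT x|MQ. f x * cnj (v x))"
    using sol vE unfolding weak_solution_def by blast
  have iu: "integrable MQ (\<lambda>z. u z * cnj (w z))" if "smooth w" for w
    by (intro L2_mult_integrable uL cL that)
  have ig: "integrable MQ (\<lambda>z. wpd h u z * cnj (w z))" if "smooth w" for w h
    by (intro L2_mult_integrable gL cL that)
  have "(LINT x|MQ. (\<Sum>b\<in>Basis. weak_partial Q b u x * cnj (weak_partial Q b v x)) - of_real (k\<^sup>2) * u x * cnj (v x))
    = (LINT z|MQ. wpd True u z * cnj (?v True z) + wpd False u z * cnj (?v False z)
        - of_real (k\<^sup>2) * (u z * cnj (v z)))"
  proof (rule integral_cong_AE)
    have m: "(\<lambda>z. wpd h u z * cnj (wpd h v z)) \<in> borel_measurable MQ" for h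
      by (intro borel_measurable_integrable L2_mult_integrable gL L2_cnj weak_partial_L2[OF smooth_H1[OF v] dir_Basis])
    have m2: "(\<lambda>z. u z * cnj (v z)) \<in> borel_measurable MQ"
      by (intro borel_measurable_integrable iu v)
    show "(\<lambda>x. (\<Sum>b\<in>Basis. weak_partial Q b u x * cnj (weak_partial Q b v x)) - of_real (k\<^sup>2) * u x * cnj (v x)) \<in> borel_measurable MQ"
      using m[of True] m[of False] m2 by (simp add: Basis_dir dir_neq mult.assoc)
    show "(\<lambda>z. wpd True u z * cnj (?v True z) + wpd False u z * cnj (?v False z)
        - of_real (k\<^sup>2) * (u z * cnj (v z))) \<in> borel_measurable MQ"
      using borel_measurable_integrable[OF ig[OF smooth_partial_dir[OF v]], of True True]
        borel_measurable_integrable[OF ig[OF smooth_partial_dir[OF v]], of False False] m2 by simp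
    show "AE x in MQ. (\<Sum>b\<in>Basis. weak_partial Q b u x * cnj (weak_partial Q b v x)) - of_real (k\<^sup>2) * u x * cnj (v x)
      = wpd True u x * cnj (?v True x) + wpd False u x * cnj (?v False x)
        - of_real (k\<^sup>2) * (u x * cnj (v x))"
      using smooth_weak_partial_AE[OF v, of True] smooth_weak_partial_AE[OF v, of False]
      by eventually_elim (simp add: Basis_dir dir_neq mult.assoc)
  qed
  also have "\<dots> = (LINT z|MQ. wpd True u z * cnj (?v True z))
      + (LINT z|MQ. wpd False u z * cnj (?v False z)) - of_real (k\<^sup>2) * (LINT z|MQ. u z * cnj (v z))"
    using ig[OF smooth_partial_dir[OF v]] iu[OF v] by simp
  also have "\<dots> = - (LINT z|MQ. u z * cnj (?vv True z)) - (LINT z|MQ. u z * cnj (?vv False z))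
      - of_real (k\<^sup>2) * (LINT z|MQ. u z * cnj (v z)) + (Y True True - Y True False)"
    unfolding green using Y0[of False True] Y0[of False False] B by (simp add: sd_simps)
  also have "- (LINT z|MQ. u z * cnj (?vv True z)) - (LINT z|MQ. u z * cnj (?vv False z))
      - of_real (k\<^sup>2) * (LINT z|MQ. u z * cnj (v z))
    = (LINT z|MQ. - (u z * cnj (?vv True z)) - u z * cnj (?vv False z) - of_real (k\<^sup>2) * (u z * cnj (v z)))"
    using iu[OF smooth_partial_dir[OF smooth_partial_dir[OF v]]] iu[OF v] by simp
  also have "\<dots> = (LINT z|MQ. u z * cnj (- ?vv True z - ?vv False z - of_real (k\<^sup>2) * v z))"
    by (intro Bochner_Integration.integral_cong refl) (simp add: algebra_simps)
  \<comment> \<open>The terms ik X left over from Green's formula are those subtracted in the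
    variational equation, and cancel.\<close>
  finally show ?thesis
    using w unfolding X sum_Impedance_sides[OF B] Y4 Y2 by (simp split: if_splits add: algebra_simps)
qed

lemma partial_tns_sum:
  assumes "\<And>n. smooth (a n)" "\<And>n. smooth (b n)"
  shows "pd True (\<lambda>z. \<Sum>n\<in>N. tns (a n) (b n) z) = (\<lambda>z. \<Sum>n\<in>N. tns (partial 1 (a n)) (b n) z)"
    and "pd False (\<lambda>z. \<Sum>n\<in>N. tns (a n) (b n) z) = (\<lambda>z. \<Sum>n\<in>N. tns (a n) (partial 1 (b n)) z)"
  using partial_sum[of N "\<lambda>n. tns (a n) (b n)"] by (simp_all add: smooth_tns partial_tns assms)

text \<open>The adjoint solution has the coefficients \<open>w n\<close> for the sources
  \<open>p n\<close>. The hypothesis on \<open>C\<close> ranges over all values of \<mu>, so that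
  one constant serves every mode and orthogonality transfers it to the whole sum.\<close>

lemma weak_solution_duality:
  fixes p :: "nat \<Rightarrow> complex poly"
  assumes k: "k > 0" and f: "f \<in> L2 Q"
    and B: "B Side1 \<in> {Dirichlet, Neumann}" "B Side3 \<in> {Dirichlet, Neumann}" "B Side4 = Impedance"
    and sol: "weak_solution B k f u" and N: "finite N" and C0: "0 \<le> C"
    and C: "\<And>\<mu> w g. mode_solution k \<mu> (B Side2) w g \<Longrightarrow> L2_norm J w \<le> C * L2_norm J g"
    and d: "d = (B Side1 = Dirichlet)" and e: "e = (B Side3 = Dirichlet)"
    and g: "g = (\<lambda>z. \<Sum>n\<in>N. tns (\<lambda>x. poly (p n) (of_real x)) (cmode d e n) z)"
  shows "cmod (LINT z|MQ. u z * cnj (g z)) \<le> C * L2_norm Q f * L2_norm Q g"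
proof -
  define \<mu> where "\<mu> n = k\<^sup>2 - (freq d e n)\<^sup>2" for n
  have "\<exists>w. mode_solution k (\<mu> n) (B Side2) w (\<lambda>x. poly (p n) (of_real x))" for n
  proof (rule mode_solution_exists[OF k])
    show "\<mu> n \<le> k\<^sup>2" by (simp add: \<mu>_def)
  qed (rule exI)
  from choice[OF allI[OF this]] obtain w where
    w: "\<forall>n. mode_solution k (\<mu> n) (B Side2) (w n) (\<lambda>x. poly (p n) (of_real x))" ..
  note sm = mode_solution.w[OF w[THEN spec]] and ode = mode_solution.ode[OF w[THEN spec]]
    and w0 = mode_solution.bc0[OF w[THEN spec]] and w1 = mode_solution.bc1[OF w[THEN spec]]
  note sm' = smooth_partial_1[OF sm] and s\<phi> = smooth_cmode[of d e] and s\<phi>' = smooth_partial_1[OF smooth_cmode[of d e]]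
  define v where "v = (\<lambda>z. \<Sum>n\<in>N. tns (w n) (cmode d e n) z)"
  have v: "smooth v" unfolding v_def by (intro smooth_sum smooth_tns sm s\<phi>)
  have vx: "pd True v = (\<lambda>z. \<Sum>n\<in>N. tns (partial 1 (w n)) (cmode d e n) z)"
    unfolding v_def by (rule partial_tns_sum[OF sm s\<phi>])
  have vy: "pd False v = (\<lambda>z. \<Sum>n\<in>N. tns (w n) (\<lambda>t. of_real (dmode d e n t)) z)"
    unfolding v_def partial_cmode[symmetric] by (rule partial_tns_sum[OF sm s\<phi>])
  have vxx: "pd True (pd True v) = (\<lambda>z. \<Sum>n\<in>N. tns (partial 1 (partial 1 (w n))) (cmode d e n) z)"
    unfolding vx by (rule partial_tns_sum[OF sm' s\<phi>])
  have vyy: "pd False (pd False v)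
      = (\<lambda>z. \<Sum>n\<in>N. tns (w n) (\<lambda>t. - of_real ((freq d e n)\<^sup>2) * cmode d e n t) z)"
    unfolding vy partial_dmode[symmetric] by (rule partial_tns_sum[OF sm s\<phi>'[unfolded partial_cmode]])
  \<comment> \<open>The second derivative of a mode brings the factor -\<lambda>^2, so the
    coefficients on the left are -w'' - \<mu> w, that is, the sources.\<close>
  have g_eq: "- pd True (pd True v) z - pd False (pd False v) z
      - of_real (k\<^sup>2) * v z = g z" for z
    unfolding vxx vyy unfolding v_def g tns_def ode sum_negf[symmetric] sum_distrib_left sum_subtractf[symmetric]
    by (intro sum.cong refl) (simp add: \<mu>_def algebra_simps)
  have "(LINT z|MQ. u z * cnj (g z)) = (LINT z|MQ. f z * cnj (v z))"
    unfolding g_eq[symmetric]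
  proof (rule weak_solution_adjoint[OF f _ _ B(3) sol v])
    show "B Side1 \<noteq> Impedance" "B Side3 \<noteq> Impedance" using B by auto
    show "v (side_point j t) = 0" if "B j = Dirichlet" for j t
    proof (cases j)
      case Side1
      then show ?thesis using that d mode_boundary(1)[of d e] by (simp add: v_def tns_def)
    next
      case Side2
      then show ?thesis using that w1 by (simp add: v_def tns_def end_op_def)
    next
      case Side3
      then show ?thesis using that e mode_boundary(3)[of e d] by (simp add: v_def tns_def)
    qed (use that B(3) in simp)
    show "pd h v (side_point (sd h q) t) = 0" if Neu: "B (sd h q) = Neumann" for h q t
    proof (cases h)
      case True
      then have "q" "B Side2 = Neumann" using Neu B(3) by (cases q; simp add: sd_def)+
      then show ?thesis using True w1 by (simp add: vx tns_def end_op_def sd_def)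
    next
      case False
      then show ?thesis
        using Neu d e mode_boundary(2)[of d e] mode_boundary(4)[of e d]
        by (cases q) (simp_all add: vy tns_def sd_def)
    qed
    show "pd True v (side_point Side4 t) = \<i> * of_real k * v (side_point Side4 t)" for t
      unfolding vx unfolding v_def by (simp add: tns_def w0 sum_distrib_left mult.assoc)
    show "pd True v (side_point Side2 t) = - \<i> * of_real k * v (side_point Side2 t)"
      if "B Side2 = Impedance" for t
    proof -
      have "partial 1 (w n) 1 = - \<i> * of_real k * w n 1" for n
        using w1[of n] that by (simp add: end_op_def add_eq_0_iff2)
      then show ?thesis unfolding vx unfolding v_def by (simp add: tns_def sum_distrib_left mult.assoc)
    qed
  qed
  also have "cmod \<dots> \<le> L2_norm Q f * L2_norm Q v"
    using L2_Cauchy_Schwarz[OF f L2_cnj[OF smooth_L2[OF v]]] by (simp add: L2_norm_cnj)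
  also have "\<dots> \<le> L2_norm Q f * (C * L2_norm Q g)"
  proof (rule mult_left_mono)
    show "L2_norm Q v \<le> C * L2_norm Q g"
    proof (rule power2_le_imp_le)
      have "(L2_norm Q v)\<^sup>2 = (\<Sum>n\<in>N. (L2_norm J (w n))\<^sup>2 * (L2_norm J (cmode d e n))\<^sup>2)"
        unfolding v_def by (rule tensor_sum_norm[OF N smooth_continuous[OF sm]])
      also have "\<dots> \<le> (\<Sum>n\<in>N. (C * L2_norm J (\<lambda>x. poly (p n) (of_real x)))\<^sup>2 * (L2_norm J (cmode d e n))\<^sup>2)"
        by (intro sum_mono mult_right_mono power_mono C[OF w[THEN spec]]) simp_all
      also have "\<dots> = C\<^sup>2 * (\<Sum>n\<in>N. (L2_norm J (\<lambda>x. poly (p n) (of_real x)))\<^sup>2 * (L2_norm J (cmode d e n))\<^sup>2)"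
        by (simp add: power_mult_distrib sum_distrib_left mult.assoc)
      also have "\<dots> = (C * L2_norm Q g)\<^sup>2"
        unfolding g power_mult_distrib tensor_sum_norm[OF N smooth_continuous[OF smooth_poly]] ..
      finally show "(L2_norm Q v)\<^sup>2 \<le> (C * L2_norm Q g)\<^sup>2" .
    qed (simp add: C0)
  qed simp
  finally show ?thesis by (simp add: mult_ac)
qed

section \<open>Density of the sources of the adjoint problem\<close>

definition tensor_poly_mode :: "bool \<Rightarrow> bool \<Rightarrow> nat \<times> nat \<Rightarrow> real \<times> real \<Rightarrow> complex" where
  "tensor_poly_mode d e k = tns (\<lambda>x. of_real x ^ fst k) (cmode d e (snd k))"

text \<open>In x the coordinate itself separates points and maps monomials to monomials; in y the
  cosine is taken, as it preserves the span of the modes. Since constants are among the polynomials,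
  \<sigma> may depend on y alone.\<close>

lemma tensor_poly_mode_dense:
  assumes u: "u \<in> L2 Q" and \<epsilon>: "\<epsilon> > 0"
  obtains q where "q \<in> lin_span (tensor_poly_mode d e)" "q \<in> L2 Q" "L2_norm Q (\<lambda>z. u z - q z) < \<epsilon>"
proof -
  let ?K = "lin_span (tensor_poly_mode d e)"
  obtain m where m: "\<forall>t\<in>J. mode d e m t \<noteq> 0" using mode_nonzero[of d e] ..
  obtain q where "q \<in> ?K" "q \<in> L2 Q" "L2_norm Q (\<lambda>z. u z - q z) < \<epsilon>"
  proof (rule L2_square_dense[of ?K "\<lambda>t. t" "\<lambda>t. cos (pi * t)" "\<lambda>z. mode d e m (snd z)" u \<epsilon>])
    have x: "(\<lambda>z. of_real (fst z) * tensor_poly_mode d e k z) \<in> ?K" for k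
      using lin_span_base[of 1 "tensor_poly_mode d e" "(Suc (fst k), snd k)"]
      by (simp add: tensor_poly_mode_def tns_def mult.assoc)
    have y: "(\<lambda>z. of_real (cos (pi * snd z)) * tensor_poly_mode d e k z) \<in> ?K" for k
    proof -
      obtain c i where *: "\<And>t. cos (pi * t) * mode d e (snd k) t = 1 / 2 * mode d e (Suc (snd k)) t + c * mode d e i t"
        using mode_cos_product[of d e "snd k"] by blast
      have "of_real (cos (pi * snd z)) * tensor_poly_mode d e k z
        = of_real (fst z) ^ fst k * of_real (cos (pi * snd z) * mode d e (snd k) (snd z))" for z
        unfolding tensor_poly_mode_def tns_def by simp
      then have "of_real (cos (pi * snd z)) * tensor_poly_mode d e k z
        = of_real (1 / 2) * tensor_poly_mode d e (fst k, Suc (snd k)) z + of_real c * tensor_poly_mode d e (fst k, i) z" for z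
        unfolding * by (simp add: tensor_poly_mode_def tns_def algebra_simps)
      note eq = this
      show ?thesis unfolding eq by (rule lin_span_add[OF lin_span_base lin_span_base])
    qed
    show "(\<lambda>z. of_real (fst z) * f z) \<in> ?K" if "f \<in> ?K" for f by (rule lin_span_mult[OF x that])
    show "(\<lambda>z. of_real (cos (pi * snd z)) * f z) \<in> ?K" if "f \<in> ?K" for f by (rule lin_span_mult[OF y that])
    show "(\<lambda>z. of_real (mode d e m (snd z))) \<in> ?K"
      using lin_span_base[of 1 "tensor_poly_mode d e" "(0, m)"] by (simp add: tensor_poly_mode_def tns_def)
    have mc: "continuous_on UNIV (mode d e m)"
      by (rule DERIV_continuous_on[OF has_field_derivative_at_within[OF mode_has_derivative]])
    show "continuous_on UNIV (\<lambda>z::real \<times> real. mode d e m (snd z))"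
      by (intro continuous_on_compose2[OF mc] continuous_on_snd continuous_on_id) simp
    show "mode d e m (snd z) \<noteq> 0" if "z \<in> Q" for z
      using that m by (auto simp: unit_square_def mem_Times_iff)
  qed (simp_all only: u \<epsilon> cos_pi_inj lin_span_add lin_span_scale continuous_on_id inj_on_id2)
  then show thesis by (rule that)
qed

text \<open>Grouping by mode index collects the monomials in front of a mode into one polynomial,
  leaving one ordinary differential equation per mode.\<close>

lemma lin_span_tensor_poly_mode:
  assumes "q \<in> lin_span (tensor_poly_mode d e)"
  obtains N p where "finite N" "q = (\<lambda>z. \<Sum>n\<in>N. tns (\<lambda>x. poly (p n) (of_real x)) (cmode d e n) z)"
proof -
  from assms obtain A c where A: "finite A" and q: "q = (\<lambda>z. \<Sum>k\<in>A. c k * tensor_poly_mode d e k z)"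
    unfolding lin_span_def by auto
  define p where "p n = (\<Sum>k\<in>{k\<in>A. snd k = n}. monom (c k) (fst k))" for n
  have "q z = (\<Sum>n\<in>snd ` A. tns (\<lambda>x. poly (p n) (of_real x)) (cmode d e n) z)" for z
  proof -
    have "q z = (\<Sum>n\<in>snd ` A. \<Sum>k\<in>{k\<in>A. snd k = n}. c k * tensor_poly_mode d e k z)"
      unfolding q by (rule sum.image_gen[OF A])
    also have "\<dots> = (\<Sum>n\<in>snd ` A. tns (\<lambda>x. poly (p n) (of_real x)) (cmode d e n) z)"
      by (intro sum.cong refl)
        (simp add: p_def tensor_poly_mode_def tns_def poly_sum poly_monom sum_distrib_right mult.assoc)
    finally show ?thesis .
  qed
  then have "q = (\<lambda>z. \<Sum>n\<in>snd ` A. tns (\<lambda>x. poly (p n) (of_real x)) (cmode d e n) z)" by (rule ext)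
  then show thesis by (rule that[of "snd ` A" p, rotated]) (use A in simp)
qed

text \<open>Duality with the source \<open>u\<close> would give norm(u)^2 \<le> C norm(f) norm(u).
  It applies only to sources of a special form, so a nearby \<open>q\<close> of that form replaces
  \<open>u\<close>.\<close>

lemma weak_solution_L2_bound:
  assumes k: "k > 0" and f: "f \<in> L2 Q"
    and B: "B Side1 \<in> {Dirichlet, Neumann}" "B Side3 \<in> {Dirichlet, Neumann}" "B Side4 = Impedance"
    and sol: "weak_solution B k f u" and C0: "0 \<le> C"
    and C: "\<And>\<mu> w g. mode_solution k \<mu> (B Side2) w g \<Longrightarrow> L2_norm J w \<le> C * L2_norm J g"
  shows "L2_norm Q u \<le> C * L2_norm Q f"
proof (rule ccontr)
  let ?U = "L2_norm Q u" and ?F = "L2_norm Q f"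
  let ?d = "B Side1 = Dirichlet" and ?e = "B Side3 = Dirichlet"
  assume "\<not> ?U \<le> C * ?F"
  then have less: "C * ?F < ?U" by simp
  have CF: "0 \<le> C * ?F" using C0 by simp
  have U: "?U > 0" using less CF by linarith
  have uL: "u \<in> L2 Q" by (rule H1_L2[OF weak_solution_H1[OF sol]])
  \<comment> \<open>The approximation costs \<epsilon> twice, through \<open>u - q\<close> and
    through the norm of \<open>q\<close>, which makes the gap at most 2 \<epsilon>; a quarter of the
    gap therefore gives a contradiction.\<close>
  define \<epsilon> where "\<epsilon> = (?U - C * ?F) / 4"
  have \<epsilon>: "\<epsilon> > 0" "\<epsilon> \<le> ?U" "4 * \<epsilon> = ?U - C * ?F" using less CF U by (simp_all add: \<epsilon>_def)
  obtain q where q: "q \<in> lin_span (tensor_poly_mode ?d ?e)" and qL: "q \<in> L2 Q" and uq: "L2_norm Q (\<lambda>z. u z - q z) < \<epsilon>"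
    using tensor_poly_mode_dense[OF uL \<epsilon>(1)] .
  obtain N p where N: "finite N" and q_eq: "q = (\<lambda>z. \<Sum>n\<in>N. tns (\<lambda>x. poly (p n) (of_real x)) (cmode ?d ?e n) z)"
    using lin_span_tensor_poly_mode[OF q] .
  have d: "(\<lambda>z. u z - q z) \<in> L2 Q" by (rule L2_diff[OF uL qL])
  have "L2_norm Q q \<le> L2_norm Q (\<lambda>z. q z - u z) + ?U"
    using L2_norm_triangle[OF L2_diff[OF qL uL] uL] by simp
  then have qn: "L2_norm Q q \<le> ?U + \<epsilon>" using uq unfolding L2_norm_minus_commute[of Q q] by linarith
  have "of_real (?U\<^sup>2) = (LINT z|MQ. u z * cnj (u z - q z) + u z * cnj (q z))"
    unfolding L2_norm_sq_cnj by (intro Bochner_Integration.integral_cong refl) (simp add: algebra_simps)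
  also have "\<dots> = (LINT z|MQ. u z * cnj (u z - q z)) + (LINT z|MQ. u z * cnj (q z))"
    by (intro Bochner_Integration.integral_add L2_mult_integrable uL L2_cnj d qL)
  finally have eq: "of_real (?U\<^sup>2) = (LINT z|MQ. u z * cnj (u z - q z)) + (LINT z|MQ. u z * cnj (q z))" .
  have "?U\<^sup>2 = cmod (of_real (?U\<^sup>2))" by (simp only: norm_of_real abs_power2)
  also have "\<dots> \<le> cmod (LINT z|MQ. u z * cnj (u z - q z)) + cmod (LINT z|MQ. u z * cnj (q z))"
    unfolding eq by (rule norm_triangle_ineq)
  also have "cmod (LINT z|MQ. u z * cnj (u z - q z)) \<le> ?U * \<epsilon>"
  proof -
    have "cmod (LINT z|MQ. u z * cnj (u z - q z)) \<le> ?U * L2_norm Q (\<lambda>z. u z - q z)"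
      using L2_Cauchy_Schwarz[OF uL L2_cnj[OF d]] unfolding L2_norm_cnj .
    also have "\<dots> \<le> ?U * \<epsilon>" using uq by (intro mult_left_mono) simp_all
    finally show ?thesis .
  qed
  also have "cmod (LINT z|MQ. u z * cnj (q z)) \<le> C * ?F * L2_norm Q q"
    by (rule weak_solution_duality[OF k f B sol N C0 C refl refl q_eq])
  also have "\<dots> \<le> C * ?F * (?U + \<epsilon>)" using qn CF by (rule mult_left_mono)
  finally have "?U\<^sup>2 \<le> ?U * \<epsilon> + C * ?F * (?U + \<epsilon>)" by simp
  also have "C * ?F * (?U + \<epsilon>) = C * ?F * ?U + C * ?F * \<epsilon>" by (simp add: algebra_simps)
  also have "C * ?F * \<epsilon> \<le> ?U * \<epsilon>" using less \<epsilon>(1) by (intro mult_right_mono) simp_all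
  finally have "?U * (?U - C * ?F) \<le> ?U * (2 * \<epsilon>)" by (simp add: power2_eq_square algebra_simps)
  then have "?U - C * ?F \<le> 2 * \<epsilon>" using U by (rule mult_left_le_imp_le)
  then show False using \<epsilon> by linarith
qed

section \<open>From the \<open>L2\<close> bound to the gradient\<close>

lemma weak_solution_energy:
  assumes f: "f \<in> L2 Q" and sol: "weak_solution B k f u"
  shows "(grad_norm Q u)\<^sup>2 \<le> k\<^sup>2 * (L2_norm Q u)\<^sup>2 + L2_norm Q f * L2_norm Q u"
proof -
  note u = weak_solution_H1[OF sol]
  note uL = H1_L2[OF u] and gL = weak_partial_L2[OF u dir_Basis]
  \<comment> \<open>The impedance sides contribute -ik times this real number, which disappears in
    the real part.\<close>
  define S where "S = (\<Sum>j | B j = Impedance. (L2_norm J (trace j u))\<^sup>2)"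
  have S: "(\<Sum>j | B j = Impedance. LINT t|MJ. trace j u t * cnj (trace j u t)) = of_real S"
    unfolding S_def L2_norm_sq_cnj[symmetric] by simp
  have "(LINT x|MQ. (\<Sum>b\<in>Basis. weak_partial Q b u x * cnj (weak_partial Q b u x)) - of_real (k\<^sup>2) * u x * cnj (u x))
    = (LINT x|MQ. wpd True u x * cnj (wpd True u x)
       + wpd False u x * cnj (wpd False u x) - of_real (k\<^sup>2) * (u x * cnj (u x)))"
    by (simp add: Basis_dir dir_neq mult.assoc)
  also have "\<dots> = of_real ((L2_norm Q (wpd True u))\<^sup>2) + of_real ((L2_norm Q (wpd False u))\<^sup>2)
      - of_real (k\<^sup>2) * of_real ((L2_norm Q u)\<^sup>2)"
  proof -
    have "integrable MQ (\<lambda>x. wpd h u x * cnj (wpd h u x))" for h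
      by (intro L2_mult_integrable L2_cnj gL)
    moreover have "integrable MQ (\<lambda>x. u x * cnj (u x))"
      by (intro L2_mult_integrable L2_cnj uL)
    ultimately show ?thesis unfolding L2_norm_sq_cnj by simp
  qed
  also have "\<dots> = of_real ((grad_norm Q u)\<^sup>2 - k\<^sup>2 * (L2_norm Q u)\<^sup>2)"
    unfolding grad_norm_sq[OF gL] by simp
  finally have eq: "(LINT x|MQ. (\<Sum>b\<in>Basis. weak_partial Q b u x * cnj (weak_partial Q b u x)) - of_real (k\<^sup>2) * u x * cnj (u x))
    = of_real ((grad_norm Q u)\<^sup>2 - k\<^sup>2 * (L2_norm Q u)\<^sup>2)" .
  have "u \<in> energy_space B" using sol by (simp add: weak_solution_def)
  note sol[unfolded weak_solution_def, THEN conjunct2, THEN bspec, OF this, unfolded eq S]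
  from arg_cong[OF this, of Re]
  have "(grad_norm Q u)\<^sup>2 - k\<^sup>2 * (L2_norm Q u)\<^sup>2 = Re (LINT x|MQ. f x * cnj (u x))" by simp
  also have "\<dots> \<le> L2_norm Q f * L2_norm Q u"
    using complex_Re_le_cmod[of "LINT x|MQ. f x * cnj (u x)"] L2_Cauchy_Schwarz[OF f L2_cnj[OF uL]]
    unfolding L2_norm_cnj by linarith
  finally show ?thesis by simp
qed

text \<open>\<open>c * M\<close> is the constant of the \<open>L2\<close> bound and \<open>R\<close>
  the k-dependent factor of the final estimate: k M \<le> R handles k norm(u), and M \<le> R^2
  handles the product norm(f) norm(u) in the energy estimate. The gradient is then at most b R
  norm(f) with b^2 \<ge> c^2 + c, and \<open>K\<close> must dominate (c + b)^2.\<close>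

lemma weak_solution_bound:
  assumes f: "f \<in> L2 Q" and sol: "weak_solution B k f u" and k: "k > 0"
    and U: "L2_norm Q u \<le> c * M * L2_norm Q f" and c: "0 \<le> c" and R: "0 \<le> R" "k * M \<le> R" "M \<le> R\<^sup>2"
    and b: "0 \<le> b" "c\<^sup>2 + c \<le> b\<^sup>2" "(c + b)\<^sup>2 \<le> K"
  shows "grad_norm Q u + k * L2_norm Q u \<le> sqrt K * R * L2_norm Q f"
proof -
  let ?U = "L2_norm Q u" and ?F = "L2_norm Q f"
  have kU: "k * ?U \<le> c * R * ?F"
  proof -
    have "k * ?U \<le> k * (c * M * ?F)" using U k by (intro mult_left_mono) simp_all
    also have "\<dots> = (k * M) * (c * ?F)" by simp
    also have "\<dots> \<le> R * (c * ?F)" using R c by (intro mult_right_mono) simp_all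
    finally show ?thesis by (simp add: mult_ac)
  qed
  have "(grad_norm Q u)\<^sup>2 \<le> (k * ?U)\<^sup>2 + ?F * ?U"
    using weak_solution_energy[OF f sol] by (simp add: power_mult_distrib)
  also have "(k * ?U)\<^sup>2 \<le> (c * R * ?F)\<^sup>2" using kU k by (intro power_mono) simp_all
  also have "?F * ?U \<le> ?F * (c * M * ?F)" using U by (intro mult_left_mono) simp_all
  also have "\<dots> = M * (c * ?F\<^sup>2)" by (simp add: power2_eq_square)
  also have "\<dots> \<le> R\<^sup>2 * (c * ?F\<^sup>2)" using R c by (intro mult_right_mono) simp_all
  also have "(c * R * ?F)\<^sup>2 + R\<^sup>2 * (c * ?F\<^sup>2) = (c\<^sup>2 + c) * (R * ?F)\<^sup>2"
    by (simp add: power_mult_distrib distrib_right)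
  also have "\<dots> \<le> b\<^sup>2 * (R * ?F)\<^sup>2" using b(2) by (rule mult_right_mono) simp
  finally have "(grad_norm Q u)\<^sup>2 \<le> (b * R * ?F)\<^sup>2" by (simp add: power_mult_distrib mult.assoc)
  then have "grad_norm Q u \<le> b * R * ?F" by (rule power2_le_imp_le) (use b R in simp)
  with kU have "grad_norm Q u + k * ?U \<le> (c + b) * (R * ?F)" by (simp add: algebra_simps)
  also have "\<dots> \<le> sqrt K * (R * ?F)" using R by (intro mult_right_mono real_le_rsqrt b) simp
  finally show ?thesis by (simp add: mult.assoc)
qed

theorem theorem2p6:
  fixes k :: real
    and f u :: "real \<times> real \<Rightarrow> complex"
    and B :: "side \<Rightarrow> boundary_condition"
  assumes "k > 0"
    and "f \<in> L2 unit_square"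
    and "B Side1 \<in> {Dirichlet, Neumann}"
    and "B Side3 \<in> {Dirichlet, Neumann}"
    and "B Side2 \<in> {Dirichlet, Neumann, Impedance}"
    and "B Side4 = Impedance"
    and "weak_solution B k f u"
  shows "(B Side2 = Dirichlet \<longrightarrow> u \<in> H2 unit_square \<longrightarrow>
            grad_norm unit_square u + k * L2_norm unit_square u
              \<le> sqrt 30 * max (k\<^sup>2) 1 * L2_norm unit_square f)
       \<and> (B Side2 \<in> {Neumann, Impedance} \<longrightarrow> u \<in> H2 unit_square \<longrightarrow>
            grad_norm unit_square u + k * L2_norm unit_square u
              \<le> sqrt 542 * max (k\<^sup>2) (k powr (-1/2)) * L2_norm unit_square f)"
proof (intro conjI impI)
  note B = assms(3,4,6) and k = assms(1) and f = assms(2) and sol = assms(7)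
  {
    assume D: "B Side2 = Dirichlet"
    have U: "L2_norm Q u \<le> 5 / 2 * max k 1 * L2_norm Q f"
      by (rule weak_solution_L2_bound[OF k f B sol]) (simp, rule mode_solution.bound_Dirichlet, simp_all add: D)
    show "grad_norm Q u + k * L2_norm Q u \<le> sqrt 30 * max (k\<^sup>2) 1 * L2_norm Q f"
    \<comment> \<open>With c = 5/2, b must lie between sqrt(35)/2, about 2.958, and sqrt(30) - 5/2,
      about 2.977.\<close>
    proof (rule weak_solution_bound[OF f sol k U, where b = "297 / 100"])
      show "k * max k 1 \<le> max (k\<^sup>2) 1" using k by (cases "k \<le> 1") (simp_all add: max_def power2_eq_square mult_le_one)
      have "max k 1 \<le> max (k\<^sup>2) 1" using self_le_power[of k 2] by (auto simp: max_def)
      also have "\<dots> \<le> (max (k\<^sup>2) 1)\<^sup>2" by (rule self_le_power) simp_all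
      finally show "max k 1 \<le> (max (k\<^sup>2) 1)\<^sup>2" .
    qed (simp_all add: power2_eq_square)
  next
    assume "B Side2 \<in> {Neumann, Impedance}"
    have U: "L2_norm Q u \<le> 9 * max k (1 / k) * L2_norm Q f"
      by (rule weak_solution_L2_bound[OF k f B sol]) (use k in simp, rule mode_solution.bound_general)
    show "grad_norm Q u + k * L2_norm Q u \<le> sqrt 542 * max (k\<^sup>2) (k powr (-1/2)) * L2_norm Q f"
    \<comment> \<open>With c = 9 the conditions read 90 \<le> 10^2 and (9 + 10)^2 = 361 \<le>
      542.\<close>
    proof (rule weak_solution_bound[OF f sol k U, where b = 10])
      define r where "r = k powr (-1/2)"
      have "r\<^sup>2 = k powr (2 * (-1/2))" unfolding r_def using k by (simp add: powr_power)
      then have r2: "r\<^sup>2 = 1 / k" using k by (simp add: powr_minus_divide)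
      have r: "r > 0" using k by (simp add: r_def)
      show "k * max k (1 / k) \<le> max (k\<^sup>2) (k powr (-1/2))"
      proof (cases "k \<ge> 1")
        case False
        then have "1 \<le> 1 / k" using k by simp
        then have "1\<^sup>2 \<le> r\<^sup>2" by (simp add: r2)
        then have "1 \<le> r" by (rule power2_le_imp_le) (use r in simp)
        moreover have "k \<le> 1 / k" using \<open>1 \<le> 1 / k\<close> False by linarith
        then have "k * max k (1 / k) = 1" using k by (simp add: max_def)
        ultimately show ?thesis unfolding r_def[symmetric] by simp
      next
        case True
        then have "1 / k \<le> 1" using k by simp
        with True have "1 / k \<le> k" by linarith
        then have "k * max k (1 / k) = k\<^sup>2" by (simp add: max_def power2_eq_square)
        then show ?thesis by simp
      qed
      \<comment> \<open>The square of k^(-1/2) is exactly 1/k, which is what fixes the exponent; for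
        k \<ge> 1 the other term satisfies k \<le> k^4.\<close>
      show "max k (1 / k) \<le> (max (k\<^sup>2) (k powr (-1/2)))\<^sup>2"
        unfolding r_def[symmetric]
      proof (rule max.boundedI)
        have "1 / k = r\<^sup>2" by (rule r2[symmetric])
        also have "\<dots> \<le> (max (k\<^sup>2) r)\<^sup>2" using r by (intro power_mono) simp_all
        finally show 1: "1 / k \<le> (max (k\<^sup>2) r)\<^sup>2" .
        show "k \<le> (max (k\<^sup>2) r)\<^sup>2"
        proof (cases "k \<ge> 1")
          case True
          then have "k \<le> k ^ 4" by (rule self_le_power) simp
          also have "\<dots> = (k\<^sup>2)\<^sup>2" by simp
          also have "\<dots> \<le> (max (k\<^sup>2) r)\<^sup>2" by (intro power_mono) simp_all
          finally show ?thesis .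
        next
          case False
          then have "1 \<le> 1 / k" using k by simp
          with False have "k \<le> 1 / k" by linarith
          with 1 show ?thesis by simp
        qed
      qed
    qed (simp_all add: power2_eq_square le_max_iff_disj)
  }
qed

end
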